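(* Let $L_T$ be a trend-admissible operator of order $N_T\ge0$, $L_S$ a seasonal-admissible operator of order $N_S\ge0$, and $1\le p\le\infty$. The seasonal-trend native space $\mathcal{M}(L_T,L_S)$ is a Banach space for the norm $$\|(f_T,f_S)\|_{\mathcal{M}(L_T,L_S),p}=\left(\|f_T\|_{\mathcal{M}_{L_T}(\mathbb{R})}^p+\|f_S\|_{\mathcal{M}_{L_S}(\mathbb{T})}^p\right)^{1/p}$$ if $p<\infty$, and $$\|(f_T,f_S)\|_{\mathcal{M}(L_T,L_S),\infty}=\max\left(\|f_T\|_{\mathcal{M}_{L_T}(\mathbb{R})},\|f_S\|_{\mathcal{M}_{L_S}(\mathbb{T})}\right)$$ if $p=\infty$.
   Context: $\mathbb{T}=\mathbb{R}/\mathbb{Z}$. $\mathcal{S}'(\mathbb{R})$ is the space of tempered distributions and $\mathcal{S}'(\mathbb{T})$ the space of $1$-periodic distributions (dual of the smooth $1$-periodic functions $\mathcal{S}(\mathbb{T})$), both with the weak*-topology; generalized functions are real-valued. $\mathcal{M}(\mathbb{R})$ is the space of finite Radon measures on $\mathbb{R}$ (dual of $\mathcal{C}_0(\mathbb{R})$), $\mathcal{M}(\mathbb{T})$ the dual of $\mathcal{C}(\mathbb{T})$, both with total variation norm. $\mathrm{D}$ is the derivative; LSI means linear and shift-invariant; for $f\in\mathcal{S}'(\mathbb{T})$, $\widehat f[0]=\langle f,1\rangle$. Trend-admissible of order $N_T\ge0$: an LSI continuous operator $L_T:\mathcal{S}'(\mathbb{R})\to\mathcal{S}'(\mathbb{R})$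 (mapping real generalized functions to real ones) of the form $L_T=\mathrm{D}^{N_T}L_{\mathrm{inv},T}$, where $L_{\mathrm{inv},T}:\mathcal{S}'(\mathbb{R})\to\mathcal{S}'(\mathbb{R})$ is LSI, continuous, with LSI continuous inverse. Seasonal-admissible of order $N_S\ge0$: an LSI continuous operator $L_S:\mathcal{S}'(\mathbb{T})\to\mathcal{S}'(\mathbb{T})$ of the form $L_S=\mathrm{D}^{N_S}L_{\mathrm{inv},S}$ with $L_{\mathrm{inv},S}:\mathcal{S}'(\mathbb{T})\to\mathcal{S}'(\mathbb{T})$ LSI, continuous, with LSI continuous inverse. $\mathcal{M}_{L_T}(\mathbb{R})=\{f\in\mathcal{S}'(\mathbb{R}):L_Tf\in\mathcal{M}(\mathbb{R})\}$, with norm $\|f\|_{\mathcal{M}_{L_T}(\mathbb{R})}=\|L_Tf\|_{\mathcal{M}(\mathbb{R})}$ if $N_T=0$ and $\|f\|_{\mathcal{M}_{L_T}(\mathbb{R})}=\|L_Tf\|_{\mathcal{M}(\mathbb{R})}+\|(\langle f,\theta_n\rangle)_{1\le n\le N_T}\|_2$ if $N_T\ge1$, where $\theta_1,\dots,\theta_{N_T}\in\mathcal{S}(\mathbb{R})$ are fixed with $\int\theta_n(t)t^{m-1}dt=\delta_{nm}$ (Kronecker). $\mathcal{M}_{L_S}(\mathbb{T})=\{f\in\mathcal{S}'(\mathbb{T}):L_Sf\in\mathcal{M}(\mathbb{T})\}$, with norm $\|f\|_{\mathcal{M}_{L_S}(\mathbb{T})}=\|L_Sf\|_{\mathcal{M}(\mathbb{T})}$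 if $N_S=0$ and $\|L_Sf\|_{\mathcal{M}(\mathbb{T})}+|\widehat f[0]|$ if $N_S\ge1$. $\mathcal{M}_{L_S,0}(\mathbb{T})=\{f\in\mathcal{M}_{L_S}(\mathbb{T}):\widehat f[0]=0\}$ with the same norm. $\mathcal{M}(L_T,L_S)=\mathcal{M}_{L_T}(\mathbb{R})\times\mathcal{M}_{L_S}(\mathbb{T})$ if $N_T=0$ and $\mathcal{M}_{L_T}(\mathbb{R})\times\mathcal{M}_{L_S,0}(\mathbb{T})$ if $N_T\ge1$. *)

theory Defs
  imports "HOL-Analysis.Analysis"
begin

section \<open>Topologies generated by seminorms\<close>

definition seminorm_open :: "('i \<Rightarrow> 'a::real_vector \<Rightarrow> real) \<Rightarrow> 'a set \<Rightarrow> bool" where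
  "seminorm_open p U \<longleftrightarrow>
     (\<forall>f\<in>U. \<exists>F \<epsilon>. finite F \<and> \<epsilon> > 0 \<and> (\<forall>g. (\<forall>i\<in>F. p i (g - f) < \<epsilon>) \<longrightarrow> g \<in> U))"

lemma seminorm_openE:
  assumes "seminorm_open p U" "f \<in> U"
  obtains F \<epsilon> where "finite F" "\<epsilon> > 0" "\<forall>g. (\<forall>i\<in>F. p i (g - f) < \<epsilon>) \<longrightarrow> g \<in> U"
proof -
  have "\<exists>F \<epsilon>. finite F \<and> \<epsilon> > 0 \<and> (\<forall>g. (\<forall>i\<in>F. p i (g - f) < \<epsilon>) \<longrightarrow> g \<in> U)"
    using assms by (simp add: seminorm_open_def)
  then show thesis
    by (elim exE conjE) (rule that)
qed

lemma seminorm_open_UNIV: "seminorm_open p UNIV"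
  unfolding seminorm_open_def by (intro ballI exI[of _ "{}"] exI[of _ "1::real"]) simp

lemma seminorm_open_Int:
  assumes "seminorm_open p U" "seminorm_open p V"
  shows "seminorm_open p (U \<inter> V)"
  unfolding seminorm_open_def
proof
  fix f assume f: "f \<in> U \<inter> V"
  obtain F \<epsilon> where F: "finite F" "\<epsilon> > 0" "\<forall>g. (\<forall>i\<in>F. p i (g - f) < \<epsilon>) \<longrightarrow> g \<in> U"
    using assms(1) IntD1[OF f] by (rule seminorm_openE)
  obtain G \<delta> where G: "finite G" "\<delta> > 0" "\<forall>g. (\<forall>i\<in>G. p i (g - f) < \<delta>) \<longrightarrow> g \<in> V"
    using assms(2) IntD2[OF f] by (rule seminorm_openE)
  have "\<forall>g. (\<forall>i\<in>F \<union> G. p i (g - f) < min \<epsilon> \<delta>) \<longrightarrow> g \<in> U \<inter> V"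
    using F(3) G(3) by auto
  moreover have "min \<epsilon> \<delta> > 0" "finite (F \<union> G)"
    using F G by auto
  ultimately show "\<exists>F \<epsilon>. finite F \<and> \<epsilon> > 0 \<and> (\<forall>g. (\<forall>i\<in>F. p i (g - f) < \<epsilon>) \<longrightarrow> g \<in> U \<inter> V)"
    by (intro exI[of _ "F \<union> G"] exI[of _ "min \<epsilon> \<delta>"]) simp
qed

lemma seminorm_open_Union:
  assumes "\<forall>U\<in>K. seminorm_open p U"
  shows "seminorm_open p (\<Union>K)"
  unfolding seminorm_open_def
proof
  fix f assume "f \<in> \<Union>K"
  then obtain U where U: "U \<in> K" "f \<in> U" by blast
  then have "seminorm_open p U" using assms by simp
  from this U(2) obtain F \<epsilon>
    where "finite F" "\<epsilon> > 0" "\<forall>g. (\<forall>i\<in>F. p i (g - f) < \<epsilon>) \<longrightarrow> g \<in> U"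
    by (rule seminorm_openE)
  then show "\<exists>F \<epsilon>. finite F \<and> \<epsilon> > 0 \<and> (\<forall>g. (\<forall>i\<in>F. p i (g - f) < \<epsilon>) \<longrightarrow> g \<in> \<Union>K)"
    using U(1) by (intro exI[of _ F] exI[of _ \<epsilon>]) auto
qed

lemma seminorm_open_vimage:
  fixes T :: "'a::real_vector \<Rightarrow> 'b::real_vector"
  assumes "linear T" and V: "seminorm_open q V"
    and kC: "\<And>j. C j \<ge> 0" "\<And>j f. q j (T f) \<le> C j * p (k j) f"
  shows "seminorm_open p (T -` V)"
  unfolding seminorm_open_def
proof
  fix f assume "f \<in> T -` V"
  then have "T f \<in> V" by simp
  from V this obtain F \<epsilon>
    where F: "finite F" "\<epsilon> > 0" "\<forall>g. (\<forall>i\<in>F. q i (g - T f) < \<epsilon>) \<longrightarrow> g \<in> V"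
    by (rule seminorm_openE)
  define S where "S = 1 + (\<Sum>j\<in>F. C j)"
  have S: "S > 0" unfolding S_def using kC(1) by (simp add: add_pos_nonneg sum_nonneg)
  have "g \<in> T -` V" if g: "\<forall>i\<in>k ` F. p i (g - f) < \<epsilon> / S" for g
  proof -
    have "q j (T g - T f) < \<epsilon>" if j: "j \<in> F" for j
    proof -
      have "C j \<le> (\<Sum>j\<in>F. C j)" using F(1) j kC(1) by (simp add: member_le_sum)
      then have CS: "C j < S" by (simp add: S_def)
      have "q j (T g - T f) \<le> C j * p (k j) (g - f)"
        using kC(2)[of j "g - f"] by (simp add: linear_diff[OF assms(1)])
      also have "\<dots> \<le> C j * (\<epsilon> / S)"
        using g j kC(1) by (intro mult_left_mono) (auto intro: less_imp_le)
      also have "\<dots> < \<epsilon>"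
        using CS S F(2) by (simp add: field_simps)
      finally show ?thesis .
    qed
    then show ?thesis using F(3) by auto
  qed
  moreover have "finite (k ` F)" "\<epsilon> / S > 0" using F S by auto
  ultimately show "\<exists>F \<epsilon>. finite F \<and> \<epsilon> > 0 \<and> (\<forall>g. (\<forall>i\<in>F. p i (g - f) < \<epsilon>) \<longrightarrow> g \<in> T -` V)"
    by (intro exI[of _ "k ` F"] exI[of _ "\<epsilon> / S"]) simp
qed

lemma seminorm_open_vimage_real:
  fixes u :: "'a::real_vector \<Rightarrow> real"
  assumes "linear u" and V: "open V" and "C \<ge> 0" and bd: "\<And>f. \<bar>u f\<bar> \<le> C * p i f"
  shows "seminorm_open p (u -` V)"
  unfolding seminorm_open_def
proof
  fix f assume "f \<in> u -` V"
  then obtain \<epsilon> where e: "\<epsilon> > 0" "ball (u f) \<epsilon> \<subseteq> V"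
    using V openE by blast
  have "g \<in> u -` V" if g: "\<forall>i\<in>{i}. p i (g - f) < \<epsilon> / (1 + C)" for g
  proof -
    have "\<bar>u g - u f\<bar> \<le> C * p i (g - f)"
      using bd[of "g - f"] by (simp add: linear_diff[OF assms(1)])
    also have "\<dots> \<le> C * (\<epsilon> / (1 + C))"
      using g \<open>C \<ge> 0\<close> by (intro mult_left_mono) auto
    also have "\<dots> < \<epsilon>"
      using \<open>C \<ge> 0\<close> e(1) by (simp add: field_simps)
    finally have "u g \<in> ball (u f) \<epsilon>" by (simp add: dist_real_def abs_minus_commute)
    then show ?thesis using e(2) by auto
  qed
  moreover have "\<epsilon> / (1 + C) > 0" using e \<open>C \<ge> 0\<close> by auto
  ultimately show "\<exists>F \<epsilon>. finite F \<and> \<epsilon> > 0 \<and> (\<forall>g. (\<forall>i\<in>F. p i (g - f) < \<epsilon>) \<longrightarrow> g \<in> u -` V)"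
    by (intro exI[of _ "{i}"] exI[of _ "\<epsilon> / (1 + C)"]) simp
qed


section \<open>Test functions and generalized functions\<close>

text \<open>All test functions are real-valued, so that their continuous linear functionals are
  exactly the real-valued generalized functions. The function \<open>shift_test h \<phi>\<close> is
  \<open>\<phi>(\<cdot> + h)\<close>.\<close>

class test_space = real_vector + topological_space +
  fixes deriv_test :: "'a \<Rightarrow> 'a"
    and shift_test :: "real \<Rightarrow> 'a \<Rightarrow> 'a"
  assumes deriv_test_add: "deriv_test (\<phi> + \<psi>) = deriv_test \<phi> + deriv_test \<psi>"
    and deriv_test_scaleR: "deriv_test (scaleR c \<phi>) = scaleR c (deriv_test \<phi>)"
    and open_vimage_deriv_test: "open U \<Longrightarrow> open (deriv_test -` U)"
    and shift_test_add: "shift_test h (\<phi> + \<psi>) = shift_test h \<phi> + shift_test h \<psi>"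
    and shift_test_scaleR: "shift_test h (scaleR c \<phi>) = scaleR c (shift_test h \<phi>)"
    and open_vimage_shift_test: "open U \<Longrightarrow> open (shift_test h -` U)"

lemma continuous_deriv_test: "continuous_on UNIV (deriv_test :: 'a::test_space \<Rightarrow> 'a)"
  and continuous_shift_test: "continuous_on UNIV (shift_test h :: 'a::test_space \<Rightarrow> 'a)"
  by (simp_all add: continuous_on_open_vimage open_vimage_deriv_test open_vimage_shift_test)

typedef (overloaded) 'a dual =
  "{u :: 'a::{real_vector, topological_space} \<Rightarrow> real. linear u \<and> continuous_on UNIV u}"
  morphisms pairing Abs_dual
  by (intro exI[of _ "\<lambda>_. 0"]) (auto intro: linearI)

setup_lifting type_definition_dual

lemma linear_cmult: "linear u \<Longrightarrow> linear (\<lambda>\<phi>. c * u \<phi>)" for u :: "'a::real_vector \<Rightarrow> real"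
  using linear_compose_scale_right[of u c] by simp

lemma dual_eqI: "(\<And>\<phi>. pairing u \<phi> = pairing v \<phi>) \<Longrightarrow> u = v"
  by transfer auto

lemma linear_pairing: "linear (pairing u)"
  and continuous_on_pairing: "continuous_on UNIV (pairing u)"
  using pairing[of u] by auto

instantiation dual :: ("{real_vector, topological_space}") real_vector
begin

lift_definition zero_dual :: "'a dual" is "\<lambda>_. 0"
  by (auto intro: linearI)

lift_definition plus_dual :: "'a dual \<Rightarrow> 'a dual \<Rightarrow> 'a dual" is "\<lambda>u v \<phi>. u \<phi> + v \<phi>"
  by (simp add: linear_compose_add continuous_on_add)

lift_definition minus_dual :: "'a dual \<Rightarrow> 'a dual \<Rightarrow> 'a dual" is "\<lambda>u v \<phi>. u \<phi> - v \<phi>"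
  by (simp add: linear_compose_sub continuous_on_diff)

lift_definition uminus_dual :: "'a dual \<Rightarrow> 'a dual" is "\<lambda>u \<phi>. - u \<phi>"
  by (simp add: linear_compose_neg continuous_on_minus)

lift_definition scaleR_dual :: "real \<Rightarrow> 'a dual \<Rightarrow> 'a dual" is "\<lambda>c u \<phi>. c * u \<phi>"
  by (simp add: linear_cmult continuous_on_mult_left)

instance
  by standard
    (rule dual_eqI; simp add: zero_dual.rep_eq plus_dual.rep_eq minus_dual.rep_eq
      uminus_dual.rep_eq scaleR_dual.rep_eq algebra_simps)+

end

text \<open>The weak* topology: the initial topology of the map \<open>u \<mapsto> (\<phi> \<mapsto> \<langle>u, \<phi>\<rangle>)\<close> into the
  function space with the topology of pointwise convergence.\<close>

instantiation dual :: ("{real_vector, topological_space}") topological_space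
begin

definition open_dual :: "'a dual set \<Rightarrow> bool" where
  "open_dual U \<longleftrightarrow> (\<exists>V :: ('a \<Rightarrow> real) set. open V \<and> U = pairing -` V)"

instance
proof
  show "open (UNIV :: 'a dual set)"
    unfolding open_dual_def by (rule exI[of _ UNIV]) auto
next
  fix S T :: "'a dual set"
  assume "open S" and T: "open T"
  from \<open>open S\<close> obtain V :: "('a \<Rightarrow> real) set" where V: "open V" "S = pairing -` V"
    unfolding open_dual_def by (elim exE conjE)
  from T obtain W :: "('a \<Rightarrow> real) set" where W: "open W" "T = pairing -` W"
    unfolding open_dual_def by (elim exE conjE)
  show "open (S \<inter> T)"
    unfolding open_dual_def using V W by (intro exI[of _ "V \<inter> W"]) (simp add: open_Int)
next
  fix K :: "'a dual set set"
  assume K: "\<forall>S\<in>K. open S"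
  define V where "V S = (SOME V :: ('a \<Rightarrow> real) set. open V \<and> S = pairing -` V)" for S
  have V: "open (V S) \<and> S = pairing -` V S" if "S \<in> K" for S
    unfolding V_def by (rule someI_ex) (use K that in \<open>simp add: open_dual_def\<close>)
  have "open (\<Union>S\<in>K. V S)" using V by (intro open_UN) simp
  moreover have "\<Union>K = pairing -` (\<Union>S\<in>K. V S)" using V by auto
  ultimately show "open (\<Union>K)" unfolding open_dual_def by (intro exI conjI)
qed

end

lift_definition deriv_dist :: "'a::test_space dual \<Rightarrow> 'a dual" is "\<lambda>u \<phi>. - u (deriv_test \<phi>)"
proof -
  fix u :: "'a \<Rightarrow> real"
  assume "linear u \<and> continuous_on UNIV u"
  moreover have "linear (deriv_test :: 'a \<Rightarrow> 'a)"
    by (intro linearI deriv_test_add deriv_test_scaleR)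
  ultimately show "linear (\<lambda>\<phi>. - u (deriv_test \<phi>)) \<and> continuous_on UNIV (\<lambda>\<phi>. - u (deriv_test \<phi>))"
    using linear_compose_neg[OF linear_compose[of deriv_test u]]
      continuous_on_minus[OF continuous_on_compose2[OF _ continuous_deriv_test], of UNIV u]
    by (simp add: o_def)
qed

text \<open>\<open>shift_dist h u\<close> is \<open>u(\<cdot> - h)\<close>.\<close>

lift_definition shift_dist :: "real \<Rightarrow> 'a::test_space dual \<Rightarrow> 'a dual"
  is "\<lambda>h u \<phi>. u (shift_test h \<phi>)"
proof -
  fix h and u :: "'a \<Rightarrow> real"
  assume "linear u \<and> continuous_on UNIV u"
  moreover have "linear (shift_test h :: 'a \<Rightarrow> 'a)"
    by (intro linearI shift_test_add shift_test_scaleR)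
  ultimately show "linear (\<lambda>\<phi>. u (shift_test h \<phi>)) \<and> continuous_on UNIV (\<lambda>\<phi>. u (shift_test h \<phi>))"
    using linear_compose[of "shift_test h" u] continuous_on_compose2[OF _ continuous_shift_test, of UNIV u]
    by (simp add: o_def)
qed


section \<open>Admissible operators\<close>

definition lsi :: "('a::test_space dual \<Rightarrow> 'a dual) \<Rightarrow> bool" where
  "lsi L \<longleftrightarrow> linear L \<and> (\<forall>h u. L (shift_dist h u) = shift_dist h (L u))"

definition lsi_continuous :: "('a::test_space dual \<Rightarrow> 'a dual) \<Rightarrow> bool" where
  "lsi_continuous L \<longleftrightarrow> lsi L \<and> continuous_on UNIV L"

definition admissible :: "nat \<Rightarrow> ('a::test_space dual \<Rightarrow> 'a dual) \<Rightarrow> bool" where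
  "admissible N L \<longleftrightarrow> lsi_continuous L \<and>
     (\<exists>L\<^sub>i\<^sub>n\<^sub>v. lsi_continuous L\<^sub>i\<^sub>n\<^sub>v \<and> bij L\<^sub>i\<^sub>n\<^sub>v \<and> lsi_continuous (inv L\<^sub>i\<^sub>n\<^sub>v) \<and>
        L = (deriv_dist ^^ N) \<circ> L\<^sub>i\<^sub>n\<^sub>v)"


section \<open>Smooth functions on the real line\<close>

definition smooth :: "(real \<Rightarrow> real) \<Rightarrow> bool" where
  "smooth f \<longleftrightarrow> (\<forall>n x. (deriv ^^ n) f field_differentiable at x)"

lemma smooth_D: "smooth f \<Longrightarrow> (deriv ^^ n) f field_differentiable at x"
  by (simp add: smooth_def)

lemma higher_deriv_continuous: "smooth f \<Longrightarrow> continuous_on S ((deriv ^^ n) f)"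
  by (intro continuous_at_imp_continuous_on ballI field_differentiable_imp_continuous_at smooth_D)

lemma higher_deriv_add:
  assumes "smooth f" "smooth g"
  shows "(deriv ^^ n) (\<lambda>x. f x + g x) = (\<lambda>x. (deriv ^^ n) f x + (deriv ^^ n) g x)"
proof (induction n)
  case (Suc n)
  have "(deriv ^^ Suc n) (\<lambda>x. f x + g x) = deriv (\<lambda>x. (deriv ^^ n) f x + (deriv ^^ n) g x)"
    by (simp add: Suc.IH)
  also have "\<dots> = (\<lambda>x. (deriv ^^ Suc n) f x + (deriv ^^ Suc n) g x)"
    by (rule ext) (simp add: smooth_D assms)
  finally show ?case .
qed simp

lemma higher_deriv_cmult:
  assumes "smooth f"
  shows "(deriv ^^ n) (\<lambda>x. c * f x) = (\<lambda>x. c * (deriv ^^ n) f x)"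
proof (induction n)
  case (Suc n)
  have "(deriv ^^ Suc n) (\<lambda>x. c * f x) = deriv (\<lambda>x. c * (deriv ^^ n) f x)"
    by (simp add: Suc.IH)
  also have "\<dots> = (\<lambda>x. c * (deriv ^^ Suc n) f x)"
    by (rule ext) (simp add: smooth_D assms)
  finally show ?case .
qed simp

lemma higher_deriv_zero: "(deriv ^^ n) (\<lambda>x. 0 :: real) = (\<lambda>x. 0)"
  by (induction n) auto

lemma higher_deriv_one: "(deriv ^^ n) (\<lambda>x. 1 :: real) = (\<lambda>x. if n = 0 then 1 else 0)"
  by (induction n) auto

lemma field_differentiable_shift:
  fixes f :: "real \<Rightarrow> real"
  assumes "f field_differentiable at (x + h)"
  shows "(\<lambda>x. f (x + h)) field_differentiable at x"
    and "deriv (\<lambda>x. f (x + h)) x = deriv f (x + h)"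
proof -
  have "((\<lambda>x. f (x + h)) has_field_derivative deriv f (x + h)) (at x)"
    using assms DERIV_shift[of f "deriv f (x + h)" x h] by (simp add: DERIV_deriv_iff_field_differentiable)
  then show "(\<lambda>x. f (x + h)) field_differentiable at x" "deriv (\<lambda>x. f (x + h)) x = deriv f (x + h)"
    by (auto simp: field_differentiable_def DERIV_imp_deriv)
qed

lemma higher_deriv_shift:
  assumes "smooth f"
  shows "(deriv ^^ n) (\<lambda>x. f (x + h)) = (\<lambda>x. (deriv ^^ n) f (x + h))"
proof (induction n)
  case (Suc n)
  have "(deriv ^^ Suc n) (\<lambda>x. f (x + h)) = deriv (\<lambda>x. (deriv ^^ n) f (x + h))"
    by (simp add: Suc.IH)
  also have "\<dots> = (\<lambda>x. (deriv ^^ Suc n) f (x + h))"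
    by (rule ext) (simp add: smooth_D field_differentiable_shift assms)
  finally show ?case .
qed simp

lemma higher_deriv_deriv: "(deriv ^^ n) (deriv f) = (deriv ^^ Suc n) f"
  by (simp only: funpow_Suc_right o_apply)

lemma smooth_add: "smooth f \<Longrightarrow> smooth g \<Longrightarrow> smooth (\<lambda>x. f x + g x)"
  by (simp add: smooth_def[of "\<lambda>x. f x + g x"] higher_deriv_add smooth_D field_differentiable_add)

lemma smooth_cmult: "smooth f \<Longrightarrow> smooth (\<lambda>x. c * f x)"
  by (simp add: smooth_def[of "\<lambda>x. c * f x"] higher_deriv_cmult smooth_D field_differentiable_mult)

lemma deriv_add_smooth: "smooth f \<Longrightarrow> smooth g \<Longrightarrow> deriv (\<lambda>x. f x + g x) x = deriv f x + deriv g x"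
  using smooth_D[of f 0 x] smooth_D[of g 0 x] by simp

lemma deriv_cmult_smooth: "smooth f \<Longrightarrow> deriv (\<lambda>x. c * f x) x = c * deriv f x"
  using smooth_D[of f 0 x] by simp

lemma smooth_zero: "smooth (\<lambda>x. 0)"
  by (simp add: smooth_def higher_deriv_zero)

lemma smooth_one: "smooth (\<lambda>x. 1)"
  by (simp add: smooth_def higher_deriv_one)

lemma smooth_shift: "smooth f \<Longrightarrow> smooth (\<lambda>x. f (x + h))"
  by (simp add: smooth_def[of "\<lambda>x. f (x + h)"] higher_deriv_shift smooth_D field_differentiable_shift)

lemma smooth_deriv: "smooth f \<Longrightarrow> smooth (deriv f)"
  unfolding smooth_def higher_deriv_deriv by blast


section \<open>Schwartz functions\<close>

text \<open>The weights \<open>(1 + \<bar>x\<bar>) ^ m\<close> give the same space and the same topology as \<open>\<bar>x\<bar> ^ m\<close>.\<close>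

typedef schwartz = "{f :: real \<Rightarrow> real.
    smooth f \<and> (\<forall>m n. bounded (range (\<lambda>x. (1 + \<bar>x\<bar>) ^ m * (deriv ^^ n) f x)))}"
  morphisms schwartz_apply Abs_schwartz
  by (intro exI[of _ "\<lambda>_. 0"]) (auto simp: smooth_zero higher_deriv_zero bounded_iff)

setup_lifting type_definition_schwartz

lemma schwartz_eqI: "(\<And>x. schwartz_apply f x = schwartz_apply g x) \<Longrightarrow> f = g"
  by transfer auto

lemma smooth_schwartz: "smooth (schwartz_apply f)"
  and bounded_schwartz: "bounded (range (\<lambda>x. (1 + \<bar>x\<bar>) ^ m * (deriv ^^ n) (schwartz_apply f) x))"
  using schwartz_apply[of f] by auto

instantiation schwartz :: real_vector
begin

lift_definition zero_schwartz :: schwartz is "\<lambda>_. 0"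
  by (auto simp: smooth_zero higher_deriv_zero bounded_iff)

lift_definition plus_schwartz :: "schwartz \<Rightarrow> schwartz \<Rightarrow> schwartz" is "\<lambda>f g x. f x + g x"
proof -
  fix f g :: "real \<Rightarrow> real"
  assume f: "smooth f \<and> (\<forall>m n. bounded (range (\<lambda>x. (1 + \<bar>x\<bar>) ^ m * (deriv ^^ n) f x)))"
    and g: "smooth g \<and> (\<forall>m n. bounded (range (\<lambda>x. (1 + \<bar>x\<bar>) ^ m * (deriv ^^ n) g x)))"
  have "bounded (range (\<lambda>x. (1 + \<bar>x\<bar>) ^ m * (deriv ^^ n) (\<lambda>x. f x + g x) x))" for m n
    using bounded_plus_comp[of "\<lambda>x. (1 + \<bar>x\<bar>) ^ m * (deriv ^^ n) f x" UNIV
        "\<lambda>x. (1 + \<bar>x\<bar>) ^ m * (deriv ^^ n) g x"] f g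
    by (simp add: higher_deriv_add distrib_left)
  then show "smooth (\<lambda>x. f x + g x) \<and>
      (\<forall>m n. bounded (range (\<lambda>x. (1 + \<bar>x\<bar>) ^ m * (deriv ^^ n) (\<lambda>x. f x + g x) x)))"
    using f g by (simp add: smooth_add)
qed

lift_definition scaleR_schwartz :: "real \<Rightarrow> schwartz \<Rightarrow> schwartz" is "\<lambda>c f x. c * f x"
proof -
  fix c and f :: "real \<Rightarrow> real"
  assume f: "smooth f \<and> (\<forall>m n. bounded (range (\<lambda>x. (1 + \<bar>x\<bar>) ^ m * (deriv ^^ n) f x)))"
  have "bounded (range (\<lambda>x. (1 + \<bar>x\<bar>) ^ m * (deriv ^^ n) (\<lambda>x. c * f x) x))" for m n
    using bounded_scaleR_comp[of "\<lambda>x. (1 + \<bar>x\<bar>) ^ m * (deriv ^^ n) f x" UNIV c] f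
    by (simp add: higher_deriv_cmult mult.left_commute)
  then show "smooth (\<lambda>x. c * f x) \<and>
      (\<forall>m n. bounded (range (\<lambda>x. (1 + \<bar>x\<bar>) ^ m * (deriv ^^ n) (\<lambda>x. c * f x) x)))"
    using f by (simp add: smooth_cmult)
qed

definition uminus_schwartz :: "schwartz \<Rightarrow> schwartz" where
  "uminus_schwartz f = (-1) *\<^sub>R f"

definition minus_schwartz :: "schwartz \<Rightarrow> schwartz \<Rightarrow> schwartz" where
  "minus_schwartz f g = f + (-1) *\<^sub>R g"

instance
  by standard
    (rule schwartz_eqI; simp add: uminus_schwartz_def minus_schwartz_def zero_schwartz.rep_eq plus_schwartz.rep_eq
      scaleR_schwartz.rep_eq algebra_simps)+

end

definition schwartz_seminorm :: "nat \<times> nat \<Rightarrow> schwartz \<Rightarrow> real" where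
  "schwartz_seminorm = (\<lambda>(m, n) f. SUP x. (1 + \<bar>x\<bar>) ^ m * \<bar>(deriv ^^ n) (schwartz_apply f) x\<bar>)"

lemma schwartz_seminorm_upper:
  "(1 + \<bar>x\<bar>) ^ m * \<bar>(deriv ^^ n) (schwartz_apply f) x\<bar> \<le> schwartz_seminorm (m, n) f"
proof -
  have "bdd_above (range (\<lambda>x. norm ((1 + \<bar>x\<bar>) ^ m * (deriv ^^ n) (schwartz_apply f) x)))"
    using bounded_schwartz[of m n f] by (intro bounded_imp_bdd_above) (simp only: bounded_norm_comp)
  then have "bdd_above (range (\<lambda>x. (1 + \<bar>x\<bar>) ^ m * \<bar>(deriv ^^ n) (schwartz_apply f) x\<bar>))"
    by (simp add: abs_mult power_abs)
  then show ?thesis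
    unfolding schwartz_seminorm_def by (auto intro: cSUP_upper)
qed

lift_definition schwartz_deriv :: "schwartz \<Rightarrow> schwartz" is deriv
proof -
  fix f :: "real \<Rightarrow> real"
  assume f: "smooth f \<and> (\<forall>m n. bounded (range (\<lambda>x. (1 + \<bar>x\<bar>) ^ m * (deriv ^^ n) f x)))"
  then have sm: "smooth f"
    and bd: "bounded (range (\<lambda>x. (1 + \<bar>x\<bar>) ^ m * (deriv ^^ Suc n) f x))" for m n
    by blast+
  show "smooth (deriv f) \<and>
      (\<forall>m n. bounded (range (\<lambda>x. (1 + \<bar>x\<bar>) ^ m * (deriv ^^ n) (deriv f) x)))"
    by (intro conjI allI smooth_deriv[OF sm]) (subst higher_deriv_deriv, rule bd)
qed

lift_definition schwartz_shift :: "real \<Rightarrow> schwartz \<Rightarrow> schwartz" is "\<lambda>h f x. f (x + h)"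
proof -
  fix h and f :: "real \<Rightarrow> real"
  assume f: "smooth f \<and> (\<forall>m n. bounded (range (\<lambda>x. (1 + \<bar>x\<bar>) ^ m * (deriv ^^ n) f x)))"
  have "bounded (range (\<lambda>x. (1 + \<bar>x\<bar>) ^ m * (deriv ^^ n) f (x + h)))" for m n
  proof -
    have "bounded (range (\<lambda>x. (1 + \<bar>x\<bar>) ^ m * (deriv ^^ n) f x))" using f by blast
    then obtain B where "\<forall>y\<in>range (\<lambda>x. (1 + \<bar>x\<bar>) ^ m * (deriv ^^ n) f x). norm y \<le> B"
      unfolding bounded_iff by (elim exE)
    then have B: "norm ((1 + \<bar>x\<bar>) ^ m * (deriv ^^ n) f x) \<le> B" for x
      by (rule bspec) (rule rangeI)
    have "norm ((1 + \<bar>x\<bar>) ^ m * (deriv ^^ n) f (x + h)) \<le> (1 + \<bar>h\<bar>) ^ m * B" for x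
    proof -
      have "1 + \<bar>x\<bar> \<le> 1 + (\<bar>h\<bar> + \<bar>x + h\<bar>)" by arith
      also have "\<dots> \<le> 1 + (\<bar>h\<bar> + \<bar>x + h\<bar>) + \<bar>h\<bar> * \<bar>x + h\<bar>" by simp
      also have "\<dots> = (1 + \<bar>h\<bar>) * (1 + \<bar>x + h\<bar>)" by (simp add: algebra_simps)
      finally have "(1 + \<bar>x\<bar>) ^ m \<le> ((1 + \<bar>h\<bar>) * (1 + \<bar>x + h\<bar>)) ^ m"
        by (intro power_mono) auto
      then have "norm ((1 + \<bar>x\<bar>) ^ m * (deriv ^^ n) f (x + h))
          \<le> ((1 + \<bar>h\<bar>) * (1 + \<bar>x + h\<bar>)) ^ m * \<bar>(deriv ^^ n) f (x + h)\<bar>"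
        by (simp add: abs_mult power_abs mult_right_mono)
      also have "\<dots> = (1 + \<bar>h\<bar>) ^ m * norm ((1 + \<bar>x + h\<bar>) ^ m * (deriv ^^ n) f (x + h))"
        by (simp add: abs_mult power_abs power_mult_distrib)
      also have "\<dots> \<le> (1 + \<bar>h\<bar>) ^ m * B"
        by (intro mult_left_mono B) auto
      finally show ?thesis .
    qed
    then show ?thesis unfolding bounded_iff by blast
  qed
  then show "smooth (\<lambda>x. f (x + h)) \<and>
      (\<forall>m n. bounded (range (\<lambda>x. (1 + \<bar>x\<bar>) ^ m * (deriv ^^ n) (\<lambda>x. f (x + h)) x)))"
    using f by (simp add: smooth_shift higher_deriv_shift)
qed

lemma linear_deriv_schwartz: "linear schwartz_deriv"
  by (rule linearI; rule schwartz_eqI)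
    (simp_all add: plus_schwartz.rep_eq scaleR_schwartz.rep_eq schwartz_deriv.rep_eq
      deriv_add_smooth deriv_cmult_smooth smooth_schwartz)

lemma linear_shift_schwartz: "linear (schwartz_shift h)"
  by (rule linearI; rule schwartz_eqI)
    (simp_all add: plus_schwartz.rep_eq scaleR_schwartz.rep_eq schwartz_shift.rep_eq)

lemma deriv_schwartz_bound:
  "schwartz_seminorm (m, n) (schwartz_deriv f) = schwartz_seminorm (m, Suc n) f"
  unfolding schwartz_seminorm_def split
  by (simp only: schwartz_deriv.rep_eq higher_deriv_deriv)

lemma shift_schwartz_bound:
  "schwartz_seminorm (m, n) (schwartz_shift h f) \<le> (1 + \<bar>h\<bar>) ^ m * schwartz_seminorm (m, n) f"
proof -
  have "(1 + \<bar>x\<bar>) ^ m * \<bar>(deriv ^^ n) (schwartz_apply f) (x + h)\<bar>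
      \<le> (1 + \<bar>h\<bar>) ^ m * schwartz_seminorm (m, n) f" for x
  proof -
    have "1 + \<bar>x\<bar> \<le> 1 + (\<bar>h\<bar> + \<bar>x + h\<bar>)" by arith
    also have "\<dots> \<le> 1 + (\<bar>h\<bar> + \<bar>x + h\<bar>) + \<bar>h\<bar> * \<bar>x + h\<bar>" by simp
    also have "\<dots> = (1 + \<bar>h\<bar>) * (1 + \<bar>x + h\<bar>)" by (simp add: algebra_simps)
    finally have "(1 + \<bar>x\<bar>) ^ m \<le> ((1 + \<bar>h\<bar>) * (1 + \<bar>x + h\<bar>)) ^ m"
      by (intro power_mono) auto
    then have "(1 + \<bar>x\<bar>) ^ m * \<bar>(deriv ^^ n) (schwartz_apply f) (x + h)\<bar>
        \<le> ((1 + \<bar>h\<bar>) * (1 + \<bar>x + h\<bar>)) ^ m * \<bar>(deriv ^^ n) (schwartz_apply f) (x + h)\<bar>"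
      by (simp add: mult_right_mono)
    also have "\<dots> = (1 + \<bar>h\<bar>) ^ m * ((1 + \<bar>x + h\<bar>) ^ m * \<bar>(deriv ^^ n) (schwartz_apply f) (x + h)\<bar>)"
      by (simp add: power_mult_distrib)
    also have "\<dots> \<le> (1 + \<bar>h\<bar>) ^ m * schwartz_seminorm (m, n) f"
      by (intro mult_left_mono schwartz_seminorm_upper) auto
    finally show ?thesis .
  qed
  then show ?thesis
    by (subst schwartz_seminorm_def, unfold split, intro cSUP_least)
      (auto simp: schwartz_shift.rep_eq higher_deriv_shift smooth_schwartz)
qed

instantiation schwartz :: test_space
begin

definition open_schwartz :: "schwartz set \<Rightarrow> bool" where
  "open_schwartz = seminorm_open schwartz_seminorm"

definition deriv_test_schwartz :: "schwartz \<Rightarrow> schwartz" where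
  "deriv_test_schwartz = schwartz_deriv"

definition shift_test_schwartz :: "real \<Rightarrow> schwartz \<Rightarrow> schwartz" where
  "shift_test_schwartz = schwartz_shift"

instance
proof
  show "open (UNIV :: schwartz set)"
    by (simp add: open_schwartz_def seminorm_open_UNIV)
  show "open (S \<inter> T)" if "open S" "open T" for S T :: "schwartz set"
    using that by (simp add: open_schwartz_def seminorm_open_Int)
  show "open (\<Union>K)" if "\<forall>S\<in>K. open S" for K :: "schwartz set set"
    using that by (simp add: open_schwartz_def seminorm_open_Union)
  fix f g :: schwartz and c h :: real
  show "deriv_test (f + g) = deriv_test f + deriv_test g"
    unfolding deriv_test_schwartz_def shift_test_schwartz_def by (rule linear_add[OF linear_deriv_schwartz])
  show "deriv_test (c *\<^sub>R f) = c *\<^sub>R deriv_test f"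
    unfolding deriv_test_schwartz_def shift_test_schwartz_def by (rule linear_scale[OF linear_deriv_schwartz])
  show "shift_test h (f + g) = shift_test h f + shift_test h g"
    unfolding deriv_test_schwartz_def shift_test_schwartz_def by (rule linear_add[OF linear_shift_schwartz])
  show "shift_test h (c *\<^sub>R f) = c *\<^sub>R shift_test h f"
    unfolding deriv_test_schwartz_def shift_test_schwartz_def by (rule linear_scale[OF linear_shift_schwartz])
  show "open (deriv_test -` V)" if "open V" for V :: "schwartz set"
    using that unfolding open_schwartz_def deriv_test_schwartz_def shift_test_schwartz_def
    by (rule seminorm_open_vimage[OF linear_deriv_schwartz, where C = "\<lambda>_. 1" and k = "\<lambda>j. (fst j, Suc (snd j))"])
      (auto simp: deriv_schwartz_bound)
  show "open (shift_test h -` V)" if "open V" for V :: "schwartz set"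
    using that unfolding open_schwartz_def deriv_test_schwartz_def shift_test_schwartz_def
    by (rule seminorm_open_vimage[OF linear_shift_schwartz, where C = "\<lambda>j. (1 + \<bar>h\<bar>) ^ fst j" and k = "\<lambda>j. j"])
      (auto simp: shift_schwartz_bound)
qed

end


section \<open>Smooth periodic functions\<close>

typedef periodic = "{f :: real \<Rightarrow> real. smooth f \<and> (\<forall>x. f (x + 1) = f x)}"
  morphisms periodic_apply Abs_periodic
  by (intro exI[of _ "\<lambda>_. 0"]) (auto simp: smooth_zero)

setup_lifting type_definition_periodic

lemma periodic_eqI: "(\<And>x. periodic_apply f x = periodic_apply g x) \<Longrightarrow> f = g"
  by transfer auto

lemma smooth_periodic: "smooth (periodic_apply f)"
  and periodic_apply_plus_1: "periodic_apply f (x + 1) = periodic_apply f x"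
  using periodic_apply[of f] by auto

lemma periodic_range:
  fixes f :: "real \<Rightarrow> real"
  assumes "\<And>x. f (x + 1) = f x"
  shows "range f = f ` {0..1}"
proof -
  have nat: "f (x + real n) = f x" for x n
  proof (induction n)
    case (Suc n)
    have "f (x + real (Suc n)) = f ((x + real n) + 1)" by (simp add: algebra_simps)
    then show ?case using Suc assms by simp
  qed simp
  have int: "f (x + of_int k) = f x" for x k
  proof (cases "k \<ge> 0")
    case True
    then show ?thesis using nat[of x "nat k"] by simp
  next
    case False
    then show ?thesis using nat[of "x + of_int k" "nat (- k)"] by simp
  qed
  have "f x = f (frac x)" for x
    using int[of "frac x" "\<lfloor>x\<rfloor>"] by (simp add: frac_def)
  moreover have "frac x \<in> {0..1}" for x :: real
    by (simp add: frac_lt_1 less_imp_le)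
  ultimately have "f x \<in> f ` {0..1}" for x by (metis image_eqI)
  then show ?thesis by auto
qed

lemma bounded_periodic:
  fixes f :: "real \<Rightarrow> real"
  assumes "\<And>x. f (x + 1) = f x" "continuous_on UNIV f"
  shows "bounded (range f)"
  unfolding periodic_range[of f, OF assms(1)]
  by (intro compact_imp_bounded compact_continuous_image continuous_on_subset[OF assms(2)]) auto

lemma higher_deriv_periodic:
  "(deriv ^^ n) (periodic_apply f) (x + 1) = (deriv ^^ n) (periodic_apply f) x"
  using higher_deriv_shift[OF smooth_periodic, of n f 1]
  by (simp add: periodic_apply_plus_1 fun_eq_iff)

instantiation periodic :: real_vector
begin

lift_definition zero_periodic :: periodic is "\<lambda>_. 0"
  by (auto simp: smooth_zero)

lift_definition plus_periodic :: "periodic \<Rightarrow> periodic \<Rightarrow> periodic" is "\<lambda>f g x. f x + g x"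
  by (auto simp: smooth_add)

lift_definition scaleR_periodic :: "real \<Rightarrow> periodic \<Rightarrow> periodic" is "\<lambda>c f x. c * f x"
  by (auto simp: smooth_cmult)

definition uminus_periodic :: "periodic \<Rightarrow> periodic" where
  "uminus_periodic f = (-1) *\<^sub>R f"

definition minus_periodic :: "periodic \<Rightarrow> periodic \<Rightarrow> periodic" where
  "minus_periodic f g = f + (-1) *\<^sub>R g"

instance
  by standard
    (rule periodic_eqI; simp add: uminus_periodic_def minus_periodic_def zero_periodic.rep_eq plus_periodic.rep_eq
      scaleR_periodic.rep_eq algebra_simps)+

end

instantiation periodic :: one
begin

lift_definition one_periodic :: periodic is "\<lambda>_. 1"
  by (auto simp: smooth_one)

instance ..

end

definition periodic_seminorm :: "nat \<Rightarrow> periodic \<Rightarrow> real" where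
  "periodic_seminorm n f = (SUP x. \<bar>(deriv ^^ n) (periodic_apply f) x\<bar>)"

lemma periodic_seminorm_upper: "\<bar>(deriv ^^ n) (periodic_apply f) x\<bar> \<le> periodic_seminorm n f"
proof -
  have "bounded (range ((deriv ^^ n) (periodic_apply f)))"
    by (intro bounded_periodic higher_deriv_periodic higher_deriv_continuous smooth_periodic)
  then have "bdd_above (range (\<lambda>x. norm ((deriv ^^ n) (periodic_apply f) x)))"
    by (intro bounded_imp_bdd_above) (simp only: bounded_norm_comp)
  then show ?thesis
    unfolding periodic_seminorm_def by (auto intro: cSUP_upper)
qed

lift_definition periodic_deriv :: "periodic \<Rightarrow> periodic" is deriv
proof -
  fix f :: "real \<Rightarrow> real"
  assume f: "smooth f \<and> (\<forall>x. f (x + 1) = f x)"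
  then have "deriv f (x + 1) = deriv f x" for x
    using higher_deriv_shift[of f 1 1] by (simp add: fun_eq_iff)
  then show "smooth (deriv f) \<and> (\<forall>x. deriv f (x + 1) = deriv f x)"
    using f smooth_deriv by blast
qed

lift_definition periodic_shift :: "real \<Rightarrow> periodic \<Rightarrow> periodic" is "\<lambda>h f x. f (x + h)"
proof -
  fix h and f :: "real \<Rightarrow> real"
  assume f: "smooth f \<and> (\<forall>x. f (x + 1) = f x)"
  then have "f (x + 1 + h) = f (x + h)" for x
    using spec[of _ "x + h"] by (metis add.assoc add.commute)
  then show "smooth (\<lambda>x. f (x + h)) \<and> (\<forall>x. f (x + 1 + h) = f (x + h))"
    using f smooth_shift by blast
qed

lemma linear_deriv_periodic: "linear periodic_deriv"
  by (rule linearI; rule periodic_eqI)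
    (simp_all add: plus_periodic.rep_eq scaleR_periodic.rep_eq periodic_deriv.rep_eq
      deriv_add_smooth deriv_cmult_smooth smooth_periodic)

lemma linear_shift_periodic: "linear (periodic_shift h)"
  by (rule linearI; rule periodic_eqI)
    (simp_all add: plus_periodic.rep_eq scaleR_periodic.rep_eq periodic_shift.rep_eq)

lemma deriv_periodic_bound: "periodic_seminorm n (periodic_deriv f) = periodic_seminorm (Suc n) f"
  unfolding periodic_seminorm_def
  by (simp only: periodic_deriv.rep_eq higher_deriv_deriv)

lemma shift_periodic_bound: "periodic_seminorm n (periodic_shift h f) \<le> periodic_seminorm n f"
  by (subst periodic_seminorm_def, intro cSUP_least)
    (auto simp: periodic_shift.rep_eq higher_deriv_shift smooth_periodic periodic_seminorm_upper)

instantiation periodic :: test_space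
begin

definition open_periodic :: "periodic set \<Rightarrow> bool" where
  "open_periodic = seminorm_open periodic_seminorm"

definition deriv_test_periodic :: "periodic \<Rightarrow> periodic" where
  "deriv_test_periodic = periodic_deriv"

definition shift_test_periodic :: "real \<Rightarrow> periodic \<Rightarrow> periodic" where
  "shift_test_periodic = periodic_shift"

instance
proof
  show "open (UNIV :: periodic set)"
    by (simp add: open_periodic_def seminorm_open_UNIV)
  show "open (S \<inter> T)" if "open S" "open T" for S T :: "periodic set"
    using that by (simp add: open_periodic_def seminorm_open_Int)
  show "open (\<Union>K)" if "\<forall>S\<in>K. open S" for K :: "periodic set set"
    using that by (simp add: open_periodic_def seminorm_open_Union)
  fix f g :: periodic and c h :: real
  show "deriv_test (f + g) = deriv_test f + deriv_test g"
    unfolding deriv_test_periodic_def shift_test_periodic_def by (rule linear_add[OF linear_deriv_periodic])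
  show "deriv_test (c *\<^sub>R f) = c *\<^sub>R deriv_test f"
    unfolding deriv_test_periodic_def shift_test_periodic_def by (rule linear_scale[OF linear_deriv_periodic])
  show "shift_test h (f + g) = shift_test h f + shift_test h g"
    unfolding deriv_test_periodic_def shift_test_periodic_def by (rule linear_add[OF linear_shift_periodic])
  show "shift_test h (c *\<^sub>R f) = c *\<^sub>R shift_test h f"
    unfolding deriv_test_periodic_def shift_test_periodic_def by (rule linear_scale[OF linear_shift_periodic])
  show "open (deriv_test -` V)" if "open V" for V :: "periodic set"
    using that unfolding open_periodic_def deriv_test_periodic_def shift_test_periodic_def
    by (rule seminorm_open_vimage[OF linear_deriv_periodic, where C = "\<lambda>_. 1" and k = "Suc"])
      (auto simp: deriv_periodic_bound)
  show "open (shift_test h -` V)" if "open V" for V :: "periodic set"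
    using that unfolding open_periodic_def deriv_test_periodic_def shift_test_periodic_def
    by (rule seminorm_open_vimage[OF linear_shift_periodic, where C = "\<lambda>_. 1" and k = "\<lambda>j. j"])
      (auto simp: shift_periodic_bound)
qed

end


section \<open>Finite Radon measures\<close>

text \<open>Finite Radon measures are the elements of the normed duals of \<open>C\<^sub>0(\<real>)\<close> and \<open>C(\<T>)\<close>,
  both with the supremum norm; the dual (operator) norm is the total variation norm.\<close>

typedef C0_fun = "{f :: real \<Rightarrow>\<^sub>C real. (f \<longlongrightarrow> 0) at_infinity}"
  morphisms C0_bcontfun Abs_C0_fun
  by (intro exI[of _ 0]) auto

setup_lifting type_definition_C0_fun

instantiation C0_fun :: real_vector
begin

lift_definition zero_C0_fun :: C0_fun is 0
  by auto

lift_definition plus_C0_fun :: "C0_fun \<Rightarrow> C0_fun \<Rightarrow> C0_fun" is "(+)"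
  by (auto intro: tendsto_add_zero)

lift_definition minus_C0_fun :: "C0_fun \<Rightarrow> C0_fun \<Rightarrow> C0_fun" is "(-)"
  by (auto intro: tendsto_eq_intros)

lift_definition uminus_C0_fun :: "C0_fun \<Rightarrow> C0_fun" is uminus
  by (auto intro: tendsto_eq_intros)

lift_definition scaleR_C0_fun :: "real \<Rightarrow> C0_fun \<Rightarrow> C0_fun" is "(*\<^sub>R)"
  by (auto intro: tendsto_mult_right_zero)

instance
  by standard (transfer; simp add: algebra_simps)+

end

instantiation C0_fun :: real_normed_vector
begin

lift_definition norm_C0_fun :: "C0_fun \<Rightarrow> real" is norm .

definition dist_C0_fun :: "C0_fun \<Rightarrow> C0_fun \<Rightarrow> real" where
  "dist_C0_fun f g = norm (f - g)"

definition sgn_C0_fun :: "C0_fun \<Rightarrow> C0_fun" where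
  "sgn_C0_fun f = f /\<^sub>R norm f"

definition uniformity_C0_fun :: "(C0_fun \<times> C0_fun) filter" where
  "uniformity_C0_fun = (INF e\<in>{0<..}. principal {(f, g). dist f g < e})"

definition open_C0_fun :: "C0_fun set \<Rightarrow> bool" where
  "open_C0_fun U = (\<forall>f\<in>U. \<forall>\<^sub>F (f', g) in uniformity. f' = f \<longrightarrow> g \<in> U)"

instance
proof
  fix f g :: C0_fun and U :: "C0_fun set" and c :: real
  show "dist f g = norm (f - g)" by (rule dist_C0_fun_def)
  show "sgn f = f /\<^sub>R norm f" by (rule sgn_C0_fun_def)
  show "uniformity = (INF e\<in>{0<..}. principal {(f :: C0_fun, g). dist f g < e})"
    by (rule uniformity_C0_fun_def)
  show "open U \<longleftrightarrow> (\<forall>f\<in>U. \<forall>\<^sub>F (f', g) in uniformity. f' = f \<longrightarrow> g \<in> U)"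
    by (simp only: open_C0_fun_def)
  show "norm f = 0 \<longleftrightarrow> f = 0" by transfer (rule norm_eq_zero)
  show "norm (f + g) \<le> norm f + norm g" by transfer (rule norm_triangle_ineq)
  show "norm (c *\<^sub>R f) = \<bar>c\<bar> * norm f" by transfer (rule norm_scaleR)
qed

end

typedef CT_fun = "{f :: real \<Rightarrow>\<^sub>C real. \<forall>x. f (x + 1) = f x}"
  morphisms CT_bcontfun Abs_CT_fun
  by (intro exI[of _ 0]) auto

setup_lifting type_definition_CT_fun

instantiation CT_fun :: real_vector
begin

lift_definition zero_CT_fun :: CT_fun is 0
  by auto

lift_definition plus_CT_fun :: "CT_fun \<Rightarrow> CT_fun \<Rightarrow> CT_fun" is "(+)"
  by auto

lift_definition minus_CT_fun :: "CT_fun \<Rightarrow> CT_fun \<Rightarrow> CT_fun" is "(-)"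
  by auto

lift_definition uminus_CT_fun :: "CT_fun \<Rightarrow> CT_fun" is uminus
  by auto

lift_definition scaleR_CT_fun :: "real \<Rightarrow> CT_fun \<Rightarrow> CT_fun" is "(*\<^sub>R)"
  by auto

instance
  by standard (transfer; simp add: algebra_simps)+

end

instantiation CT_fun :: real_normed_vector
begin

lift_definition norm_CT_fun :: "CT_fun \<Rightarrow> real" is norm .

definition dist_CT_fun :: "CT_fun \<Rightarrow> CT_fun \<Rightarrow> real" where
  "dist_CT_fun f g = norm (f - g)"

definition sgn_CT_fun :: "CT_fun \<Rightarrow> CT_fun" where
  "sgn_CT_fun f = f /\<^sub>R norm f"

definition uniformity_CT_fun :: "(CT_fun \<times> CT_fun) filter" where
  "uniformity_CT_fun = (INF e\<in>{0<..}. principal {(f, g). dist f g < e})"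

definition open_CT_fun :: "CT_fun set \<Rightarrow> bool" where
  "open_CT_fun U = (\<forall>f\<in>U. \<forall>\<^sub>F (f', g) in uniformity. f' = f \<longrightarrow> g \<in> U)"

instance
proof
  fix f g :: CT_fun and U :: "CT_fun set" and c :: real
  show "dist f g = norm (f - g)" by (rule dist_CT_fun_def)
  show "sgn f = f /\<^sub>R norm f" by (rule sgn_CT_fun_def)
  show "uniformity = (INF e\<in>{0<..}. principal {(f :: CT_fun, g). dist f g < e})"
    by (rule uniformity_CT_fun_def)
  show "open U \<longleftrightarrow> (\<forall>f\<in>U. \<forall>\<^sub>F (f', g) in uniformity. f' = f \<longrightarrow> g \<in> U)"
    by (simp only: open_CT_fun_def)
  show "norm f = 0 \<longleftrightarrow> f = 0" by transfer (rule norm_eq_zero)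
  show "norm (f + g) \<le> norm f + norm g" by transfer (rule norm_triangle_ineq)
  show "norm (c *\<^sub>R f) = \<bar>c\<bar> * norm f" by transfer (rule norm_scaleR)
qed

end

type_synonym radon_R = "C0_fun \<Rightarrow>\<^sub>L real"
type_synonym radon_T = "CT_fun \<Rightarrow>\<^sub>L real"

text \<open>Both kinds of test functions embed into the respective space of continuous functions, so
  that every measure restricts to a generalized function.\<close>

lemma schwartz_mem_bcontfun: "schwartz_apply f \<in> bcontfun"
  using bounded_schwartz[of 0 0 f] higher_deriv_continuous[OF smooth_schwartz, of UNIV 0 f]
  by (simp add: bcontfun_def)

lemma schwartz_tendsto_0: "(schwartz_apply f \<longlongrightarrow> 0) at_infinity"
proof (rule Lim_null_comparison)
  let ?C = "schwartz_seminorm (1, 0) f"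
  show "\<forall>\<^sub>F x in at_infinity. norm (schwartz_apply f x) \<le> ?C * inverse (norm (1 + \<bar>x\<bar>))"
    using schwartz_seminorm_upper[of _ 1 0 f]
    by (intro always_eventually allI) (simp add: field_simps)
  have "filterlim (\<lambda>x :: real. 1 + \<bar>x\<bar>) at_infinity at_infinity"
    by (intro filterlim_at_top_imp_at_infinity filterlim_tendsto_add_at_top[OF tendsto_const])
      (use filterlim_norm_at_top[where 'a = real] in \<open>simp add: real_norm_def[abs_def]\<close>)
  then have "((\<lambda>x :: real. inverse (norm (1 + \<bar>x\<bar>))) \<longlongrightarrow> 0) at_infinity"
    by (intro tendsto_inverse_0_at_top filterlim_compose[OF filterlim_norm_at_top])
  from tendsto_mult_left[OF this, of ?C] show "((\<lambda>x :: real. ?C * inverse (norm (1 + \<bar>x\<bar>))) \<longlongrightarrow> 0) at_infinity"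
    by (simp only: mult_zero_right)
qed

lemma periodic_mem_bcontfun: "periodic_apply f \<in> bcontfun"
  using bounded_periodic[of "periodic_apply f"] higher_deriv_continuous[OF smooth_periodic, of UNIV 0 f]
  by (simp add: bcontfun_def periodic_apply_plus_1)

definition C0_of_schwartz :: "schwartz \<Rightarrow> C0_fun" where
  "C0_of_schwartz \<phi> = Abs_C0_fun (Bcontfun (schwartz_apply \<phi>))"

definition CT_of_periodic :: "periodic \<Rightarrow> CT_fun" where
  "CT_of_periodic \<phi> = Abs_CT_fun (Bcontfun (periodic_apply \<phi>))"

lemma apply_C0_of_schwartz [simp]: "C0_bcontfun (C0_of_schwartz \<phi>) x = schwartz_apply \<phi> x"
  unfolding C0_of_schwartz_def
  by (simp add: Abs_C0_fun_inverse Bcontfun_inverse schwartz_mem_bcontfun schwartz_tendsto_0)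

lemma apply_CT_of_periodic [simp]: "CT_bcontfun (CT_of_periodic \<phi>) x = periodic_apply \<phi> x"
  unfolding CT_of_periodic_def
  by (simp add: Abs_CT_fun_inverse Bcontfun_inverse periodic_mem_bcontfun periodic_apply_plus_1)

lemma linear_C0_of_schwartz: "linear C0_of_schwartz"
  by (rule linearI; rule C0_bcontfun_inject[THEN iffD1], rule bcontfun_eqI)
    (simp_all add: plus_C0_fun.rep_eq scaleR_C0_fun.rep_eq plus_schwartz.rep_eq scaleR_schwartz.rep_eq)

lemma linear_CT_of_periodic: "linear CT_of_periodic"
  by (rule linearI; rule CT_bcontfun_inject[THEN iffD1], rule bcontfun_eqI)
    (simp_all add: plus_CT_fun.rep_eq scaleR_CT_fun.rep_eq plus_periodic.rep_eq scaleR_periodic.rep_eq)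

lemma norm_C0_of_schwartz_le: "norm (C0_of_schwartz \<phi>) \<le> schwartz_seminorm (0, 0) \<phi>"
  unfolding norm_C0_fun.rep_eq using schwartz_seminorm_upper[of _ 0 0 \<phi>]
  by (intro norm_bound) simp

lemma norm_CT_of_periodic_le: "norm (CT_of_periodic \<phi>) \<le> periodic_seminorm 0 \<phi>"
  unfolding norm_CT_fun.rep_eq using periodic_seminorm_upper[of 0 \<phi>]
  by (intro norm_bound) simp

lift_definition dist_of_radon_R :: "radon_R \<Rightarrow> schwartz dual"
  is "\<lambda>\<nu> \<phi>. blinfun_apply \<nu> (C0_of_schwartz \<phi>)"
proof -
  fix \<nu> :: radon_R
  have lin: "linear (\<lambda>\<phi>. \<nu> (C0_of_schwartz \<phi>))"
    using linear_compose[OF linear_C0_of_schwartz, of "blinfun_apply \<nu>"]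
    by (simp add: o_def blinfun.bounded_linear_right bounded_linear.linear)
  have "\<bar>\<nu> (C0_of_schwartz \<phi>)\<bar> \<le> norm \<nu> * schwartz_seminorm (0, 0) \<phi>" for \<phi>
    using norm_blinfun[of \<nu> "C0_of_schwartz \<phi>"]
      mult_left_mono[OF norm_C0_of_schwartz_le[of \<phi>] norm_ge_zero[of \<nu>]] by simp
  then have "open V \<Longrightarrow> open ((\<lambda>\<phi>. \<nu> (C0_of_schwartz \<phi>)) -` V)" for V
    unfolding open_schwartz_def by (intro seminorm_open_vimage_real[OF lin, of V "norm \<nu>"]) auto
  then show "linear (\<lambda>\<phi>. \<nu> (C0_of_schwartz \<phi>)) \<and> continuous_on UNIV (\<lambda>\<phi>. \<nu> (C0_of_schwartz \<phi>))"
    using lin by (simp add: continuous_on_open_vimage)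
qed

lift_definition dist_of_radon_T :: "radon_T \<Rightarrow> periodic dual"
  is "\<lambda>\<nu> \<phi>. blinfun_apply \<nu> (CT_of_periodic \<phi>)"
proof -
  fix \<nu> :: radon_T
  have lin: "linear (\<lambda>\<phi>. \<nu> (CT_of_periodic \<phi>))"
    using linear_compose[OF linear_CT_of_periodic, of "blinfun_apply \<nu>"]
    by (simp add: o_def blinfun.bounded_linear_right bounded_linear.linear)
  have "\<bar>\<nu> (CT_of_periodic \<phi>)\<bar> \<le> norm \<nu> * periodic_seminorm 0 \<phi>" for \<phi>
    using norm_blinfun[of \<nu> "CT_of_periodic \<phi>"]
      mult_left_mono[OF norm_CT_of_periodic_le[of \<phi>] norm_ge_zero[of \<nu>]] by simp
  then have "open V \<Longrightarrow> open ((\<lambda>\<phi>. \<nu> (CT_of_periodic \<phi>)) -` V)" for V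
    unfolding open_periodic_def by (intro seminorm_open_vimage_real[OF lin, of V "norm \<nu>"]) auto
  then show "linear (\<lambda>\<phi>. \<nu> (CT_of_periodic \<phi>)) \<and> continuous_on UNIV (\<lambda>\<phi>. \<nu> (CT_of_periodic \<phi>))"
    using lin by (simp add: continuous_on_open_vimage)
qed

text \<open>By density of the test functions, a generalized function extends to at most one measure,
  so the choice made by \<^const>\<open>inv\<close> is immaterial on the ranges of the embeddings. Outside of
  these ranges the values of the norms are meaningless.\<close>

definition radon_norm_R :: "schwartz dual \<Rightarrow> real" where
  "radon_norm_R u = norm (inv dist_of_radon_R u)"

definition radon_norm_T :: "periodic dual \<Rightarrow> real" where
  "radon_norm_T u = norm (inv dist_of_radon_T u)"


section \<open>Native spaces\<close>

definition native_R :: "(schwartz dual \<Rightarrow> schwartz dual) \<Rightarrow> schwartz dual set" where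
  "native_R L\<^sub>T = {f. L\<^sub>T f \<in> range dist_of_radon_R}"

definition native_R_norm ::
  "nat \<Rightarrow> (nat \<Rightarrow> schwartz) \<Rightarrow> (schwartz dual \<Rightarrow> schwartz dual) \<Rightarrow> schwartz dual \<Rightarrow> real" where
  "native_R_norm N\<^sub>T \<theta> L\<^sub>T f =
     (if N\<^sub>T = 0 then radon_norm_R (L\<^sub>T f)
      else radon_norm_R (L\<^sub>T f) + L2_set (\<lambda>n. pairing f (\<theta> n)) {1..N\<^sub>T})"

definition mean_T :: "periodic dual \<Rightarrow> real" where
  "mean_T f = pairing f 1"

definition native_T :: "(periodic dual \<Rightarrow> periodic dual) \<Rightarrow> periodic dual set" where
  "native_T L\<^sub>S = {f. L\<^sub>S f \<in> range dist_of_radon_T}"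

definition native_T0 :: "(periodic dual \<Rightarrow> periodic dual) \<Rightarrow> periodic dual set" where
  "native_T0 L\<^sub>S = {f \<in> native_T L\<^sub>S. mean_T f = 0}"

definition native_T_norm ::
  "nat \<Rightarrow> (periodic dual \<Rightarrow> periodic dual) \<Rightarrow> periodic dual \<Rightarrow> real" where
  "native_T_norm N\<^sub>S L\<^sub>S f =
     (if N\<^sub>S = 0 then radon_norm_T (L\<^sub>S f) else radon_norm_T (L\<^sub>S f) + \<bar>mean_T f\<bar>)"

definition native ::
  "nat \<Rightarrow> (schwartz dual \<Rightarrow> schwartz dual) \<Rightarrow> (periodic dual \<Rightarrow> periodic dual) \<Rightarrow>
   (schwartz dual \<times> periodic dual) set" where
  "native N\<^sub>T L\<^sub>T L\<^sub>S =
     (if N\<^sub>T = 0 then native_R L\<^sub>T \<times> native_T L\<^sub>S else native_R L\<^sub>T \<times> native_T0 L\<^sub>S)"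

definition native_norm ::
  "ereal \<Rightarrow> nat \<Rightarrow> (nat \<Rightarrow> schwartz) \<Rightarrow> (schwartz dual \<Rightarrow> schwartz dual) \<Rightarrow>
   nat \<Rightarrow> (periodic dual \<Rightarrow> periodic dual) \<Rightarrow> schwartz dual \<times> periodic dual \<Rightarrow> real" where
  "native_norm p N\<^sub>T \<theta> L\<^sub>T N\<^sub>S L\<^sub>S = (\<lambda>(f\<^sub>T, f\<^sub>S).
     if p = \<infinity> then max (native_R_norm N\<^sub>T \<theta> L\<^sub>T f\<^sub>T) (native_T_norm N\<^sub>S L\<^sub>S f\<^sub>S)
     else (native_R_norm N\<^sub>T \<theta> L\<^sub>T f\<^sub>T powr real_of_ereal p
           + native_T_norm N\<^sub>S L\<^sub>S f\<^sub>S powr real_of_ereal p) powr (1 / real_of_ereal p))"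

text \<open>The norm is only required to behave like a norm on the subspace \<open>V\<close>.\<close>

definition banach_on :: "'a::real_vector set \<Rightarrow> ('a \<Rightarrow> real) \<Rightarrow> bool" where
  "banach_on V N \<longleftrightarrow> subspace V \<and>
     (\<forall>x\<in>V. 0 \<le> N x \<and> (N x = 0 \<longleftrightarrow> x = 0)) \<and>
     (\<forall>c. \<forall>x\<in>V. N (c *\<^sub>R x) = \<bar>c\<bar> * N x) \<and>
     (\<forall>x\<in>V. \<forall>y\<in>V. N (x + y) \<le> N x + N y) \<and>
     (\<forall>X :: nat \<Rightarrow> 'a. range X \<subseteq> V \<and> (\<forall>\<epsilon>>0. \<exists>k. \<forall>m\<ge>k. \<forall>n\<ge>k. N (X m - X n) < \<epsilon>) \<longrightarrow>
        (\<exists>x\<in>V. (\<lambda>n. N (X n - x)) \<longlonglongrightarrow> 0))"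

end

theory Submission
  imports Defs
begin

text \<open>Let \<open>J\<close> be the embedding of the measures into the generalized functions. Since \<open>J\<close> is
  injective (the test functions are dense in \<open>C\<^sub>0(\<real>)\<close> and \<open>C(\<T>)\<close>, by Stone--Weierstrass) and the
  measures are complete, it is enough to control the kernel and the range of \<open>L\<close>. A continuous
  shift-invariant operator commutes with the derivative, so that
  \<open>L = D\<^sup>N L\<^sub>i\<^sub>n\<^sub>v = L\<^sub>i\<^sub>n\<^sub>v D\<^sup>N\<close> has the same kernel and the same range as
  \<open>D\<^sup>N\<close>. On the line \<open>D\<^sup>N\<close> is onto and its kernel consists of the polynomials of degree \<open>< N\<close>, on
  which \<open>\<theta>\<close> provides coordinates. On the circle, for \<open>N \<ge> 1\<close>, it maps the generalized functions
  of mean zero bijectively onto themselves and kills the constants. In this way the limit of a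
  Cauchy sequence is found by inverting \<open>L\<close> on the limit measure and correcting the result by a
  polynomial or a constant. The two factors are combined by Minkowski's inequality in the plane.\<close>

section \<open>Banach spaces as subspaces\<close>

text \<open>Generalized functions are integrated by transposition. A test function has an
  antiderivative among the test functions exactly when its mean is zero. Subtracting the mean times
  a fixed test function of integral 1 (\<open>\<theta> 1\<close> on the line, the constant 1 on the
  circle, here written \<open>\<theta>\<close>) therefore gives a continuous linear operator
  \<open>A\<close> on test functions with
  \<open>D (A \<phi>) = \<phi> - \<langle>1, \<phi>\<rangle> \<theta>\<close>. The transpose of
  \<open>A\<close> inverts \<open>D\<close> up to sign, on the circle for right-hand sides of mean
  zero, and the same identity shows that \<open>D u = 0\<close> only for multiples of 1.

  The delicate case on the circle is \<open>N\<^sub>T \<ge> 1\<close> with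
  \<open>N\<^sub>S = 0\<close>: the norm does not see the mean, yet the limit must have mean zero.
  There the inverse of \<open>L\<^sub>i\<^sub>n\<^sub>v\<close> is continuous, so norm convergence
  of the measures gives weak* convergence of the preimages, and the mean passes to the limit. For
  \<open>N\<^sub>S \<ge> 1\<close> the norm controls the mean; weak* convergence is then used on the
  other side of \<open>L\<close>, to see that the limit measure has mean zero and so lies in the
  range.\<close>

lemma powr_convex_nonneg:
  fixes a b p t :: real
  assumes "1 \<le> p" "0 \<le> a" "0 \<le> b" "0 \<le> t" "t \<le> 1"
  shows "(t * a + (1 - t) * b) powr p \<le> t * a powr p + (1 - t) * b powr p"
proof (cases "a > 0 \<and> b > 0")
  case True
  then show ?thesis
    using convex_onD[OF powr_convex[OF assms(1)], of "1 - t" a b] assms by (simp add: algebra_simps)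
next
  case False
  \<comment> \<open>When an argument vanishes only one summand remains, and the claim reduces to
    \<open>s powr p \<le> s\<close> for \<open>s\<close> between 0 and 1.\<close>
  have le: "(s * c) powr p \<le> s * c powr p" if "0 \<le> s" "s \<le> 1" "0 \<le> c" for s c :: real
    using that powr_mono'[of 1 p s] assms(1) by (auto simp: powr_mult intro!: mult_right_mono)
  show ?thesis
    using False assms le[of t a] le[of "1 - t" b] by (cases "a = 0") auto
qed

text \<open>Convexity on normalized vectors: with \<open>A\<close> and \<open>B\<close> the two
  norms on the right, \<open>(a + c) / (A + B)\<close> is the convex combination of
  \<open>a / A\<close> and \<open>c / B\<close> with weight \<open>A / (A + B)\<close>, and likewise
  for \<open>b\<close> and \<open>d\<close>. Adding the two convexity estimates bounds the
  normalized sum by 1.\<close>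

lemma powr_norm_triangle:
  fixes a b c d p :: real
  assumes p: "1 \<le> p" and nonneg: "0 \<le> a" "0 \<le> b" "0 \<le> c" "0 \<le> d"
  shows "((a + c) powr p + (b + d) powr p) powr (1 / p)
    \<le> (a powr p + b powr p) powr (1 / p) + (c powr p + d powr p) powr (1 / p)"
proof -
  define A where "A = (a powr p + b powr p) powr (1 / p)"
  define B where "B = (c powr p + d powr p) powr (1 / p)"
  have Ap: "A powr p = a powr p + b powr p" and Bp: "B powr p = c powr p + d powr p"
    using p by (simp_all add: A_def B_def powr_powr)
  have A0: "0 \<le> A" and B0: "0 \<le> B" by (simp_all add: A_def B_def)
  show ?thesis
  proof (cases "A = 0 \<or> B = 0")
    case True
    then show ?thesis
    proof
      assume "A = 0"
      then have "a powr p + b powr p = 0" using Ap p by simp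
      then have "a = 0" "b = 0" using nonneg by (auto simp: add_nonneg_eq_0_iff)
      then show ?thesis by simp
    next
      assume "B = 0"
      then have "c powr p + d powr p = 0" using Bp p by simp
      then have "c = 0" "d = 0" using nonneg by (auto simp: add_nonneg_eq_0_iff)
      then show ?thesis by simp
    qed
  next
    case False
    then have pos: "A > 0" "B > 0" using A0 B0 by auto
    define t where "t = A / (A + B)"
    have t: "0 \<le> t" "t \<le> 1" using pos by (auto simp: t_def field_simps)
    have conv: "((x + y) / (A + B)) powr p \<le> t * (x powr p / A powr p) + (1 - t) * (y powr p / B powr p)"
      if "0 \<le> x" "0 \<le> y" for x y
    proof -
      have "1 - t = B / (A + B)" using pos by (simp add: t_def field_simps)
      then have "(x + y) / (A + B) = t * (x / A) + (1 - t) * (y / B)"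
        using pos by (simp add: t_def add_divide_distrib)
      then show ?thesis
        using powr_convex_nonneg[OF p, of "x / A" "y / B" t] t that pos by (simp add: powr_divide)
    qed
    have "((a + c) / (A + B)) powr p + ((b + d) / (A + B)) powr p
      \<le> t * ((a powr p + b powr p) / A powr p) + (1 - t) * ((c powr p + d powr p) / B powr p)"
      using conv[OF nonneg(1,3)] conv[OF nonneg(2,4)] by (simp add: add_divide_distrib distrib_left)
    also have "\<dots> = 1" using pos by (simp flip: Ap Bp)
    finally have "(a + c) powr p + (b + d) powr p \<le> (A + B) powr p"
      using pos nonneg by (simp add: powr_divide field_simps)
    then have "((a + c) powr p + (b + d) powr p) powr (1 / p) \<le> ((A + B) powr p) powr (1 / p)"
      using p by (intro powr_mono2) auto
    also have "\<dots> = A + B" using pos p by (simp add: powr_powr)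
    finally show ?thesis unfolding A_def B_def .
  qed
qed

section \<open>Completeness of products and of preimages under an operator\<close>

lemma banach_onD:
  assumes "banach_on V N"
  shows "subspace V"
    and "\<And>x. x \<in> V \<Longrightarrow> 0 \<le> N x"
    and "\<And>x. x \<in> V \<Longrightarrow> N x = 0 \<longleftrightarrow> x = 0"
    and "\<And>c x. x \<in> V \<Longrightarrow> N (c *\<^sub>R x) = \<bar>c\<bar> * N x"
    and "\<And>x y. x \<in> V \<Longrightarrow> y \<in> V \<Longrightarrow> N (x + y) \<le> N x + N y"
  using assms by (simp_all add: banach_on_def)

lemma banach_on_complete:
  assumes "banach_on V N" "\<And>n. X n \<in> V"
    "\<forall>\<epsilon>>0. \<exists>k. \<forall>m\<ge>k. \<forall>n\<ge>k. N (X m - X n) < \<epsilon>"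
  obtains x where "x \<in> V" "(\<lambda>n. N (X n - x)) \<longlonglongrightarrow> 0"
proof -
  have "range X \<subseteq> V" using assms(2) by blast
  then have "\<exists>x\<in>V. (\<lambda>n. N (X n - x)) \<longlonglongrightarrow> 0"
    using assms(1,3) unfolding banach_on_def by simp
  then show thesis using that by blast
qed

text \<open>\<open>P\<close> stands for a norm on the plane that is monotone on the nonnegative
  quadrant. Being squeezed between maximum and sum, it has the same Cauchy and null sequences as the
  components, so that one lemma serves every exponent.\<close>

lemma banach_on_prod:
  assumes V: "banach_on V M" and W: "banach_on W N"
    and lower: "\<And>a b. 0 \<le> a \<Longrightarrow> 0 \<le> b \<Longrightarrow> max a b \<le> P a b"
    and upper: "\<And>a b. 0 \<le> a \<Longrightarrow> 0 \<le> b \<Longrightarrow> P a b \<le> a + b"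
    and homog: "\<And>a b c. 0 \<le> a \<Longrightarrow> 0 \<le> b \<Longrightarrow> 0 \<le> c \<Longrightarrow> P (c * a) (c * b) = c * P a b"
    and mono: "\<And>a b c d. 0 \<le> a \<Longrightarrow> 0 \<le> b \<Longrightarrow> a \<le> c \<Longrightarrow> b \<le> d \<Longrightarrow> P a b \<le> P c d"
    and triangle: "\<And>a b c d. 0 \<le> a \<Longrightarrow> 0 \<le> b \<Longrightarrow> 0 \<le> c \<Longrightarrow> 0 \<le> d \<Longrightarrow> P (a + c) (b + d) \<le> P a b + P c d"
  shows "banach_on (V \<times> W) (\<lambda>(x, y). P (M x) (N y))"
proof -
  note V' = banach_onD[OF V] and W' = banach_onD[OF W]
  note sV = V'(1) and sW = W'(1) and M0 = V'(2,3) and N0 = W'(2,3)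
  have P0: "0 \<le> P a b" if "0 \<le> a" "0 \<le> b" for a b using lower[OF that] that by linarith
  have Peq: "P a b = 0 \<longleftrightarrow> a = 0 \<and> b = 0" if "0 \<le> a" "0 \<le> b" for a b
    using lower[OF that] upper[OF that] that by auto
  show ?thesis
    unfolding banach_on_def
  proof (intro conjI allI impI ballI; (elim conjE)?)
    show "subspace (V \<times> W)" using sV sW by (rule subspace_Times)
  next
    fix z assume "z \<in> V \<times> W"
    then obtain x y where z: "z = (x, y)" "x \<in> V" "y \<in> W" by auto
    show "0 \<le> (case z of (x, y) \<Rightarrow> P (M x) (N y))" using z M0 N0 P0 by simp
    show "(case z of (x, y) \<Rightarrow> P (M x) (N y)) = 0 \<longleftrightarrow> z = 0"
      using z M0 N0 Peq by (simp add: zero_prod_def)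
    show "(case c *\<^sub>R z of (x, y) \<Rightarrow> P (M x) (N y)) = \<bar>c\<bar> * (case z of (x, y) \<Rightarrow> P (M x) (N y))" for c
      using z by (simp add: V'(4) W'(4) homog M0(1) N0(1))
    fix w assume "w \<in> V \<times> W"
    then obtain x' y' where w: "w = (x', y')" "x' \<in> V" "y' \<in> W" by auto
    have "M (x + x') \<le> M x + M x'" "N (y + y') \<le> N y + N y'" using z w by (simp_all add: V'(5) W'(5))
    moreover have "0 \<le> M (x + x')" "0 \<le> N (y + y')"
      using M0 N0 z w subspace_add[OF sV] subspace_add[OF sW] by auto
    ultimately have "P (M (x + x')) (N (y + y')) \<le> P (M x + M x') (N y + N y')" by (intro mono)
    also have "\<dots> \<le> P (M x) (N y) + P (M x') (N y')" using M0 N0 z w by (intro triangle) auto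
    finally show "(case z + w of (x, y) \<Rightarrow> P (M x) (N y))
        \<le> (case z of (x, y) \<Rightarrow> P (M x) (N y)) + (case w of (x, y) \<Rightarrow> P (M x) (N y))"
      using z w by simp
  next
    fix Z :: "nat \<Rightarrow> 'a \<times> 'b"
    assume Z: "range Z \<subseteq> V \<times> W"
      and Cauchy: "\<forall>\<epsilon>>0. \<exists>k. \<forall>m\<ge>k. \<forall>n\<ge>k. (case Z m - Z n of (x, y) \<Rightarrow> P (M x) (N y)) < \<epsilon>"
    define X where "X n = fst (Z n)" for n
    define Y where "Y n = snd (Z n)" for n
    have ZXY: "Z n = (X n, Y n)" for n by (simp add: X_def Y_def)
    have XV: "X n \<in> V" and YW: "Y n \<in> W" for n using Z by (auto simp: X_def Y_def mem_Times_iff image_subset_iff)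
    have dV: "X m - X n \<in> V" and dW: "Y m - Y n \<in> W" for m n
      using XV YW subspace_diff sV sW by blast+
    have less: "M (X m - X n) < \<epsilon>" "N (Y m - Y n) < \<epsilon>"
      if "(case Z m - Z n of (x, y) \<Rightarrow> P (M x) (N y)) < \<epsilon>" for m n \<epsilon>
      using that lower[OF M0(1)[OF dV[of m n]] N0(1)[OF dW[of m n]]] by (auto simp: ZXY)
    obtain x where x: "x \<in> V" "(\<lambda>n. M (X n - x)) \<longlonglongrightarrow> 0"
      using Cauchy less(1)
      by (elim banach_on_complete[where X = X, OF V XV, rotated]) (rule all_forward, assumption, blast)
    obtain y where y: "y \<in> W" "(\<lambda>n. N (Y n - y)) \<longlonglongrightarrow> 0"
      using Cauchy less(2)
      by (elim banach_on_complete[where X = Y, OF W YW, rotated]) (rule all_forward, assumption, blast)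
    have dV': "0 \<le> M (X n - x)" and dW': "0 \<le> N (Y n - y)" for n
      using XV YW x y sV sW by (simp_all add: M0(1) N0(1) subspace_diff)
    have "(\<lambda>n. P (M (X n - x)) (N (Y n - y))) \<longlonglongrightarrow> 0"
    proof (rule tendsto_sandwich)
      show "\<forall>\<^sub>F n in sequentially. 0 \<le> P (M (X n - x)) (N (Y n - y))"
        using P0 dV' dW' by simp
      show "\<forall>\<^sub>F n in sequentially. P (M (X n - x)) (N (Y n - y)) \<le> M (X n - x) + N (Y n - y)"
        using upper dV' dW' by simp
      show "(\<lambda>n. M (X n - x) + N (Y n - y)) \<longlonglongrightarrow> 0" using tendsto_add[OF x(2) y(2)] by simp
    qed simp
    then show "\<exists>z\<in>V \<times> W. (\<lambda>n. case Z n - z of (x, y) \<Rightarrow> P (M x) (N y)) \<longlonglongrightarrow> 0"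
      using x y by (intro bexI[of _ "(x, y)"]) (auto simp: ZXY)
  qed
qed

text \<open>Since \<open>J\<close> is injective, \<open>inv J (L f)\<close> is linear in
  \<open>f\<close> on the subspace, and a Cauchy sequence there yields a convergent sequence in the
  Banach space. What remains is a preimage of its limit that also fits the seminorm
  \<open>s\<close>, whose purpose is to detect the kernel of \<open>L\<close>. The subspace
  \<open>U\<close> leaves room for the condition of mean zero.\<close>

lemma banach_on_pullback:
  fixes L :: "'a::real_vector \<Rightarrow> 'b::real_vector" and J :: "'c::banach \<Rightarrow> 'b"
  assumes L: "linear L" and J: "linear J" "inj J" and U: "subspace U"
    and s0: "\<And>f. 0 \<le> s f" and s_scale: "\<And>c f. s (c *\<^sub>R f) = \<bar>c\<bar> * s f"
    and s_add: "\<And>f g. s (f + g) \<le> s f + s g"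
    and kernel: "\<And>f. f \<in> U \<Longrightarrow> L f = 0 \<Longrightarrow> s f = 0 \<Longrightarrow> f = 0"
    and complete: "\<And>X b. (\<And>n. X n \<in> U) \<Longrightarrow> (\<And>n. L (X n) \<in> range J) \<Longrightarrow>
      (\<lambda>n. inv J (L (X n))) \<longlonglongrightarrow> b \<Longrightarrow> \<forall>\<epsilon>>0. \<exists>k. \<forall>m\<ge>k. \<forall>n\<ge>k. s (X m - X n) < \<epsilon> \<Longrightarrow>
      \<exists>f\<in>U. L f = J b \<and> (\<lambda>n. s (X n - f)) \<longlonglongrightarrow> 0"
  shows "banach_on {f \<in> U. L f \<in> range J} (\<lambda>f. norm (inv J (L f)) + s f)"
proof -
  let ?V = "{f \<in> U. L f \<in> range J}"
  define \<nu> where "\<nu> f = inv J (L f)" for f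
  have J\<nu>: "J (\<nu> f) = L f" if "f \<in> ?V" for f using that by (auto simp: \<nu>_def f_inv_into_f)
  have \<nu>I: "\<nu> f = b" if "L f = J b" for f b using that J(2) by (simp add: \<nu>_def)
  have V: "subspace ?V"
  proof -
    have "?V = U \<inter> L -` range J" by auto
    then show ?thesis
      using U L J by (simp add: subspace_inter linear_subspace_vimage linear_subspace_image)
  qed
  have \<nu>_add: "\<nu> (f + g) = \<nu> f + \<nu> g" if "f \<in> ?V" "g \<in> ?V" for f g
    by (rule \<nu>I) (simp only: J\<nu>[OF that(1)] J\<nu>[OF that(2)] linear_add[OF L] linear_add[OF J(1)])
  have \<nu>_scale: "\<nu> (c *\<^sub>R f) = c *\<^sub>R \<nu> f" if "f \<in> ?V" for f c
    by (rule \<nu>I) (simp only: J\<nu>[OF that] linear_scale[OF L] linear_scale[OF J(1)])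
  have \<nu>_diff: "\<nu> (f - g) = \<nu> f - \<nu> g" if "f \<in> ?V" "g \<in> ?V" for f g
    by (rule \<nu>I) (simp only: J\<nu>[OF that(1)] J\<nu>[OF that(2)] linear_diff[OF L] linear_diff[OF J(1)])
  have "s 0 = 0" using s_scale[of 0 0] by simp
  show ?thesis
    unfolding banach_on_def \<nu>_def[symmetric]
  proof (intro conjI allI impI ballI; (elim conjE)?)
    fix f assume f: "f \<in> ?V"
    show "0 \<le> norm (\<nu> f) + s f" using s0[of f] by simp
    show "norm (\<nu> f) + s f = 0 \<longleftrightarrow> f = 0"
    proof
      assume "norm (\<nu> f) + s f = 0"
      then have "\<nu> f = 0" "s f = 0" using s0[of f] norm_ge_zero[of "\<nu> f"] by (auto simp: add_nonneg_eq_0_iff)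
      then show "f = 0" using kernel f J\<nu>[OF f] linear_0[OF J(1)] by auto
    next
      assume "f = 0"
      then show "norm (\<nu> f) + s f = 0"
        using \<open>s 0 = 0\<close> \<nu>I[of 0 0] linear_0[OF J(1)] linear_0[OF L] by simp
    qed
    show "norm (\<nu> (c *\<^sub>R f)) + s (c *\<^sub>R f) = \<bar>c\<bar> * (norm (\<nu> f) + s f)" for c
      using f by (simp add: \<nu>_scale s_scale distrib_left)
    show "norm (\<nu> (f + g)) + s (f + g) \<le> norm (\<nu> f) + s f + (norm (\<nu> g) + s g)" if "g \<in> ?V" for g
      using \<nu>_add[OF f that] norm_triangle_ineq[of "\<nu> f" "\<nu> g"] s_add[of f g] by simp
  next
    fix X :: "nat \<Rightarrow> 'a"
    assume "range X \<subseteq> ?V"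
    then have X: "X n \<in> ?V" for n by blast
    assume C: "\<forall>\<epsilon>>0. \<exists>k. \<forall>m\<ge>k. \<forall>n\<ge>k. norm (\<nu> (X m - X n)) + s (X m - X n) < \<epsilon>"
    have "norm (\<nu> (X m) - \<nu> (X n)) < \<epsilon> \<and> s (X m - X n) < \<epsilon>"
      if "norm (\<nu> (X m - X n)) + s (X m - X n) < \<epsilon>" for m n \<epsilon>
      using that s0[of "X m - X n"] norm_ge_zero[of "\<nu> (X m - X n)"] unfolding \<nu>_diff[OF X X]
      by linarith
    then have C': "\<forall>\<epsilon>>0. \<exists>k. \<forall>m\<ge>k. \<forall>n\<ge>k. norm (\<nu> (X m) - \<nu> (X n)) < \<epsilon> \<and> s (X m - X n) < \<epsilon>"
      using C by meson
    then have "Cauchy (\<lambda>n. \<nu> (X n))" unfolding Cauchy_def dist_norm by meson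
    then obtain b where b: "(\<lambda>n. \<nu> (X n)) \<longlonglongrightarrow> b" using Cauchy_convergent convergent_def by blast
    have "\<exists>f\<in>U. L f = J b \<and> (\<lambda>n. s (X n - f)) \<longlonglongrightarrow> 0"
      using X b C' unfolding \<nu>_def by (intro complete) (blast, blast, assumption, meson)
    then obtain f where f: "f \<in> U" "L f = J b" "(\<lambda>n. s (X n - f)) \<longlonglongrightarrow> 0" by blast
    have fV: "f \<in> ?V" and "\<nu> f = b" using f \<nu>I by auto
    have "(\<lambda>n. norm (\<nu> (X n - f)) + s (X n - f)) \<longlonglongrightarrow> 0 + 0"
      unfolding \<nu>_diff[OF X fV] \<open>\<nu> f = b\<close>
      by (intro tendsto_add f tendsto_norm_zero LIM_zero b)
    then show "\<exists>f\<in>?V. (\<lambda>n. norm (\<nu> (X n - f)) + s (X n - f)) \<longlonglongrightarrow> 0" using fV by auto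
  qed (rule V)
qed


section \<open>Smooth functions\<close>

text \<open>Giving all derivatives at once in closed form replaces the computation of iterated
  \<open>deriv\<close>. This serves products, the Gaussian and the cosine.\<close>

lemma smoothI:
  assumes "\<And>n x. (F n has_field_derivative F (Suc n) x) (at x)" and "F 0 = f"
  shows "smooth f" and "(deriv ^^ n) f = F n"
proof -
  have *: "(deriv ^^ n) f = F n" for n
  proof (induction n)
    case (Suc n)
    have "deriv (F n) = F (Suc n)" using assms(1) by (intro ext DERIV_imp_deriv)
    then show ?case by (simp add: Suc)
  qed (simp add: assms(2))
  show "(deriv ^^ n) f = F n" by (rule *)
  show "smooth f" unfolding smooth_def * using assms(1) by (auto simp: field_differentiable_def)
qed

lemma smooth_has_derivative:
  "smooth f \<Longrightarrow> ((deriv ^^ n) f has_field_derivative (deriv ^^ Suc n) f x) (at x)"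
  by (simp add: smooth_D DERIV_deriv_iff_field_differentiable)

lemma smooth_antiderivative:
  assumes "\<And>x. (F has_field_derivative f x) (at x)" "smooth f"
  shows "smooth F" "(deriv ^^ Suc n) F = (deriv ^^ n) f" "deriv F = f"
proof -
  show d: "deriv F = f" using assms(1) by (intro ext DERIV_imp_deriv)
  then show s: "(deriv ^^ Suc n) F = (deriv ^^ n) f" for n
    by (simp add: funpow_Suc_right del: funpow.simps)
  have "(deriv ^^ n) F field_differentiable at x" for n x
    using assms s smooth_D[OF assms(2)] by (cases n) (auto simp: field_differentiable_def simp del: funpow.simps(2))
  then show "smooth F" unfolding smooth_def by blast
qed

text \<open>The Leibniz sums themselves form the family required by \<open>smoothI\<close>; that
  differentiation leads from each to the next is Pascal's rule. Products of test functions are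
  needed for the algebras in the Stone-Weierstrass argument.\<close>

lemma higher_deriv_mult:
  assumes f: "smooth f" and g: "smooth g"
  shows "smooth (\<lambda>x. f x * g x)"
    and "(deriv ^^ n) (\<lambda>x. f x * g x)
      = (\<lambda>x. \<Sum>k\<le>n. of_nat (n choose k) * ((deriv ^^ k) f x * (deriv ^^ (n - k)) g x))"
proof -
  define F where "F n x = (\<Sum>k\<le>n. of_nat (n choose k) * ((deriv ^^ k) f x * (deriv ^^ (n - k)) g x))" for n x
  have D: "(F n has_field_derivative F (Suc n) x) (at x)" for n x
  proof -
    define a where "a i j = (deriv ^^ i) f x * (deriv ^^ j) g x" for i j
    have "(F n has_field_derivative
      (\<Sum>k\<le>n. of_nat (n choose k) * (a k (Suc (n - k)) + a (Suc k) (n - k)))) (at x)"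
      unfolding F_def a_def
      by (rule DERIV_sum derivative_eq_intros smooth_has_derivative f g refl)+ (simp add: algebra_simps)
    also have "(\<Sum>k\<le>n. of_nat (n choose k) * (a k (Suc (n - k)) + a (Suc k) (n - k)))
      = (\<Sum>k\<le>n. of_nat (n choose k) * a k (Suc n - k)) + (\<Sum>k\<le>n. of_nat (n choose k) * a (Suc k) (n - k))"
      by (simp add: distrib_left sum.distrib Suc_diff_le)
    also have "\<dots> = (\<Sum>k\<le>Suc n. of_nat (Suc n choose k) * a k (Suc n - k))"
    proof -
      \<comment> \<open>The added term \<open>k = Suc n\<close> has binomial coefficient 0; with it,
        splitting off \<open>k = 0\<close> aligns this sum with the other one.\<close>
      have "(\<Sum>k\<le>n. of_nat (n choose k) * a k (Suc n - k)) = (\<Sum>k\<le>Suc n. of_nat (n choose k) * a k (Suc n - k))"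
        by (simp add: binomial_eq_0)
      also have "\<dots> = a 0 (Suc n) + (\<Sum>k\<le>n. of_nat (n choose Suc k) * a (Suc k) (n - k))"
        by (subst sum.atMost_Suc_shift) simp
      finally show ?thesis
        by (subst sum.atMost_Suc_shift) (simp add: distrib_right sum.distrib add_ac)
    qed
    finally show ?thesis unfolding F_def a_def .
  qed
  have F0: "F 0 = (\<lambda>x. f x * g x)" by (rule ext) (simp add: F_def)
  show "smooth (\<lambda>x. f x * g x)" by (rule smoothI(1)[of F, OF D F0])
  show "(deriv ^^ n) (\<lambda>x. f x * g x)
      = (\<lambda>x. \<Sum>k\<le>n. of_nat (n choose k) * ((deriv ^^ k) f x * (deriv ^^ (n - k)) g x))"
    unfolding smoothI(2)[of F, OF D F0] F_def ..
qed

section \<open>Products of Schwartz functions and the Gaussian\<close>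

lemma bounded_range_iff: "bounded (range f) \<longleftrightarrow> (\<exists>B. \<forall>x. \<bar>f x\<bar> \<le> B)" for f :: "'a \<Rightarrow> real"
  by (simp add: bounded_iff)

lift_definition schwartz_mult :: "schwartz \<Rightarrow> schwartz \<Rightarrow> schwartz" is "\<lambda>f g x. f x * g x"
proof -
  fix f g :: "real \<Rightarrow> real"
  assume f: "smooth f \<and> (\<forall>m n. bounded (range (\<lambda>x. (1 + \<bar>x\<bar>) ^ m * (deriv ^^ n) f x)))"
    and g: "smooth g \<and> (\<forall>m n. bounded (range (\<lambda>x. (1 + \<bar>x\<bar>) ^ m * (deriv ^^ n) g x)))"
  have "bounded (range (\<lambda>x. (1 + \<bar>x\<bar>) ^ m * (deriv ^^ n) (\<lambda>x. f x * g x) x))" for m n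
  proof -
    have "\<exists>B. \<forall>x. \<bar>(1 + \<bar>x\<bar>) ^ m * (deriv ^^ k) f x\<bar> \<le> B" for k
      using f unfolding bounded_range_iff by blast
    then obtain B where B: "\<And>k x. \<bar>(1 + \<bar>x\<bar>) ^ m * (deriv ^^ k) f x\<bar> \<le> B k" by metis
    \<comment> \<open>The whole weight goes to the derivatives of \<open>f\<close>; those of
      \<open>g\<close> only have to be bounded, hence the exponent 0.\<close>
    have "\<exists>C. \<forall>x. \<bar>(1 + \<bar>x\<bar>) ^ 0 * (deriv ^^ k) g x\<bar> \<le> C" for k
      using g unfolding bounded_range_iff by blast
    then obtain C where C: "\<And>k x. \<bar>(deriv ^^ k) g x\<bar> \<le> C k" by (simp only: power_0 mult_1) metis
    have "\<bar>(1 + \<bar>x\<bar>) ^ m * (deriv ^^ n) (\<lambda>x. f x * g x) x\<bar>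
      \<le> (\<Sum>k\<le>n. of_nat (n choose k) * (B k * C (n - k)))" for x
    proof -
      have "(1 + \<bar>x\<bar>) ^ m * (deriv ^^ n) (\<lambda>x. f x * g x) x
        = (\<Sum>k\<le>n. of_nat (n choose k) * (((1 + \<bar>x\<bar>) ^ m * (deriv ^^ k) f x) * (deriv ^^ (n - k)) g x))"
        using f g by (simp add: higher_deriv_mult sum_distrib_left mult_ac)
      also have "\<bar>\<dots>\<bar> \<le> (\<Sum>k\<le>n. of_nat (n choose k) * (B k * C (n - k)))"
      proof (rule order.trans[OF sum_abs sum_mono])
        fix k
        have "\<bar>(1 + \<bar>x\<bar>) ^ m * (deriv ^^ k) f x\<bar> * \<bar>(deriv ^^ (n - k)) g x\<bar> \<le> B k * C (n - k)"
          by (intro mult_mono B C order.trans[OF abs_ge_zero B]) auto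
        then show "\<bar>of_nat (n choose k) * (((1 + \<bar>x\<bar>) ^ m * (deriv ^^ k) f x) * (deriv ^^ (n - k)) g x)\<bar>
          \<le> real (n choose k) * (B k * C (n - k))"
          by (simp only: abs_mult abs_of_nat) (intro mult_left_mono, auto)
      qed
      finally show ?thesis .
    qed
    then show ?thesis unfolding bounded_range_iff by blast
  qed
  then show "smooth (\<lambda>x. f x * g x) \<and>
      (\<forall>m n. bounded (range (\<lambda>x. (1 + \<bar>x\<bar>) ^ m * (deriv ^^ n) (\<lambda>x. f x * g x) x)))"
    using f g by (simp add: higher_deriv_mult(1))
qed

text \<open>A single term of the exponential series is at most the whole sum, all terms being
  nonnegative.\<close>

lemma power_le_fact_exp: "0 \<le> x \<Longrightarrow> x ^ n \<le> fact n * exp x" for x :: real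
  using sum_le_suminf[OF summable_exp_generic, of "{n}" x]
  by (simp add: exp_def field_simps)

lemma one_plus_abs_power_exp_le: "(1 + \<bar>x\<bar>) ^ n * exp (- (x\<^sup>2)) \<le> fact n * exp 2" for x :: real
proof -
  have "(1 + \<bar>x\<bar>) ^ n \<le> fact n * exp (1 + \<bar>x\<bar>)" by (intro power_le_fact_exp) auto
  \<comment> \<open>The quadratic bound lets \<open>exp (x\<^sup>2)\<close> cancel against the
    Gaussian and leaves the constant \<open>exp 2\<close>.\<close>
  also have "1 + \<bar>x\<bar> \<le> 2 + x\<^sup>2"
    using zero_le_power2[of "\<bar>x\<bar> - 1"] by (simp add: power2_eq_square algebra_simps)
  finally have "(1 + \<bar>x\<bar>) ^ n \<le> fact n * (exp 2 * exp (x\<^sup>2))" by (simp add: exp_add)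
  then show ?thesis by (simp add: exp_minus field_simps)
qed

lemma poly_bound: "\<exists>C k. \<forall>x. \<bar>poly p x\<bar> \<le> C * (1 + \<bar>x\<bar>) ^ k" for p :: "real poly"
proof (induction p)
  case (pCons a p)
  then obtain C k where C: "\<And>x. \<bar>poly p x\<bar> \<le> C * (1 + \<bar>x\<bar>) ^ k" by blast
  have "\<bar>poly (pCons a p) x\<bar> \<le> (\<bar>a\<bar> + C) * (1 + \<bar>x\<bar>) ^ Suc k" for x
  proof -
    have "\<bar>poly (pCons a p) x\<bar> \<le> \<bar>a\<bar> + \<bar>x\<bar> * \<bar>poly p x\<bar>"
      using abs_triangle_ineq[of a "x * poly p x"] by (simp add: abs_mult)
    also have "\<dots> \<le> \<bar>a\<bar> * (1 + \<bar>x\<bar>) ^ Suc k + (1 + \<bar>x\<bar>) * (C * (1 + \<bar>x\<bar>) ^ k)"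
    proof (rule add_mono)
      have "1 \<le> (1 + \<bar>x\<bar>) ^ Suc k" by (rule one_le_power) simp
      from mult_left_mono[OF this abs_ge_zero[of a]]
      show "\<bar>a\<bar> \<le> \<bar>a\<bar> * (1 + \<bar>x\<bar>) ^ Suc k" by simp
      show "\<bar>x\<bar> * \<bar>poly p x\<bar> \<le> (1 + \<bar>x\<bar>) * (C * (1 + \<bar>x\<bar>) ^ k)"
        using C[of x] by (intro mult_mono) auto
    qed
    finally show ?thesis by (simp add: algebra_simps)
  qed
  then show ?case by blast
qed (auto intro!: exI[of _ 0])

text \<open>The translates of this function will separate the points of the line.\<close>

lift_definition gaussian :: schwartz is "\<lambda>x. exp (- (x\<^sup>2))"
proof -
  \<comment> \<open>Differentiating \<open>p(x) exp(- x\<^sup>2)\<close> turns the polynomial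
    \<open>p\<close> into \<open>p' - 2 x p\<close>; up to the sign \<open>(-1) ^ n\<close> these
    are the Hermite polynomials.\<close>
  define q :: "nat \<Rightarrow> real poly" where "q = rec_nat 1 (\<lambda>_ p. pderiv p - [:0, 2:] * p)"
  define F where "F n x = poly (q n) x * exp (- (x\<^sup>2))" for n x
  have D: "(F n has_field_derivative F (Suc n) x) (at x)" for n x
    unfolding F_def q_def by (auto intro!: derivative_eq_intros simp: algebra_simps)
  have F0: "F 0 = (\<lambda>x. exp (- (x\<^sup>2)))" by (rule ext) (simp add: F_def q_def)
  have "\<exists>B. \<forall>x. \<bar>(1 + \<bar>x\<bar>) ^ m * F n x\<bar> \<le> B" for m n
  proof -
    obtain C k where C: "\<And>x. \<bar>poly (q n) x\<bar> \<le> C * (1 + \<bar>x\<bar>) ^ k" using poly_bound by blast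
    have "C \<ge> 0" using order.trans[OF abs_ge_zero C[of 0]] by simp
    have "\<bar>(1 + \<bar>x\<bar>) ^ m * F n x\<bar> \<le> C * (fact (m + k) * exp 2)" for x
    proof -
      have "\<bar>(1 + \<bar>x\<bar>) ^ m * F n x\<bar> = (1 + \<bar>x\<bar>) ^ m * exp (- (x\<^sup>2)) * \<bar>poly (q n) x\<bar>"
        by (simp add: F_def abs_mult power_abs)
      also have "\<dots> \<le> (1 + \<bar>x\<bar>) ^ m * exp (- (x\<^sup>2)) * (C * (1 + \<bar>x\<bar>) ^ k)"
        by (intro mult_left_mono C) auto
      also have "\<dots> = C * ((1 + \<bar>x\<bar>) ^ (m + k) * exp (- (x\<^sup>2)))" by (simp add: power_add)
      also have "\<dots> \<le> C * (fact (m + k) * exp 2)"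
        by (intro mult_left_mono one_plus_abs_power_exp_le \<open>C \<ge> 0\<close>)
      finally show ?thesis .
    qed
    then show ?thesis by blast
  qed
  then have bounded: "bounded (range (\<lambda>x. (1 + \<bar>x\<bar>) ^ m * F n x))" for m n
    unfolding bounded_range_iff by blast
  show "smooth (\<lambda>x. exp (- (x\<^sup>2))) \<and>
      (\<forall>m n. bounded (range (\<lambda>x. (1 + \<bar>x\<bar>) ^ m * (deriv ^^ n) (\<lambda>x :: real. exp (- (x\<^sup>2))) x)))"
    by (intro conjI allI smoothI(1)[of F, OF D F0]) (subst smoothI(2)[of F, OF D F0], rule bounded)
qed


section \<open>Weak* convergence and difference quotients\<close>

text \<open>The topology of \<open>dual\<close> is initial with respect to \<open>pairing\<close>,
  and convergence in the product topology of the function space is pointwise.\<close>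

lemma tendsto_dual_iff:
  fixes X :: "nat \<Rightarrow> 'a::{real_vector, topological_space} dual"
  shows "X \<longlonglongrightarrow> u \<longleftrightarrow> (\<forall>\<phi>. (\<lambda>k. pairing (X k) \<phi>) \<longlonglongrightarrow> pairing u \<phi>)"
proof
  assume X: "X \<longlonglongrightarrow> u"
  have "continuous_on UNIV (\<lambda>u :: 'a dual. pairing u \<phi>)" for \<phi>
  proof (rule continuous_on_open_vimage[THEN iffD2, OF open_UNIV], intro allI impI)
    fix B :: "real set"
    assume "open B"
    then have "open ((\<lambda>f :: 'a \<Rightarrow> real. f \<phi>) -` B)"
      by (rule open_vimage[OF _ continuous_on_product_coordinates])
    then show "open ((\<lambda>u :: 'a dual. pairing u \<phi>) -` B \<inter> UNIV)"
      unfolding open_dual_def by (intro exI[of _ "(\<lambda>f. f \<phi>) -` B"]) auto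
  qed
  from continuous_on_tendsto_compose[OF this X]
  show "\<forall>\<phi>. (\<lambda>k. pairing (X k) \<phi>) \<longlonglongrightarrow> pairing u \<phi>" by simp
next
  assume "\<forall>\<phi>. (\<lambda>k. pairing (X k) \<phi>) \<longlonglongrightarrow> pairing u \<phi>"
  then have lim: "(\<lambda>k. pairing (X k)) \<longlonglongrightarrow> pairing u"
    using limitin_componentwise[of "\<lambda>_. euclidean" UNIV "\<lambda>k. pairing (X k)" "pairing u" sequentially]
    by (simp add: euclidean_product_topology)
  show "X \<longlonglongrightarrow> u"
  proof (rule topological_tendstoI)
    fix S :: "'a dual set" assume "open S" "u \<in> S"
    then obtain V :: "('a \<Rightarrow> real) set" where "open V" "S = pairing -` V" "pairing u \<in> V"
      unfolding open_dual_def by blast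
    then show "\<forall>\<^sub>F k in sequentially. X k \<in> S" using topological_tendstoD[OF lim] by simp
  qed
qed

text \<open>A continuous shift-invariant operator commutes with the derivative because the latter is
  the weak* limit of difference quotients.\<close>

lemma lsi_continuous_deriv_dist:
  fixes L :: "'a::test_space dual \<Rightarrow> 'a dual"
  assumes L: "lsi_continuous L"
    and quot: "\<And>(u :: 'a dual) \<phi>. (\<lambda>k. real (Suc k) * (pairing u (shift_test (inverse (real (Suc k))) \<phi>) - pairing u \<phi>))
      \<longlonglongrightarrow> pairing u (deriv_test \<phi>)"
  shows "L (deriv_dist u) = deriv_dist (L u)"
proof (rule dual_eqI)
  fix \<phi>
  \<comment> \<open>As \<open>shift_dist h v\<close> is \<open>v\<close> translated to the right by
    \<open>h\<close>, this backward difference quotient has the limit \<open>deriv_dist v\<close>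
    with the correct sign. On test functions it is the forward quotient of \<open>quot\<close>, up
    to the sign of transposition.\<close>
  define d where "d k v = real (Suc k) *\<^sub>R (v - shift_dist (inverse (real (Suc k))) v)" for k and v :: "'a dual"
  have lin: "linear L" and cont: "continuous_on UNIV L"
    and shift: "L (shift_dist h v) = shift_dist h (L v)" for h v
    using L by (auto simp: lsi_continuous_def lsi_def)
  have d: "(\<lambda>k. d k v) \<longlonglongrightarrow> deriv_dist v" for v
    unfolding tendsto_dual_iff
  proof
    fix \<phi>
    show "(\<lambda>k. pairing (d k v) \<phi>) \<longlonglongrightarrow> pairing (deriv_dist v) \<phi>"
      using tendsto_minus[OF quot[of v \<phi>]]
      by (simp add: d_def scaleR_dual.rep_eq minus_dual.rep_eq shift_dist.rep_eq deriv_dist.rep_eq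
          mult_minus_right[symmetric] del: of_nat_Suc mult_minus_right)
  qed
  have "L (d k u) = d k (L u)" for k
    by (simp add: d_def linear_scale[OF lin] linear_diff[OF lin] shift)
  moreover have "(\<lambda>k. L (d k u)) \<longlonglongrightarrow> L (deriv_dist u)"
    using continuous_on_tendsto_compose[OF cont d] by simp
  ultimately have "(\<lambda>k. d k (L u)) \<longlonglongrightarrow> L (deriv_dist u)" by simp
  then show "pairing (L (deriv_dist u)) \<phi> = pairing (deriv_dist (L u)) \<phi>"
    using d[of "L u"] unfolding tendsto_dual_iff by (meson LIMSEQ_unique)
qed

text \<open>A basic neighbourhood involves finitely many seminorms only, so convergence in each of
  them separately is enough.\<close>

lemma seminorm_tendsto:
  fixes u :: "'a::real_vector \<Rightarrow> real"
  assumes u: "\<And>V. open V \<Longrightarrow> seminorm_open p (u -` V)"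
    and X: "\<And>i. (\<lambda>k. p i (X k - f)) \<longlonglongrightarrow> 0"
  shows "(\<lambda>k. u (X k)) \<longlonglongrightarrow> u f"
proof (rule topological_tendstoI)
  fix V assume "open V" "u f \<in> V"
  from u[OF this(1)] this(2) obtain F \<epsilon>
    where F: "finite F" "\<epsilon> > 0" "\<forall>g. (\<forall>i\<in>F. p i (g - f) < \<epsilon>) \<longrightarrow> g \<in> u -` V"
    using seminorm_openE[of p "u -` V" f] by auto
  have "\<forall>\<^sub>F k in sequentially. p i (X k - f) < \<epsilon>" for i
    using order_tendstoD(2)[OF X F(2)] .
  then have "\<forall>\<^sub>F k in sequentially. \<forall>i\<in>F. p i (X k - f) < \<epsilon>"
    using F(1) by (simp add: eventually_ball_finite)
  then show "\<forall>\<^sub>F k in sequentially. u (X k) \<in> V"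
    by (rule eventually_mono) (use F(3) in auto)
qed

text \<open>In contrast to \<open>seminorm_open_vimage\<close>, several seminorms may enter the bound.\<close>

lemma seminorm_open_vimage_sum:
  fixes T :: "'a::real_vector \<Rightarrow> 'b::real_vector"
  assumes "linear T" and V: "seminorm_open q V"
    and K: "\<And>j. finite (K j)" and C: "\<And>j. C j \<ge> 0"
    and bound: "\<And>j f. q j (T f) \<le> C j * (\<Sum>i\<in>K j. p i f)"
  shows "seminorm_open p (T -` V)"
  unfolding seminorm_open_def
proof
  fix f assume "f \<in> T -` V"
  then have "T f \<in> V" by simp
  from V this obtain F \<epsilon>
    where F: "finite F" "\<epsilon> > 0" "\<forall>g. (\<forall>i\<in>F. q i (g - T f) < \<epsilon>) \<longrightarrow> g \<in> V"
    by (rule seminorm_openE)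
  \<comment> \<open>Bounding every seminorm in the sum over \<open>K j\<close> by
    \<open>\<epsilon> / S\<close> costs a factor \<open>card (K j)\<close>; the summand 1 makes
    \<open>C j * card (K j) < S\<close> strict.\<close>
  define S where "S = 1 + (\<Sum>j\<in>F. C j * card (K j))"
  have S: "S > 0" unfolding S_def using C by (simp add: add_pos_nonneg sum_nonneg)
  have "g \<in> T -` V" if g: "\<forall>i\<in>(\<Union>j\<in>F. K j). p i (g - f) < \<epsilon> / S" for g
  proof -
    have "q j (T g - T f) < \<epsilon>" if j: "j \<in> F" for j
    proof -
      have "C j * card (K j) \<le> (\<Sum>j\<in>F. C j * card (K j))"
        using F(1) j C by (intro member_le_sum) auto
      then have CS: "C j * card (K j) < S" by (simp add: S_def)
      have "q j (T g - T f) \<le> C j * (\<Sum>i\<in>K j. p i (g - f))"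
        using bound[of j "g - f"] by (simp add: linear_diff[OF assms(1)])
      also have "(\<Sum>i\<in>K j. p i (g - f)) \<le> card (K j) * (\<epsilon> / S)"
        using g j by (intro sum_bounded_above) (auto intro: less_imp_le)
      finally have "q j (T g - T f) \<le> C j * (card (K j) * (\<epsilon> / S))"
        using C by (simp add: mult_left_mono)
      also have "\<dots> < \<epsilon>"
        using CS S F(2) by (simp add: field_simps)
      finally show ?thesis .
    qed
    then show ?thesis using F(3) by auto
  qed
  moreover have "finite (\<Union>j\<in>F. K j)" "\<epsilon> / S > 0" using F S K by auto
  ultimately show "\<exists>F \<epsilon>. finite F \<and> \<epsilon> > 0 \<and> (\<forall>g. (\<forall>i\<in>F. p i (g - f) < \<epsilon>) \<longrightarrow> g \<in> T -` V)"
    by (intro exI[of _ "\<Union>j\<in>F. K j"] exI[of _ "\<epsilon> / S"]) simp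
qed

section \<open>Convergence of difference quotients of test functions\<close>

lemma higher_deriv_schwartz:
  "(deriv ^^ n) (schwartz_apply (f + g)) x = (deriv ^^ n) (schwartz_apply f) x + (deriv ^^ n) (schwartz_apply g) x"
  "(deriv ^^ n) (schwartz_apply (c *\<^sub>R f)) x = c * (deriv ^^ n) (schwartz_apply f) x"
  "(deriv ^^ n) (schwartz_apply (f - g)) x = (deriv ^^ n) (schwartz_apply f) x - (deriv ^^ n) (schwartz_apply g) x"
  "(deriv ^^ n) (schwartz_apply (shift_test h f)) x = (deriv ^^ n) (schwartz_apply f) (x + h)"
  "(deriv ^^ n) (schwartz_apply (deriv_test f)) x = (deriv ^^ Suc n) (schwartz_apply f) x"
proof -
  show add: "(deriv ^^ n) (schwartz_apply (f + g)) x = (deriv ^^ n) (schwartz_apply f) x + (deriv ^^ n) (schwartz_apply g) x" for f g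
    by (simp only: plus_schwartz.rep_eq higher_deriv_add smooth_schwartz)
  show scale: "(deriv ^^ n) (schwartz_apply (c *\<^sub>R f)) x = c * (deriv ^^ n) (schwartz_apply f) x" for c f
    by (simp only: scaleR_schwartz.rep_eq higher_deriv_cmult smooth_schwartz)
  show "(deriv ^^ n) (schwartz_apply (f - g)) x = (deriv ^^ n) (schwartz_apply f) x - (deriv ^^ n) (schwartz_apply g) x"
    by (simp only: minus_schwartz_def add scale)
  show "(deriv ^^ n) (schwartz_apply (shift_test h f)) x = (deriv ^^ n) (schwartz_apply f) (x + h)"
    by (simp only: shift_test_schwartz_def schwartz_shift.rep_eq higher_deriv_shift[OF smooth_schwartz])
  show "(deriv ^^ n) (schwartz_apply (deriv_test f)) x = (deriv ^^ Suc n) (schwartz_apply f) x"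
    by (simp only: deriv_test_schwartz_def schwartz_deriv.rep_eq higher_deriv_deriv)
qed

lemma higher_deriv_periodic_ops:
  "(deriv ^^ n) (periodic_apply (f + g)) x = (deriv ^^ n) (periodic_apply f) x + (deriv ^^ n) (periodic_apply g) x"
  "(deriv ^^ n) (periodic_apply (c *\<^sub>R f)) x = c * (deriv ^^ n) (periodic_apply f) x"
  "(deriv ^^ n) (periodic_apply (f - g)) x = (deriv ^^ n) (periodic_apply f) x - (deriv ^^ n) (periodic_apply g) x"
  "(deriv ^^ n) (periodic_apply (shift_test h f)) x = (deriv ^^ n) (periodic_apply f) (x + h)"
  "(deriv ^^ n) (periodic_apply (deriv_test f)) x = (deriv ^^ Suc n) (periodic_apply f) x"
proof -
  show add: "(deriv ^^ n) (periodic_apply (f + g)) x = (deriv ^^ n) (periodic_apply f) x + (deriv ^^ n) (periodic_apply g) x" for f g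
    by (simp only: plus_periodic.rep_eq higher_deriv_add smooth_periodic)
  show scale: "(deriv ^^ n) (periodic_apply (c *\<^sub>R f)) x = c * (deriv ^^ n) (periodic_apply f) x" for c f
    by (simp only: scaleR_periodic.rep_eq higher_deriv_cmult smooth_periodic)
  show "(deriv ^^ n) (periodic_apply (f - g)) x = (deriv ^^ n) (periodic_apply f) x - (deriv ^^ n) (periodic_apply g) x"
    by (simp only: minus_periodic_def add scale)
  show "(deriv ^^ n) (periodic_apply (shift_test h f)) x = (deriv ^^ n) (periodic_apply f) (x + h)"
    by (simp only: shift_test_periodic_def periodic_shift.rep_eq higher_deriv_shift[OF smooth_periodic])
  show "(deriv ^^ n) (periodic_apply (deriv_test f)) x = (deriv ^^ Suc n) (periodic_apply f) x"
    by (simp only: deriv_test_periodic_def periodic_deriv.rep_eq higher_deriv_deriv)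
qed

lemma schwartz_seminorm_least:
  "(\<And>x. (1 + \<bar>x\<bar>) ^ m * \<bar>(deriv ^^ n) (schwartz_apply f) x\<bar> \<le> B) \<Longrightarrow> schwartz_seminorm (m, n) f \<le> B"
  unfolding schwartz_seminorm_def by (auto intro: cSUP_least)

lemma periodic_seminorm_least:
  "(\<And>x. \<bar>(deriv ^^ n) (periodic_apply f) x\<bar> \<le> B) \<Longrightarrow> periodic_seminorm n f \<le> B"
  unfolding periodic_seminorm_def by (auto intro: cSUP_least)

lemma schwartz_seminorm_nonneg: "0 \<le> schwartz_seminorm i f"
  using order.trans[OF _ schwartz_seminorm_upper[of 0 "fst i" "snd i" f], of 0] by simp

lemma periodic_seminorm_nonneg: "0 \<le> periodic_seminorm n f"
  using order.trans[OF abs_ge_zero periodic_seminorm_upper[of n f 0]] .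

text \<open>The mean value theorem is applied twice: the quotient is the next derivative at some
  \<open>\<eta>\<close> between \<open>x\<close> and \<open>x + h\<close>, and its deviation from
  the value at \<open>x\<close> is \<open>\<eta> - x\<close> times the derivative after that at
  \<open>\<xi>\<close>. The location of \<open>\<xi>\<close> is exported because the Schwartz weight
  has to be moved from \<open>x\<close> to \<open>\<xi>\<close>.\<close>

lemma difference_quotient_bound:
  fixes f :: "real \<Rightarrow> real"
  assumes f: "smooth f" and h: "0 < h"
  obtains \<xi> where "x < \<xi>" "\<xi> < x + h"
    "\<bar>((deriv ^^ n) f (x + h) - (deriv ^^ n) f x) / h - (deriv ^^ Suc n) f x\<bar>
      \<le> h * \<bar>(deriv ^^ Suc (Suc n)) f \<xi>\<bar>"
proof -
  have D: "((deriv ^^ k) f has_field_derivative (deriv ^^ Suc k) f y) (at y)" for k y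
    using f by (rule smooth_has_derivative)
  obtain \<eta> where \<eta>: "x < \<eta>" "\<eta> < x + h"
    "(deriv ^^ n) f (x + h) - (deriv ^^ n) f x = h * (deriv ^^ Suc n) f \<eta>"
    using MVT2[of x "x + h" "(deriv ^^ n) f" "(deriv ^^ Suc n) f"] D[of n] h by auto
  obtain \<xi> where \<xi>: "x < \<xi>" "\<xi> < \<eta>"
    "(deriv ^^ Suc n) f \<eta> - (deriv ^^ Suc n) f x = (\<eta> - x) * (deriv ^^ Suc (Suc n)) f \<xi>"
    using MVT2[of x \<eta> "(deriv ^^ Suc n) f" "(deriv ^^ Suc (Suc n)) f"] D[of "Suc n"] \<eta> by blast
  have "((deriv ^^ n) f (x + h) - (deriv ^^ n) f x) / h - (deriv ^^ Suc n) f x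
      = (\<eta> - x) * (deriv ^^ Suc (Suc n)) f \<xi>"
    unfolding \<eta>(3) using \<xi>(3) h by simp
  then have "\<bar>((deriv ^^ n) f (x + h) - (deriv ^^ n) f x) / h - (deriv ^^ Suc n) f x\<bar>
      \<le> h * \<bar>(deriv ^^ Suc (Suc n)) f \<xi>\<bar>"
    using \<eta> \<xi> by (simp add: abs_mult mult_right_mono del: funpow.simps)
  then show thesis using \<eta> \<xi> by (intro that[of \<xi>]) auto
qed

lemma difference_quotient_schwartz:
  fixes u :: "schwartz dual"
  shows "(\<lambda>k. real (Suc k) * (pairing u (shift_test (inverse (real (Suc k))) \<phi>) - pairing u \<phi>))
    \<longlonglongrightarrow> pairing u (deriv_test \<phi>)"
proof -
  define h where "h k = inverse (real (Suc k))" for k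
  define X where "X k = real (Suc k) *\<^sub>R (shift_test (h k) \<phi> - \<phi>)" for k
  have h: "0 < h k" "h k \<le> 1" for k by (auto simp: h_def divide_simps)
  have "(\<lambda>k. pairing u (X k)) \<longlonglongrightarrow> pairing u (deriv_test \<phi>)"
  proof (rule seminorm_tendsto[where p = schwartz_seminorm])
    show "seminorm_open schwartz_seminorm (pairing u -` V)" if "open V" for V
      using open_vimage[OF that continuous_on_pairing[of u]] by (simp add: open_schwartz_def)
    fix i :: "nat \<times> nat"
    obtain m n where i: "i = (m, n)" by (cases i)
    have le: "schwartz_seminorm i (X k - deriv_test \<phi>) \<le> h k * (2 ^ m * schwartz_seminorm (m, Suc (Suc n)) \<phi>)" for k
      unfolding i
    proof (rule schwartz_seminorm_least)
      fix x
      let ?f = "schwartz_apply \<phi>"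
      obtain \<xi> where \<xi>: "x < \<xi>" "\<xi> < x + h k"
        "\<bar>((deriv ^^ n) ?f (x + h k) - (deriv ^^ n) ?f x) / h k - (deriv ^^ Suc n) ?f x\<bar>
          \<le> h k * \<bar>(deriv ^^ Suc (Suc n)) ?f \<xi>\<bar>"
        by (rule difference_quotient_bound[OF smooth_schwartz h(1)])
      \<comment> \<open>The step size is at most 1, so \<open>x\<close> and \<open>\<xi>\<close> are
        at distance below 1.\<close>
      have "1 + \<bar>x\<bar> \<le> 2 * (1 + \<bar>\<xi>\<bar>)" using \<xi>(1,2) h[of k] by (simp add: abs_if split: if_splits)
      then have "(1 + \<bar>x\<bar>) ^ m \<le> 2 ^ m * (1 + \<bar>\<xi>\<bar>) ^ m"
        unfolding power_mult_distrib[symmetric] by (intro power_mono) auto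
      then have "(1 + \<bar>x\<bar>) ^ m * \<bar>((deriv ^^ n) ?f (x + h k) - (deriv ^^ n) ?f x) / h k - (deriv ^^ Suc n) ?f x\<bar>
          \<le> (2 ^ m * (1 + \<bar>\<xi>\<bar>) ^ m) * (h k * \<bar>(deriv ^^ Suc (Suc n)) ?f \<xi>\<bar>)"
        using \<xi>(3) by (intro mult_mono) auto
      also have "\<dots> = h k * (2 ^ m * ((1 + \<bar>\<xi>\<bar>) ^ m * \<bar>(deriv ^^ Suc (Suc n)) ?f \<xi>\<bar>))"
        by (simp only: mult_ac)
      also have "\<dots> \<le> h k * (2 ^ m * schwartz_seminorm (m, Suc (Suc n)) \<phi>)"
        using h[of k] by (intro mult_left_mono schwartz_seminorm_upper) auto
      finally show "(1 + \<bar>x\<bar>) ^ m * \<bar>(deriv ^^ n) (schwartz_apply (X k - deriv_test \<phi>)) x\<bar>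
          \<le> h k * (2 ^ m * schwartz_seminorm (m, Suc (Suc n)) \<phi>)"
        by (simp add: X_def higher_deriv_schwartz h_def divide_inverse mult.commute del: funpow.simps)
    qed
    have "(\<lambda>k. h k * (2 ^ m * schwartz_seminorm (m, Suc (Suc n)) \<phi>)) \<longlonglongrightarrow> 0"
      unfolding h_def by (intro tendsto_mult_left_zero LIMSEQ_inverse_real_of_nat)
    then show "(\<lambda>k. schwartz_seminorm i (X k - deriv_test \<phi>)) \<longlonglongrightarrow> 0"
      by (rule tendsto_sandwich[OF _ _ tendsto_const, rotated 2]) (simp_all add: schwartz_seminorm_nonneg le)
  qed
  then show ?thesis
    by (simp only: X_def h_def linear_scale[OF linear_pairing] linear_diff[OF linear_pairing] real_scaleR_def)
qed

lemma difference_quotient_periodic: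
  fixes u :: "periodic dual"
  shows "(\<lambda>k. real (Suc k) * (pairing u (shift_test (inverse (real (Suc k))) \<phi>) - pairing u \<phi>))
    \<longlonglongrightarrow> pairing u (deriv_test \<phi>)"
proof -
  define h where "h k = inverse (real (Suc k))" for k
  define X where "X k = real (Suc k) *\<^sub>R (shift_test (h k) \<phi> - \<phi>)" for k
  have h: "0 < h k" for k by (auto simp: h_def divide_simps)
  have "(\<lambda>k. pairing u (X k)) \<longlonglongrightarrow> pairing u (deriv_test \<phi>)"
  proof (rule seminorm_tendsto[where p = periodic_seminorm])
    show "seminorm_open periodic_seminorm (pairing u -` V)" if "open V" for V
      using open_vimage[OF that continuous_on_pairing[of u]] by (simp add: open_periodic_def)
    fix n
    have le: "periodic_seminorm n (X k - deriv_test \<phi>) \<le> h k * periodic_seminorm (Suc (Suc n)) \<phi>" for k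
    proof (rule periodic_seminorm_least)
      fix x
      let ?f = "periodic_apply \<phi>"
      obtain \<xi> where "\<bar>((deriv ^^ n) ?f (x + h k) - (deriv ^^ n) ?f x) / h k - (deriv ^^ Suc n) ?f x\<bar>
          \<le> h k * \<bar>(deriv ^^ Suc (Suc n)) ?f \<xi>\<bar>"
        by (rule difference_quotient_bound[OF smooth_periodic h])
      also have "\<dots> \<le> h k * periodic_seminorm (Suc (Suc n)) \<phi>"
        using h[of k] by (intro mult_left_mono periodic_seminorm_upper) auto
      finally show "\<bar>(deriv ^^ n) (periodic_apply (X k - deriv_test \<phi>)) x\<bar> \<le> h k * periodic_seminorm (Suc (Suc n)) \<phi>"
        by (simp add: X_def higher_deriv_periodic_ops h_def divide_inverse mult.commute del: funpow.simps)
    qed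
    have "(\<lambda>k. h k * periodic_seminorm (Suc (Suc n)) \<phi>) \<longlonglongrightarrow> 0"
      unfolding h_def by (intro tendsto_mult_left_zero LIMSEQ_inverse_real_of_nat)
    then show "(\<lambda>k. periodic_seminorm n (X k - deriv_test \<phi>)) \<longlonglongrightarrow> 0"
      by (rule tendsto_sandwich[OF _ _ tendsto_const, rotated 2]) (simp_all add: periodic_seminorm_nonneg le)
  qed
  then show ?thesis
    by (simp only: X_def h_def linear_scale[OF linear_pairing] linear_diff[OF linear_pairing] real_scaleR_def)
qed


section \<open>Density of the test functions\<close>

text \<open>The circle \<open>\<bar>z - 1/2\<bar> = 1/2\<close> is the one-point compactification of the line: it is
  parametrised by \<open>x = Im z / Re z\<close>, and the point at infinity is \<open>z = 0\<close>.\<close>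

definition line_ext :: "(real \<Rightarrow> real) \<Rightarrow> complex \<Rightarrow> real" where
  "line_ext f z = (if Re z = 0 then 0 else f (Im z / Re z))"

text \<open>The point other than 0 in which the line of slope \<open>x\<close> through the origin
  meets the circle.\<close>

definition line_point :: "real \<Rightarrow> complex" where
  "line_point x = Complex (1 / (1 + x\<^sup>2)) (x / (1 + x\<^sup>2))"

lemma line_circle_iff: "z \<in> sphere (1/2) (1/2) \<longleftrightarrow> (Re z)\<^sup>2 + (Im z)\<^sup>2 = Re z"
proof -
  have "z \<in> sphere (1/2) (1/2) \<longleftrightarrow> (cmod (1/2 - z))\<^sup>2 = (1/2)\<^sup>2"
    using power2_eq_iff_nonneg[of "cmod (1/2 - z)" "1/2"] by (simp add: dist_norm)
  also have "(cmod (1/2 - z))\<^sup>2 = (1/2 - Re z)\<^sup>2 + (Im z)\<^sup>2" by (simp add: cmod_power2)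
  also have "\<dots> = (1/2)\<^sup>2 \<longleftrightarrow> (Re z)\<^sup>2 + (Im z)\<^sup>2 = Re z"
    by (auto simp: power2_eq_square algebra_simps)
  finally show ?thesis .
qed

lemma line_point: "line_point x \<in> sphere (1/2) (1/2)" "line_ext f (line_point x) = f x"
proof -
  have pos: "1 + x\<^sup>2 > 0" by (simp add: add_pos_nonneg)
  have "(1 / (1 + x\<^sup>2))\<^sup>2 + (x / (1 + x\<^sup>2))\<^sup>2 = (1 + x\<^sup>2) / (1 + x\<^sup>2)\<^sup>2"
    by (simp add: power_divide add_divide_distrib)
  also have "\<dots> = 1 / (1 + x\<^sup>2)" using pos by (simp add: power2_eq_square)
  finally show "line_point x \<in> sphere (1/2) (1/2)" unfolding line_circle_iff by (simp add: line_point_def)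
  show "line_ext f (line_point x) = f x" using pos by (simp add: line_ext_def line_point_def)
qed

text \<open>This is the equation of the circle divided by the square of \<open>Re z\<close>. It
  shows that the parameter \<open>Im z / Re z\<close> determines the point and that it becomes
  unbounded near the origin.\<close>

lemma line_circle_Re:
  assumes "z \<in> sphere (1/2) (1/2)" "Re z \<noteq> 0"
  shows "1 / Re z = 1 + (Im z / Re z)\<^sup>2" "0 < Re z"
proof -
  have eq: "(Re z)\<^sup>2 + (Im z)\<^sup>2 = Re z" using assms line_circle_iff by blast
  then have "Re z * (1 / Re z) = Re z * (1 + (Im z / Re z)\<^sup>2)"
    using assms(2) by (simp add: power2_eq_square field_simps)
  then show "1 / Re z = 1 + (Im z / Re z)\<^sup>2" using assms(2) mult_left_cancel by blast
  have "0 \<le> Re z" using eq by (metis sum_power2_ge_zero)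
  then show "0 < Re z" using assms(2) by simp
qed

lemma line_circle_eqI:
  assumes "z \<in> sphere (1/2) (1/2)" "w \<in> sphere (1/2) (1/2)"
    and "Re z \<noteq> 0" "Re w \<noteq> 0" "Im z / Re z = Im w / Re w"
  shows "z = w"
proof -
  have "1 / Re z = 1 / Re w"
    using line_circle_Re(1)[OF assms(1,3)] line_circle_Re(1)[OF assms(2,4)] assms(5) by simp
  then have "Re z = Re w" by simp
  then show ?thesis using assms(3,5) by (simp add: complex_eq_iff)
qed

lemma continuous_on_line_ext:
  assumes f: "continuous_on UNIV f" and lim: "(f \<longlongrightarrow> 0) at_infinity"
  shows "continuous_on (sphere (1/2) (1/2)) (line_ext f)"
  unfolding continuous_on_eq_continuous_within
proof
  fix z :: complex assume z: "z \<in> sphere (1/2) (1/2)"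
  let ?S = "sphere (1/2) (1/2) :: complex set"
  show "continuous (at z within ?S) (line_ext f)"
  proof (cases "Re z = 0")
    case False
    have op: "open {w :: complex. Re w \<noteq> 0}"
      by (intro open_Collect_neq continuous_intros)
    have "continuous (at z) (\<lambda>w. Im w / Re w)" using False by (intro continuous_intros) auto
    then have "continuous (at z) (\<lambda>w. f (Im w / Re w))"
      using f by (auto intro: continuous_at_compose[unfolded o_def] simp: continuous_on_eq_continuous_at)
    then have "isCont (line_ext f) z"
      using op False
      by (elim continuous_transform_within_openin[where T = UNIV and S = "{w. Re w \<noteq> 0}", simplified])
         (auto simp: line_ext_def)
    then show ?thesis by (rule continuous_at_imp_continuous_at_within)
  next
    case True
    then have z0: "z = 0" using z line_circle_iff[of z] by (simp add: complex_eq_iff)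
    show ?thesis
      unfolding continuous_within_eps_delta
    proof (intro allI impI)
      fix \<epsilon> :: real assume \<epsilon>: "\<epsilon> > 0"
      have "\<forall>\<^sub>F x in at_infinity. \<bar>f x\<bar> < \<epsilon>" using tendstoD[OF lim \<epsilon>] by (simp add: dist_real_def)
      then obtain B where B: "\<And>x. B \<le> \<bar>x\<bar> \<Longrightarrow> \<bar>f x\<bar> < \<epsilon>" unfolding eventually_at_infinity by auto
      \<comment> \<open>On the circle, \<open>Re w < 1 / (1 + B\<^sup>2)\<close> forces the
        parameter of \<open>w\<close> beyond \<open>B\<close>, where \<open>f\<close> is small; this
        dictates the radius. The only other point is the origin itself.\<close>
      have "dist (line_ext f w) (line_ext f z) < \<epsilon>" if w: "w \<in> ?S" "dist w z < 1 / (1 + B\<^sup>2)" for w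
      proof (cases "Re w = 0")
        case False
        have pos: "0 < 1 + B\<^sup>2" by (simp add: add_pos_nonneg)
        have "Re w < 1 / (1 + B\<^sup>2)" using w(2) z0 abs_Re_le_cmod[of w] by simp
        then have "1 + B\<^sup>2 < 1 / Re w"
          using line_circle_Re(2)[OF w(1) False] pos by (simp add: field_simps)
        then have "B\<^sup>2 < (Im w / Re w)\<^sup>2" using line_circle_Re(1)[OF w(1) False] by simp
        then have "B \<le> \<bar>Im w / Re w\<bar>"
          by (metis abs_ge_self abs_le_square_iff less_imp_le order.trans)
        then show ?thesis using B[of "Im w / Re w"] False True by (simp add: line_ext_def)
      qed (simp add: line_ext_def True \<epsilon>)
      moreover have "0 < 1 / (1 + B\<^sup>2)" by (simp add: add_pos_nonneg)
      ultimately show "\<exists>d>0. \<forall>w\<in>?S. dist w z < d \<longrightarrow> dist (line_ext f w) (line_ext f z) < \<epsilon>" by blast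
    qed
  qed
qed

lemma continuous_on_line_ext_schwartz: "continuous_on (sphere (1/2) (1/2)) (line_ext (schwartz_apply \<phi>))"
  using higher_deriv_continuous[OF smooth_schwartz, of UNIV 0 \<phi>]
  by (intro continuous_on_line_ext schwartz_tendsto_0) simp

text \<open>A Gaussian centred at the parameter of one point takes the value 1 there and at no other
  point of the circle; at infinity its extension is 0. Of two distinct points at least one is not at
  infinity.\<close>

lemma schwartz_separates:
  assumes "z \<in> sphere (1/2) (1/2)" "w \<in> sphere (1/2) (1/2)" "z \<noteq> w"
  shows "\<exists>\<phi>. line_ext (schwartz_apply \<phi>) z \<noteq> line_ext (schwartz_apply \<phi>) w"
proof -
  have *: "\<exists>\<phi>. line_ext (schwartz_apply \<phi>) z \<noteq> line_ext (schwartz_apply \<phi>) w"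
    if zw: "z \<in> sphere (1/2) (1/2)" "w \<in> sphere (1/2) (1/2)" "z \<noteq> w" and z: "Re z \<noteq> 0" for z w
  proof -
    define \<phi> where "\<phi> = shift_test (- (Im z / Re z)) gaussian"
    have \<phi>: "schwartz_apply \<phi> x = exp (- ((x - Im z / Re z)\<^sup>2))" for x
      by (simp add: \<phi>_def shift_test_schwartz_def schwartz_shift.rep_eq gaussian.rep_eq)
    have "line_ext (schwartz_apply \<phi>) z = 1" using z by (simp add: line_ext_def \<phi>)
    moreover have "line_ext (schwartz_apply \<phi>) w \<noteq> 1"
      using line_circle_eqI[OF zw(1,2) z] zw(3) by (auto simp: line_ext_def \<phi>)
    ultimately show ?thesis by (intro exI[of _ \<phi>]) simp
  qed
  have "Re z \<noteq> 0 \<or> Re w \<noteq> 0" using assms line_circle_iff by (auto simp: complex_eq_iff)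
  then show ?thesis using *[of z w] *[of w z] assms by metis
qed

text \<open>Schwartz functions vanish at infinity, so constants are adjoined to obtain the unital
  algebra that the Stone-Weierstrass theorem requires.\<close>

definition line_ring :: "(complex \<Rightarrow> real) set" where
  "line_ring = {g. continuous_on (sphere (1/2) (1/2)) g \<and>
     (\<exists>c \<phi>. \<forall>z. g z = c + line_ext (schwartz_apply \<phi>) z)}"

lemma line_ringI:
  "(\<And>z. g z = c + line_ext (schwartz_apply \<phi>) z) \<Longrightarrow> g \<in> line_ring"
  using continuous_on_add[OF continuous_on_const[of _ c] continuous_on_line_ext_schwartz[of \<phi>]]
  by (auto simp: line_ring_def fun_eq_iff[symmetric] cong: continuous_on_cong)

interpretation line_ring: function_ring_on line_ring "sphere (1/2) (1/2)"
proof
  fix f g assume "f \<in> line_ring" "g \<in> line_ring"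
  then obtain c \<phi> d \<psi> where f: "\<And>z. f z = c + line_ext (schwartz_apply \<phi>) z"
    and g: "\<And>z. g z = d + line_ext (schwartz_apply \<psi>) z"
    unfolding line_ring_def by blast
  show "(\<lambda>z. f z + g z) \<in> line_ring"
    by (rule line_ringI[of _ "c + d" "\<phi> + \<psi>"]) (simp add: f g line_ext_def plus_schwartz.rep_eq)
  show "(\<lambda>z. f z * g z) \<in> line_ring"
    by (rule line_ringI[of _ "c * d" "c *\<^sub>R \<psi> + d *\<^sub>R \<phi> + schwartz_mult \<phi> \<psi>"])
      (simp add: f g line_ext_def plus_schwartz.rep_eq scaleR_schwartz.rep_eq schwartz_mult.rep_eq algebra_simps)
next
  show "(\<lambda>_. c) \<in> line_ring" for c
    by (rule line_ringI[of _ c 0]) (simp add: line_ext_def zero_schwartz.rep_eq)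
  show "\<exists>f\<in>line_ring. f z \<noteq> f w" if "z \<in> sphere (1/2) (1/2)" "w \<in> sphere (1/2) (1/2)" "z \<noteq> w" for z w
    using schwartz_separates[OF that] line_ringI[of _ 0] by auto
qed (auto simp: line_ring_def)

lemma schwartz_dense_C0:
  assumes "0 < \<epsilon>"
  shows "\<exists>\<phi>. norm (f - C0_of_schwartz \<phi>) \<le> \<epsilon>"
proof -
  let ?f = "apply_bcontfun (C0_bcontfun f)"
  have "continuous_on (sphere (1/2) (1/2)) (line_ext ?f)"
    using C0_bcontfun[of f] by (intro continuous_on_line_ext) (auto simp: continuous_on_apply_bcontfun)
  then obtain g where "g \<in> line_ring" and g: "\<And>z. z \<in> sphere (1/2) (1/2) \<Longrightarrow> \<bar>line_ext ?f z - g z\<bar> < \<epsilon> / 2"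
    using line_ring.Stone_Weierstrass_basic[of "line_ext ?f" "\<epsilon> / 2"] assms by auto
  then obtain c \<phi> where c: "\<And>z. g z = c + line_ext (schwartz_apply \<phi>) z"
    unfolding line_ring_def by blast
  have "0 \<in> sphere (1/2 :: complex) (1/2)" unfolding line_circle_iff by simp
  then have "\<bar>c\<bar> < \<epsilon> / 2" using g[of 0] c[of 0] by (simp add: line_ext_def)
  then have "\<bar>?f x - schwartz_apply \<phi> x\<bar> \<le> \<epsilon>" for x
    using g[OF line_point(1)[of x]] unfolding c line_point(2) by linarith
  then have "norm (f - C0_of_schwartz \<phi>) \<le> \<epsilon>"
    unfolding norm_C0_fun.rep_eq by (intro norm_bound) (simp add: minus_C0_fun.rep_eq)
  then show ?thesis ..
qed

section \<open>Periodic functions as functions on the unit circle\<close>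

lemma periodic_of_int:
  fixes f :: "real \<Rightarrow> 'a"
  assumes "\<And>x. f (x + 1) = f x"
  shows "f (x + of_int k) = f x"
proof (induction k rule: int_induct[where k = 0])
  case (step1 i)
  then show ?case using assms[of "x + of_int i"] by (simp add: add.assoc)
next
  case (step2 i)
  then show ?case using assms[of "x + of_int (i - 1)"] by (simp add: algebra_simps)
qed simp

definition circle_fun :: "(real \<Rightarrow> real) \<Rightarrow> complex \<Rightarrow> real" where
  "circle_fun f z = f (Arg z / (2 * pi))"

text \<open>\<open>Arg (cis t)\<close> and \<open>t\<close> differ by a multiple of
  \<open>2 * pi\<close>, which periodicity absorbs.\<close>

lemma circle_fun_cis:
  assumes f: "\<And>x. f (x + 1) = f x"
  shows "circle_fun f (cis t) = f (t / (2 * pi))"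
proof -
  have "cis (Arg (cis t)) = cis t" using cis_Arg[of "cis t"] by simp
  then have "sin (Arg (cis t)) = sin t \<and> cos (Arg (cis t)) = cos t" by (simp add: complex_eq_iff)
  then obtain n :: int where "Arg (cis t) = t + 2 * pi * of_int n"
    unfolding sin_cos_eq_iff by blast
  then have "Arg (cis t) / (2 * pi) = t / (2 * pi) + of_int n" by (simp add: field_simps)
  then show ?thesis unfolding circle_fun_def using periodic_of_int[of f, OF f] by simp
qed

text \<open>\<open>Arg\<close> jumps across the negative real axis. There \<open>Arg2pi\<close> is
  used, whose jump lies on the positive real axis; the two branches define the same function because
  \<open>f\<close> is periodic.\<close>

lemma continuous_on_circle_fun:
  assumes f: "\<And>x. f (x + 1) = f x" and cont: "continuous_on UNIV f"
  shows "continuous_on (sphere 0 1) (circle_fun f)"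
  unfolding continuous_on_eq_continuous_within
proof
  fix z :: complex assume z: "z \<in> sphere 0 1"
  have iso: "isCont (\<lambda>w. f (A w / (2 * pi))) z" if "isCont A z" for A :: "complex \<Rightarrow> real"
  proof -
    have "isCont (\<lambda>w. A w / (2 * pi)) z" using that by (intro continuous_intros) auto
    moreover have "isCont f (A z / (2 * pi))" using cont by (simp add: continuous_on_eq_continuous_at)
    ultimately show ?thesis by (rule isCont_o2)
  qed
  show "continuous (at z within sphere 0 1) (circle_fun f)"
  proof (cases "z \<in> \<real>\<^sub>\<le>\<^sub>0")
    case False
    then show ?thesis
      unfolding circle_fun_def[abs_def] by (rule continuous_at_imp_continuous_at_within[OF iso[OF continuous_at_Arg]])
  next
    case True
    then have "z \<notin> \<real>\<^sub>\<ge>\<^sub>0" using z by (auto simp: complex_nonneg_Reals_iff complex_nonpos_Reals_iff complex_eq_iff norm_complex_def)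
    then have "continuous (at z within sphere 0 1) (\<lambda>w. f (Arg2pi w / (2 * pi)))"
      by (rule continuous_at_imp_continuous_at_within[OF iso[OF continuous_at_Arg2pi]])
    then show ?thesis
    proof (rule continuous_transform_within[OF _ zero_less_one z])
      fix w :: complex assume "w \<in> sphere 0 1"
      then have "exp (\<i> * complex_of_real (Arg2pi w)) = w" using complex_norm_eq_1_exp[of w] by simp
      then have "w = cis (Arg2pi w)" by (simp add: cis_conv_exp)
      then show "f (Arg2pi w / (2 * pi)) = circle_fun f w"
        using circle_fun_cis[of f "Arg2pi w", OF f] by simp
    qed
  qed
qed

lemma continuous_on_circle_fun_periodic: "continuous_on (sphere 0 1) (circle_fun (periodic_apply \<phi>))"
  using higher_deriv_continuous[OF smooth_periodic, of UNIV 0 \<phi>]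
  by (intro continuous_on_circle_fun periodic_apply_plus_1) simp

lift_definition periodic_mult :: "periodic \<Rightarrow> periodic \<Rightarrow> periodic" is "\<lambda>f g x. f x * g x"
  by (simp add: higher_deriv_mult(1))

lift_definition periodic_cos :: periodic is "\<lambda>x. cos (2 * pi * x)"
proof -
  \<comment> \<open>Each derivative advances the phase by a quarter turn and contributes a factor
    \<open>2 * pi\<close>, so the derivatives need no case distinction modulo 4.\<close>
  define F where "F n x = (2 * pi) ^ n * cos (2 * pi * x + real n * (pi / 2))" for n x
  have D: "(F n has_field_derivative F (Suc n) x) (at x)" for n x
  proof -
    have "cos (2 * pi * x + real (Suc n) * (pi / 2)) = cos ((2 * pi * x + real n * (pi / 2)) + pi / 2)"
      by (rule arg_cong[where f = cos]) (simp add: algebra_simps add_divide_distrib)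
    also have "\<dots> = - sin (2 * pi * x + real n * (pi / 2))"
      by (simp add: cos_add)
    finally have "F (Suc n) x = - ((2 * pi) ^ Suc n * sin (2 * pi * x + real n * (pi / 2)))"
      by (simp only: F_def mult_minus_right)
    then show ?thesis unfolding F_def
      by (auto intro!: derivative_eq_intros)
  qed
  have "F 0 = (\<lambda>x. cos (2 * pi * x))" by (rule ext) (simp add: F_def)
  from smoothI(1)[of F, OF D this]
  show "smooth (\<lambda>x. cos (2 * pi * x)) \<and> (\<forall>x. cos (2 * pi * (x + 1)) = cos (2 * pi * x))"
    by (simp add: distrib_left)
qed

text \<open>As a cosine delayed by a quarter period, the sine inherits smoothness and
  periodicity.\<close>

definition periodic_sin :: periodic where
  "periodic_sin = shift_test (- (1/4)) periodic_cos"

lemma circle_fun_cos_sin: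
  assumes "z \<in> sphere 0 1"
  shows "circle_fun (periodic_apply periodic_cos) z = Re z"
    and "circle_fun (periodic_apply periodic_sin) z = Im z"
proof -
  have "z \<noteq> 0" using assms by auto
  then have z: "cis (Arg z) = z" using assms cis_Arg[of z] by (simp add: sgn_div_norm)
  show "circle_fun (periodic_apply periodic_cos) z = Re z"
    by (subst (2) z[symmetric]) (simp add: circle_fun_def periodic_cos.rep_eq)
  have "cos (Arg z - pi / 2) = sin (Arg z)" by (simp add: cos_diff)
  then show "circle_fun (periodic_apply periodic_sin) z = Im z"
    by (subst (2) z[symmetric])
      (simp add: circle_fun_def periodic_sin_def shift_test_periodic_def periodic_shift.rep_eq periodic_cos.rep_eq right_diff_distrib)
qed

text \<open>The constants already are periodic test functions, and the cosine and the sine, being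
  the two coordinates on the circle, separate its points.\<close>

interpretation circle_ring: function_ring_on "range (\<lambda>\<phi>. circle_fun (periodic_apply \<phi>))" "sphere 0 1"
proof
  fix f g assume "f \<in> range (\<lambda>\<phi>. circle_fun (periodic_apply \<phi>))" "g \<in> range (\<lambda>\<phi>. circle_fun (periodic_apply \<phi>))"
  then obtain \<phi> \<psi> where f: "f = circle_fun (periodic_apply \<phi>)" and g: "g = circle_fun (periodic_apply \<psi>)" by blast
  show "(\<lambda>z. f z + g z) \<in> range (\<lambda>\<phi>. circle_fun (periodic_apply \<phi>))"
    by (rule range_eqI[of _ _ "\<phi> + \<psi>"]) (simp add: f g circle_fun_def plus_periodic.rep_eq fun_eq_iff)
  show "(\<lambda>z. f z * g z) \<in> range (\<lambda>\<phi>. circle_fun (periodic_apply \<phi>))"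
    by (rule range_eqI[of _ _ "periodic_mult \<phi> \<psi>"]) (simp add: f g circle_fun_def periodic_mult.rep_eq fun_eq_iff)
next
  show "(\<lambda>_. c) \<in> range (\<lambda>\<phi>. circle_fun (periodic_apply \<phi>))" for c
    by (rule range_eqI[of _ _ "c *\<^sub>R 1"]) (simp add: circle_fun_def scaleR_periodic.rep_eq one_periodic.rep_eq fun_eq_iff)
  show "\<exists>f\<in>range (\<lambda>\<phi>. circle_fun (periodic_apply \<phi>)). f z \<noteq> f w"
    if "z \<in> sphere 0 1" "w \<in> sphere 0 1" "z \<noteq> w" for z w
  proof (cases "Re z = Re w")
    case True
    then have "Im z \<noteq> Im w" using that(3) by (simp add: complex_eq_iff)
    then show ?thesis using circle_fun_cos_sin(2)[OF that(1)] circle_fun_cos_sin(2)[OF that(2)]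
      by (intro bexI[of _ "circle_fun (periodic_apply periodic_sin)"] rangeI) simp
  next
    case False
    then show ?thesis using circle_fun_cos_sin(1)[OF that(1)] circle_fun_cos_sin(1)[OF that(2)]
      by (intro bexI[of _ "circle_fun (periodic_apply periodic_cos)"] rangeI) simp
  qed
qed (auto simp: continuous_on_circle_fun_periodic)

lemma periodic_dense_CT:
  assumes "0 < \<epsilon>"
  shows "\<exists>\<phi>. norm (f - CT_of_periodic \<phi>) \<le> \<epsilon>"
proof -
  let ?f = "apply_bcontfun (CT_bcontfun f)"
  have f: "?f (x + 1) = ?f x" for x using CT_bcontfun[of f] by simp
  have "continuous_on (sphere 0 1) (circle_fun ?f)"
    by (intro continuous_on_circle_fun f) (simp add: continuous_on_apply_bcontfun)
  then obtain \<phi> where \<phi>: "\<And>z. z \<in> sphere 0 1 \<Longrightarrow> \<bar>circle_fun ?f z - circle_fun (periodic_apply \<phi>) z\<bar> < \<epsilon>"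
    using circle_ring.Stone_Weierstrass_basic[of "circle_fun ?f" \<epsilon>] assms by blast
  have "\<bar>?f x - periodic_apply \<phi> x\<bar> \<le> \<epsilon>" for x
    using \<phi>[of "cis (2 * pi * x)"]
    by (simp add: circle_fun_cis[of ?f, OF f] circle_fun_cis[of "periodic_apply \<phi>", OF periodic_apply_plus_1])
  then have "norm (f - CT_of_periodic \<phi>) \<le> \<epsilon>"
    unfolding norm_CT_fun.rep_eq by (intro norm_bound) (simp add: minus_CT_fun.rep_eq)
  then show ?thesis ..
qed

section \<open>Injectivity of the embeddings of measures\<close>

lemma linear_dist_of_radon_R: "linear dist_of_radon_R"
  by (rule linearI; rule dual_eqI)
    (simp_all add: dist_of_radon_R.rep_eq plus_dual.rep_eq scaleR_dual.rep_eq blinfun.add_left blinfun.scaleR_left)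

lemma linear_dist_of_radon_T: "linear dist_of_radon_T"
  by (rule linearI; rule dual_eqI)
    (simp_all add: dist_of_radon_T.rep_eq plus_dual.rep_eq scaleR_dual.rep_eq blinfun.add_left blinfun.scaleR_left)

lemma blinfun_eq_0_on_dense:
  fixes \<nu> :: "'a::real_normed_vector \<Rightarrow>\<^sub>L real"
  assumes "\<And>\<phi>. \<nu> (e \<phi>) = 0" and dense: "\<And>f \<epsilon>. 0 < \<epsilon> \<Longrightarrow> \<exists>\<phi>. norm (f - e \<phi>) \<le> \<epsilon>"
  shows "\<nu> = 0"
proof (rule blinfun_eqI)
  fix f
  have "\<bar>\<nu> f\<bar> \<le> 0 + \<epsilon>" if \<epsilon>: "0 < \<epsilon>" for \<epsilon>
  proof -
    have pos: "0 < 1 + norm \<nu>" by (simp add: add_pos_nonneg)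
    obtain \<phi> where \<phi>: "norm (f - e \<phi>) \<le> \<epsilon> / (1 + norm \<nu>)"
      using dense[of "\<epsilon> / (1 + norm \<nu>)" f] \<epsilon> pos by auto
    have "\<bar>\<nu> f\<bar> = norm (\<nu> (f - e \<phi>))" by (simp add: blinfun.diff_right assms(1))
    also have "\<dots> \<le> norm \<nu> * (\<epsilon> / (1 + norm \<nu>))"
      using \<phi> by (intro order.trans[OF norm_blinfun] mult_left_mono) auto
    also have "\<dots> \<le> \<epsilon>" using that pos by (simp add: field_simps)
    finally show ?thesis by simp
  qed
  then have "\<bar>\<nu> f\<bar> \<le> 0" by (rule field_le_epsilon)
  then show "\<nu> f = blinfun_apply 0 f" by simp
qed

lemma inj_dist_of_radon_R: "inj dist_of_radon_R"
proof (subst linear_injective_0[OF linear_dist_of_radon_R], intro allI impI)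
  fix \<nu> assume "dist_of_radon_R \<nu> = 0"
  then have "\<nu> (C0_of_schwartz \<phi>) = 0" for \<phi>
    by (metis dist_of_radon_R.rep_eq zero_dual.rep_eq)
  then show "\<nu> = 0" using schwartz_dense_C0 by (rule blinfun_eq_0_on_dense)
qed

lemma inj_dist_of_radon_T: "inj dist_of_radon_T"
proof (subst linear_injective_0[OF linear_dist_of_radon_T], intro allI impI)
  fix \<nu> assume "dist_of_radon_T \<nu> = 0"
  then have "\<nu> (CT_of_periodic \<phi>) = 0" for \<phi>
    by (metis dist_of_radon_T.rep_eq zero_dual.rep_eq)
  then show "\<nu> = 0" using periodic_dense_CT by (rule blinfun_eq_0_on_dense)
qed


section \<open>Antiderivatives on the line\<close>

text \<open>The constant in the bounds on the line: an integral against a Schwartz function is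
  controlled by a seminorm whose weight exponent is raised by 2, the surplus being this integrable
  weight.\<close>

definition decay_mass :: real where
  "decay_mass = (LINT x|lborel. 1 / (1 + \<bar>x\<bar>)\<^sup>2)"

text \<open>The function is dominated by \<open>1 / (1 + x\<^sup>2)\<close>, the derivative of the
  bounded function \<open>arctan\<close>.\<close>

lemma integrable_decay: "integrable lborel (\<lambda>x :: real. 1 / (1 + \<bar>x\<bar>)\<^sup>2)"
proof (rule Bochner_Integration.integrable_bound)
  have "set_integrable lborel (einterval (-\<infinity>) \<infinity>) (\<lambda>x. inverse (1 + x\<^sup>2))"
  proof (rule interval_integral_FTC_nonneg[where F = arctan and A = "- (pi / 2)" and B = "pi / 2"])
    show "((arctan \<circ> real_of_ereal) \<longlongrightarrow> - (pi / 2)) (at_right (- \<infinity>))"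
      "((arctan \<circ> real_of_ereal) \<longlongrightarrow> pi / 2) (at_left \<infinity>)"
      by (simp_all add: ereal_tendsto_simps tendsto_arctan_at_bot tendsto_arctan_at_top)
    show "isCont (\<lambda>x. inverse (1 + x\<^sup>2)) x" for x :: real
      by (intro continuous_intros) (auto simp: add_nonneg_eq_0_iff)
  qed (auto intro!: DERIV_arctan)
  then show "integrable lborel (\<lambda>x :: real. inverse (1 + x\<^sup>2))"
    by (simp add: set_integrable_def)
  have "norm (1 / (1 + \<bar>x\<bar>)\<^sup>2) \<le> norm (inverse (1 + x\<^sup>2))" for x :: real
  proof -
    have "0 < 1 + x\<^sup>2" by (simp add: add_pos_nonneg)
    moreover have "1 + x\<^sup>2 \<le> (1 + \<bar>x\<bar>)\<^sup>2" by (simp add: power2_sum)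
    ultimately show ?thesis by (simp add: divide_inverse le_imp_inverse_le)
  qed
  then show "AE x in lborel. norm (1 / (1 + \<bar>x :: real\<bar>)\<^sup>2) \<le> norm (inverse (1 + x\<^sup>2))" by simp
qed simp

lemma decay_mass_nonneg: "0 \<le> decay_mass"
  unfolding decay_mass_def by (rule integral_nonneg_AE) simp

lemma schwartz_decay:
  "(1 + \<bar>x\<bar>) ^ m * \<bar>schwartz_apply \<phi> x\<bar> \<le> schwartz_seminorm (m + 2, 0) \<phi> * (1 / (1 + \<bar>x\<bar>)\<^sup>2)"
proof -
  have "0 < (1 + \<bar>x\<bar>)\<^sup>2" by (simp add: add_pos_nonneg)
  then show ?thesis
    using schwartz_seminorm_upper[of x "m + 2" 0 \<phi>]
    by (simp only: power_add funpow_0 times_divide_eq_right mult_1_right pos_le_divide_eq mult_ac)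
qed

lemma continuous_on_schwartz: "continuous_on S (schwartz_apply \<phi>)"
  using higher_deriv_continuous[OF smooth_schwartz, of S 0 \<phi>] by simp

lemma schwartz_measurable [measurable]: "schwartz_apply \<phi> \<in> borel_measurable borel"
  by (intro borel_measurable_continuous_onI continuous_on_schwartz)

lemma moment_decay: "\<bar>schwartz_apply \<phi> x * x ^ j\<bar> \<le> schwartz_seminorm (j + 2, 0) \<phi> * (1 / (1 + \<bar>x\<bar>)\<^sup>2)"
proof -
  have "\<bar>schwartz_apply \<phi> x * x ^ j\<bar> \<le> (1 + \<bar>x\<bar>) ^ j * \<bar>schwartz_apply \<phi> x\<bar>"
    by (simp add: abs_mult power_abs mult.commute[of "\<bar>schwartz_apply \<phi> x\<bar>"] mult_right_mono power_mono)
  also note schwartz_decay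
  finally show ?thesis .
qed

lemma integrable_moment: "integrable lborel (\<lambda>x. schwartz_apply \<phi> x * x ^ j)"
  by (rule Bochner_Integration.integrable_bound[OF integrable_mult_right[OF integrable_decay, of "schwartz_seminorm (j + 2, 0) \<phi>"]])
    (use moment_decay in \<open>auto simp: schwartz_seminorm_nonneg intro: order.trans\<close>)

lemma moment_bound:
  "\<bar>LINT x|lborel. schwartz_apply \<phi> x * x ^ j\<bar> \<le> decay_mass * schwartz_seminorm (j + 2, 0) \<phi>"
proof -
  have "\<bar>LINT x|lborel. schwartz_apply \<phi> x * x ^ j\<bar> \<le> (LINT x|lborel. \<bar>schwartz_apply \<phi> x * x ^ j\<bar>)"
    using integral_abs_bound .
  also have "\<dots> \<le> (LINT x|lborel. schwartz_seminorm (j + 2, 0) \<phi> * (1 / (1 + \<bar>x\<bar>)\<^sup>2))"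
    by (intro integral_mono integrable_abs integrable_moment integrable_mult_right integrable_decay moment_decay)
  finally show ?thesis by (simp only: integral_mult_right_zero decay_mass_def mult.commute)
qed

text \<open>For \<open>j < N\<close> these span the kernel of \<open>deriv_dist ^^ N\<close>, and
  their pairings with \<open>\<theta> n\<close> are the prescribed moments. The case
  \<open>j = 0\<close> is also the total integral of a test function, the obstruction to an
  antiderivative.\<close>

lift_definition monomial_dist :: "nat \<Rightarrow> schwartz dual"
  is "\<lambda>j \<phi>. LINT t|lborel. schwartz_apply \<phi> t * t ^ j"
proof -
  fix j
  let ?M = "\<lambda>\<phi>. LINT t|lborel. schwartz_apply \<phi> t * t ^ j"
  have lin: "linear ?M"
    by (rule linearI)
      (simp_all add: plus_schwartz.rep_eq scaleR_schwartz.rep_eq distrib_right mult.assoc integrable_moment)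
  have "open V \<Longrightarrow> open (?M -` V)" for V
    unfolding open_schwartz_def
    by (rule seminorm_open_vimage_real[where p = schwartz_seminorm and i = "(j + 2, 0)",
          OF lin _ decay_mass_nonneg moment_bound])
  then show "linear ?M \<and> continuous_on UNIV ?M"
    using lin by (simp add: continuous_on_open_vimage)
qed

lemma integral_deriv_line:
  fixes F f :: "real \<Rightarrow> real"
  assumes F: "\<And>x. (F has_field_derivative f x) (at x)" and f: "continuous_on UNIV f" "integrable lborel f"
    and lim: "(F \<longlongrightarrow> A) at_bot" "(F \<longlongrightarrow> B) at_top"
  shows "(LINT x|lborel. f x) = B - A"
proof -
  have "(LBINT x=-\<infinity>..\<infinity>. f x) = B - A"
    using F f lim
    by (intro interval_integral_FTC_integrable[where F = F])
      (auto simp: ereal_tendsto_simps set_integrable_def continuous_on_eq_continuous_at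
        has_real_derivative_iff_has_vector_derivative)
  then show ?thesis by (simp add: interval_lebesgue_integral_def set_lebesgue_integral_def)
qed

text \<open>Integration by parts, with boundary terms killed by the decay of the test function. For
  \<open>j = 0\<close> the factor \<open>real j\<close> makes the truncated exponent
  \<open>j - 1\<close> harmless.\<close>

lemma deriv_monomial_dist: "deriv_dist (monomial_dist j) = real j *\<^sub>R monomial_dist (j - 1)"
proof (rule dual_eqI)
  fix \<phi>
  let ?f = "schwartz_apply \<phi>" and ?f' = "schwartz_apply (deriv_test \<phi>)"
  have D: "(?f has_field_derivative ?f' x) (at x)" for x
    using smooth_has_derivative[OF smooth_schwartz, of 0 \<phi> x]
    by (simp add: deriv_test_schwartz_def schwartz_deriv.rep_eq)
  have lim: "((\<lambda>x. ?f x * x ^ j) \<longlongrightarrow> 0) at_infinity"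
  proof (rule Lim_null_comparison)
    show "\<forall>\<^sub>F x in at_infinity. norm (?f x * x ^ j) \<le> schwartz_seminorm (j + 1, 0) \<phi> * inverse (norm x)"
    proof (rule eventually_mono)
      show "\<forall>\<^sub>F x :: real in at_infinity. 1 \<le> norm x" by (auto simp: eventually_at_infinity)
      fix x :: real assume x: "1 \<le> norm x"
      have "\<bar>?f x\<bar> * \<bar>x\<bar> ^ (j + 1) \<le> (1 + \<bar>x\<bar>) ^ (j + 1) * \<bar>?f x\<bar>"
        by (subst mult.commute) (intro mult_right_mono power_mono, auto)
      also have "\<dots> \<le> schwartz_seminorm (j + 1, 0) \<phi>"
        using schwartz_seminorm_upper[of x "j + 1" 0 \<phi>] by simp
      finally show "norm (?f x * x ^ j) \<le> schwartz_seminorm (j + 1, 0) \<phi> * inverse (norm x)"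
        using x by (simp add: abs_mult power_abs field_simps)
    qed
    show "((\<lambda>x :: real. schwartz_seminorm (j + 1, 0) \<phi> * inverse (norm x)) \<longlongrightarrow> 0) at_infinity"
      by (intro tendsto_mult_right_zero tendsto_inverse_0_at_top filterlim_norm_at_top)
  qed
  have "(LINT x|lborel. ?f' x * x ^ j + real j * (?f x * x ^ (j - 1))) = 0 - 0"
  proof (rule integral_deriv_line[where F = "\<lambda>x. ?f x * x ^ j"])
    show "((\<lambda>x. ?f x * x ^ j) has_field_derivative ?f' x * x ^ j + real j * (?f x * x ^ (j - 1))) (at x)" for x
      by (rule DERIV_cong[OF DERIV_mult[OF D DERIV_pow]]) simp
    show "((\<lambda>x. ?f x * x ^ j) \<longlongrightarrow> 0) at_bot" "((\<lambda>x. ?f x * x ^ j) \<longlongrightarrow> 0) at_top"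
      by (rule tendsto_mono[OF at_bot_le_at_infinity lim] tendsto_mono[OF at_top_le_at_infinity lim])+
    show "integrable lborel (\<lambda>x. ?f' x * x ^ j + real j * (?f x * x ^ (j - 1)))"
      by (intro Bochner_Integration.integrable_add integrable_mult_right integrable_moment)
  qed (intro continuous_intros continuous_on_schwartz)
  then show "pairing (deriv_dist (monomial_dist j)) \<phi> = pairing (real j *\<^sub>R monomial_dist (j - 1)) \<phi>"
    by (simp add: deriv_dist.rep_eq monomial_dist.rep_eq scaleR_dual.rep_eq integrable_moment)
qed

section \<open>Antiderivatives of Schwartz functions\<close>

lemma integrable_indicator_schwartz:
  assumes "A \<in> sets borel"
  shows "integrable lborel (\<lambda>y. indicator A y * schwartz_apply \<phi> y)"
  using integrable_mult_indicator[of A lborel "schwartz_apply \<phi>"] integrable_moment[of \<phi> 0] assms by simp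

text \<open>If all of \<open>A\<close> is at least as far from the origin as \<open>x\<close>, the
  weight at \<open>x\<close> may be moved under the integral and enlarged to the weight at
  \<open>y\<close>. This turns decay of a function into decay of its tail integrals.\<close>

lemma schwartz_tail_bound:
  assumes A: "A \<in> sets borel" and far: "\<And>y. y \<in> A \<Longrightarrow> \<bar>x\<bar> \<le> \<bar>y\<bar>"
  shows "(1 + \<bar>x\<bar>) ^ m * \<bar>LINT y|lborel. indicator A y * schwartz_apply \<phi> y\<bar>
    \<le> decay_mass * schwartz_seminorm (m + 2, 0) \<phi>"
proof -
  have "(1 + \<bar>x\<bar>) ^ m * \<bar>LINT y|lborel. indicator A y * schwartz_apply \<phi> y\<bar>
      = \<bar>LINT y|lborel. (1 + \<bar>x\<bar>) ^ m * (indicator A y * schwartz_apply \<phi> y)\<bar>"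
    by (simp add: abs_mult power_abs)
  also have "\<dots> \<le> (LINT y|lborel. \<bar>(1 + \<bar>x\<bar>) ^ m * (indicator A y * schwartz_apply \<phi> y)\<bar>)"
    by (rule integral_abs_bound)
  also have "\<dots> \<le> (LINT y|lborel. schwartz_seminorm (m + 2, 0) \<phi> * (1 / (1 + \<bar>y\<bar>)\<^sup>2))"
  proof (rule integral_mono)
    show "integrable lborel (\<lambda>y. \<bar>(1 + \<bar>x\<bar>) ^ m * (indicator A y * schwartz_apply \<phi> y)\<bar>)"
      by (intro integrable_abs integrable_mult_right integrable_indicator_schwartz A)
    show "integrable lborel (\<lambda>y. schwartz_seminorm (m + 2, 0) \<phi> * (1 / (1 + \<bar>y\<bar>)\<^sup>2))"
      by (intro integrable_mult_right integrable_decay)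
    fix y
    show "\<bar>(1 + \<bar>x\<bar>) ^ m * (indicator A y * schwartz_apply \<phi> y)\<bar> \<le> schwartz_seminorm (m + 2, 0) \<phi> * (1 / (1 + \<bar>y\<bar>)\<^sup>2)"
    proof (cases "y \<in> A")
      case True
      have "(1 + \<bar>x\<bar>) ^ m * \<bar>schwartz_apply \<phi> y\<bar> \<le> (1 + \<bar>y\<bar>) ^ m * \<bar>schwartz_apply \<phi> y\<bar>"
        using far[OF True] by (intro mult_right_mono power_mono) auto
      also note schwartz_decay
      finally show ?thesis using True by (simp add: abs_mult power_abs)
    qed (simp add: schwartz_seminorm_nonneg)
  qed
  finally show ?thesis by (simp only: integral_mult_right_zero decay_mass_def mult.commute)
qed

text \<open>The integral from minus infinity to \<open>x\<close> decays on the left; by mean zero it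
  is minus the integral from \<open>x\<close> to infinity and so decays on the right as well. Only
  seminorms of order 0 are estimated, since those of higher order are seminorms of
  \<open>\<phi>\<close>.\<close>

lemma schwartz_antiderivative:
  assumes mean: "pairing (monomial_dist 0) \<phi> = 0"
  shows "\<exists>\<Phi>. deriv_test \<Phi> = \<phi> \<and>
    (\<forall>m. schwartz_seminorm (m, 0) \<Phi> \<le> decay_mass * schwartz_seminorm (m + 2, 0) \<phi>)"
proof -
  let ?f = "schwartz_apply \<phi>"
  define F where "F x = (LINT y|lborel. indicator {..x} y * ?f y)" for x
  note int = integrable_indicator_schwartz[of _ \<phi>]
  have F_right: "F x = - (LINT y|lborel. indicator {x<..} y * ?f y)" for x
  proof -
    have "F x + (LINT y|lborel. indicator {x<..} y * ?f y)
        = (LINT y|lborel. indicator {..x} y * ?f y + indicator {x<..} y * ?f y)"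
      unfolding F_def by (subst Bochner_Integration.integral_add) (simp_all add: int)
    also have "\<dots> = (LINT y|lborel. ?f y * y ^ 0)"
      by (intro Bochner_Integration.integral_cong) (auto simp: indicator_def)
    also have "\<dots> = 0" using mean by (simp add: monomial_dist.rep_eq)
    finally show ?thesis by simp
  qed
  have D: "(F has_field_derivative ?f t) (at t)" for t
  proof -
    \<comment> \<open>Near \<open>t\<close> the function \<open>F\<close> differs by a constant from
      an integral over a compact interval, to which the fundamental theorem of calculus applies;
      \<open>t - 1\<close> serves as base point to the left of \<open>t\<close>.\<close>
    have *: "F x = F (t - 1) + integral {t - 1..x} ?f" if "t - 1 \<le> x" for x
    proof -
      have "F x = (LINT y|lborel. indicator {..t - 1} y * ?f y + indicator {t - 1<..x} y * ?f y)"
        unfolding F_def using that by (intro Bochner_Integration.integral_cong) (auto simp: indicator_def)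
      also have "\<dots> = F (t - 1) + (LINT y|lborel. indicator {t - 1<..x} y * ?f y)"
        unfolding F_def by (rule Bochner_Integration.integral_add[OF int int]) simp_all
      also have "(LINT y|lborel. indicator {t - 1<..x} y * ?f y) = (LINT y|lborel. indicator {t - 1..x} y * ?f y)"
      proof (rule integral_cong_AE)
        show "AE y in lborel. indicator {t - 1<..x} y * ?f y = indicator {t - 1..x} y * ?f y"
          using AE_lborel_singleton[of "t - 1"] by (rule AE_mp) (auto simp: indicator_def)
      qed measurable
      also have "\<dots> = integral {t - 1..x} ?f"
        using set_borel_integral_eq_integral(2)[of "{t - 1..x}" ?f] int[of "{t - 1..x}"]
        by (simp add: set_integrable_def set_lebesgue_integral_def)
      finally show ?thesis .
    qed
    have "((\<lambda>x. F (t - 1) + integral {t - 1..x} ?f) has_field_derivative 0 + ?f t) (at t within {t - 1..t + 1})"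
      by (intro DERIV_add DERIV_const integral_has_real_derivative continuous_on_schwartz) auto
    then have "((\<lambda>x. F (t - 1) + integral {t - 1..x} ?f) has_field_derivative ?f t) (at t)"
      by (simp add: at_within_Icc_at)
    then show ?thesis
      by (rule has_field_derivative_transform_within_open[where S = "{t - 1<..<t + 1}"])
        (simp_all add: *[symmetric])
  qed
  note F = smooth_antiderivative[OF D smooth_schwartz]
  have bound: "(1 + \<bar>x\<bar>) ^ m * \<bar>F x\<bar> \<le> decay_mass * schwartz_seminorm (m + 2, 0) \<phi>" for m x
  \<comment> \<open>The sign of \<open>x\<close> decides which of the two half-lines consists of
    points at least as far from the origin as \<open>x\<close>.\<close>
  proof (cases "x \<le> 0")
    case True
    then show ?thesis unfolding F_def by (intro schwartz_tail_bound) auto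
  next
    case False
    then show ?thesis unfolding F_right abs_minus_cancel by (intro schwartz_tail_bound) auto
  qed
  have "bounded (range (\<lambda>x. (1 + \<bar>x\<bar>) ^ m * (deriv ^^ n) F x))" for m n
  proof (cases n)
    case 0
    then show ?thesis unfolding bounded_range_iff using bound[where m = m] by (auto simp: abs_mult power_abs)
  next
    case (Suc k)
    then show ?thesis using bounded_schwartz[of m k \<phi>] by (simp only: F(2))
  qed
  then have rep: "schwartz_apply (Abs_schwartz F) = F"
    using F(1) by (simp add: Abs_schwartz_inverse)
  have "deriv_test (Abs_schwartz F) = \<phi>"
    by (rule schwartz_eqI) (simp add: deriv_test_schwartz_def schwartz_deriv.rep_eq rep F(3))
  moreover have "schwartz_seminorm (m, 0) (Abs_schwartz F) \<le> decay_mass * schwartz_seminorm (m + 2, 0) \<phi>" for m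
    by (rule schwartz_seminorm_least) (simp only: rep funpow_0 bound)
  ultimately show ?thesis by blast
qed

lemma deriv_test_schwartz_eq_0D:
  assumes "deriv_test \<Phi> = (0 :: schwartz)"
  shows "\<Phi> = 0"
proof (rule schwartz_eqI)
  fix x
  let ?F = "schwartz_apply \<Phi>"
  have "(?F has_field_derivative schwartz_apply (deriv_test \<Phi>) t) (at t)" for t
    using smooth_has_derivative[OF smooth_schwartz, of 0 \<Phi> t]
    by (simp add: deriv_test_schwartz_def schwartz_deriv.rep_eq)
  then have "(?F has_field_derivative 0) (at t)" for t
    by (simp add: assms zero_schwartz.rep_eq)
  then have "?F = (\<lambda>_. ?F x)" using DERIV_isconst_all[of ?F] by blast
  then have "((\<lambda>_ :: real. ?F x) \<longlongrightarrow> 0) at_infinity" using schwartz_tendsto_0[of \<Phi>] by metis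
  then show "?F x = schwartz_apply 0 x"
    by (simp add: tendsto_const_iff[OF trivial_limit_at_infinity] zero_schwartz.rep_eq)
qed

section \<open>Primitives of generalized functions on the line and the kernel of powers of the
  derivative\<close>

lemma pairing_compose:
  fixes A :: "'a::{real_vector, topological_space} \<Rightarrow> 'a"
  assumes "linear A" and "\<And>V. open V \<Longrightarrow> open (A -` V)"
  shows "\<exists>u. \<forall>\<phi>. pairing u \<phi> = pairing v (A \<phi>)"
proof -
  have "linear (\<lambda>\<phi>. pairing v (A \<phi>))"
    using linear_compose[OF assms(1) linear_pairing[of v]] by (simp add: o_def)
  moreover have "continuous_on UNIV A"
    using assms(2) by (simp add: continuous_on_open_vimage)
  then have "continuous_on UNIV (\<lambda>\<phi>. pairing v (A \<phi>))"
    by (rule continuous_on_compose2[OF continuous_on_pairing[of v]]) simp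
  ultimately have "pairing (Abs_dual (\<lambda>\<phi>. pairing v (A \<phi>))) \<phi> = pairing v (A \<phi>)" for \<phi>
    by (simp add: Abs_dual_inverse)
  then show ?thesis by blast
qed

lemma linear_deriv_test: "linear (deriv_test :: 'a::test_space \<Rightarrow> 'a)"
  by (intro linearI deriv_test_add deriv_test_scaleR)

lemma linear_deriv_dist: "linear (deriv_dist :: 'a::test_space dual \<Rightarrow> 'a dual)"
  by (rule linearI; rule dual_eqI)
    (simp_all add: deriv_dist.rep_eq plus_dual.rep_eq scaleR_dual.rep_eq)

lemma linear_deriv_dist_power: "linear ((deriv_dist :: 'a::test_space dual \<Rightarrow> 'a dual) ^^ N)"
proof (induction N)
  case 0
  then show ?case using linear_id by (simp add: id_def)
next
  case (Suc N)
  then show ?case using linear_compose[OF Suc linear_deriv_dist] by (simp add: o_def)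
qed

lemma schwartz_seminorm_diff_scaleR:
  "schwartz_seminorm i (f - c *\<^sub>R g) \<le> schwartz_seminorm i f + \<bar>c\<bar> * schwartz_seminorm i g"
proof -
  obtain m n where i: "i = (m, n)" by (cases i)
  show ?thesis unfolding i
  proof (rule schwartz_seminorm_least)
    fix x :: real
    let ?w = "(1 + \<bar>x\<bar>) ^ m" and ?f = "(deriv ^^ n) (schwartz_apply f) x" and ?g = "(deriv ^^ n) (schwartz_apply g) x"
    have "?w * \<bar>?f - c * ?g\<bar> \<le> ?w * (\<bar>?f\<bar> + \<bar>c\<bar> * \<bar>?g\<bar>)"
      by (intro mult_left_mono order.trans[OF abs_triangle_ineq4]) (auto simp: abs_mult)
    also have "\<dots> = ?w * \<bar>?f\<bar> + \<bar>c\<bar> * (?w * \<bar>?g\<bar>)" by (simp only: distrib_left mult_ac)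
    also have "\<dots> \<le> schwartz_seminorm (m, n) f + \<bar>c\<bar> * schwartz_seminorm (m, n) g"
      by (intro add_mono mult_left_mono schwartz_seminorm_upper) auto
    finally show "?w * \<bar>(deriv ^^ n) (schwartz_apply (f - c *\<^sub>R g)) x\<bar>
        \<le> schwartz_seminorm (m, n) f + \<bar>c\<bar> * schwartz_seminorm (m, n) g"
      by (simp only: higher_deriv_schwartz)
  qed
qed

text \<open>Subtracting the mean times \<open>\<theta>\<close> leaves a function of mean zero. Its
  antiderivative is unique, as no nonzero constant is a Schwartz function, and uniqueness forces the
  chosen \<open>A\<close> to be linear. Continuity needs two seminorms at once, since
  \<open>(2, 0)\<close> controls the subtracted mean.\<close>

lemma schwartz_antiderivative_operator:
  assumes \<theta>: "pairing (monomial_dist 0) \<theta> = 1"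
  shows "\<exists>A. linear A \<and> (\<forall>V. open V \<longrightarrow> open (A -` V)) \<and>
    (\<forall>\<phi>. deriv_test (A \<phi>) = \<phi> - pairing (monomial_dist 0) \<phi> *\<^sub>R \<theta>)"
proof -
  let ?M = "pairing (monomial_dist 0)" and ?p = schwartz_seminorm
  define P where "P \<phi> = \<phi> - ?M \<phi> *\<^sub>R \<theta>" for \<phi>
  have "?M (P \<phi>) = 0" for \<phi>
    by (simp add: P_def \<theta> linear_diff[OF linear_pairing] linear_scale[OF linear_pairing])
  from schwartz_antiderivative[OF this] obtain A where
    A: "\<And>\<phi>. deriv_test (A \<phi>) = P \<phi>" and
    A0: "\<And>\<phi> m. ?p (m, 0) (A \<phi>) \<le> decay_mass * ?p (m + 2, 0) (P \<phi>)"
    by metis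
  have eqI: "f = g" if "deriv_test f = deriv_test g" for f g :: schwartz
    using deriv_test_schwartz_eq_0D[of "f - g"] that by (simp add: linear_diff[OF linear_deriv_test])
  have "linear A"
    by (rule linearI; rule eqI)
      (simp_all add: A deriv_test_add deriv_test_scaleR P_def linear_add[OF linear_pairing]
        linear_scale[OF linear_pairing] algebra_simps)
  have P_bound: "?p i (P \<phi>) \<le> (1 + decay_mass * ?p i \<theta>) * (\<Sum>k\<in>{i, (2, 0)}. ?p k \<phi>)" for i \<phi>
  proof -
    let ?S = "\<Sum>k\<in>{i, (2, 0)}. ?p k \<phi>"
    have le: "?p k \<phi> \<le> ?S" if "k \<in> {i, (2, 0)}" for k
      using that by (intro member_le_sum) (auto simp: schwartz_seminorm_nonneg)
    have "\<bar>?M \<phi>\<bar> \<le> decay_mass * ?p (2, 0) \<phi>"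
      using moment_bound[of \<phi> 0] by (simp only: monomial_dist.rep_eq add_0)
    also have "\<dots> \<le> decay_mass * ?S" by (intro mult_left_mono le decay_mass_nonneg) simp
    finally have M: "\<bar>?M \<phi>\<bar> \<le> decay_mass * ?S" .
    have "?p i (P \<phi>) \<le> ?p i \<phi> + \<bar>?M \<phi>\<bar> * ?p i \<theta>"
      unfolding P_def by (rule schwartz_seminorm_diff_scaleR)
    also have "\<dots> \<le> ?S + decay_mass * ?S * ?p i \<theta>"
      by (intro add_mono mult_right_mono le M schwartz_seminorm_nonneg) simp
    finally show ?thesis by (simp only: distrib_right mult_1_left mult_ac)
  qed
  \<comment> \<open>The seminorm of \<open>P \<phi>\<close> that controls seminorm \<open>i\<close>
    of its antiderivative: the order drops by one, whereas at order 0 two more powers of the weight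
    are paid. The factor \<open>1 + decay_mass\<close> below covers both cases.\<close>
  define pre where "pre i = (case i of (m, n) \<Rightarrow> if n = 0 then (m + 2, 0) else (m, n - 1))" for i :: "nat \<times> nat"
  have A_bound: "?p i (A \<phi>) \<le> (1 + decay_mass) * ?p (pre i) (P \<phi>)" for i \<phi>
  proof -
    obtain m n where i: "i = (m, n)" by (cases i)
    have nn: "0 \<le> ?p (pre i) (P \<phi>)" "0 \<le> decay_mass * ?p (pre i) (P \<phi>)"
      using decay_mass_nonneg by (simp_all add: schwartz_seminorm_nonneg)
    show ?thesis
    proof (cases n)
      case 0
      then show ?thesis using A0[of m \<phi>] nn by (simp add: i pre_def distrib_right)
    next
      case (Suc k)
      have "?p i (A \<phi>) = ?p (m, k) (deriv_test (A \<phi>))"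
        using deriv_schwartz_bound[of m k "A \<phi>"] by (simp add: i Suc deriv_test_schwartz_def)
      also have "\<dots> = ?p (pre i) (P \<phi>)" by (simp add: A i Suc pre_def)
      finally show ?thesis using nn by (simp add: distrib_right)
    qed
  qed
  have "?p i (A \<phi>) \<le> ((1 + decay_mass) * (1 + decay_mass * ?p (pre i) \<theta>)) * (\<Sum>k\<in>{pre i, (2, 0)}. ?p k \<phi>)" for i \<phi>
  proof -
    have "?p i (A \<phi>) \<le> (1 + decay_mass) * ?p (pre i) (P \<phi>)" by (rule A_bound)
    also have "\<dots> \<le> (1 + decay_mass) * ((1 + decay_mass * ?p (pre i) \<theta>) * (\<Sum>k\<in>{pre i, (2, 0)}. ?p k \<phi>))"
      using decay_mass_nonneg by (intro mult_left_mono P_bound) auto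
    finally show ?thesis by (simp only: mult.assoc)
  qed
  then have "open (A -` V)" if "open V" for V
    using that unfolding open_schwartz_def
    by (elim seminorm_open_vimage_sum[OF \<open>linear A\<close>, rotated 3])
      (simp_all add: decay_mass_nonneg schwartz_seminorm_nonneg)
  then show ?thesis using \<open>linear A\<close> A unfolding P_def by blast
qed

text \<open>Derivatives have mean zero and \<open>deriv_test\<close> is injective, so
  \<open>A\<close> undoes \<open>deriv_test\<close>; the transpose of \<open>- A\<close> is
  therefore a right inverse of \<open>deriv_dist\<close>.\<close>

lemma deriv_dist_surj_schwartz:
  fixes v :: "schwartz dual"
  assumes \<theta>: "pairing (monomial_dist 0) \<theta> = 1"
  shows "\<exists>u. deriv_dist u = v"
proof -
  obtain A where A: "linear A" "\<And>V. open V \<Longrightarrow> open (A -` V)"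
    "\<And>\<phi>. deriv_test (A \<phi>) = \<phi> - pairing (monomial_dist 0) \<phi> *\<^sub>R \<theta>"
    using schwartz_antiderivative_operator[OF \<theta>] by blast
  obtain u where u: "\<And>\<phi>. pairing u \<phi> = pairing v (A \<phi>)" using pairing_compose[OF A(1,2)] by blast
  have "A (deriv_test \<phi>) = \<phi>" for \<phi>
  proof -
    have "pairing (monomial_dist 0) (deriv_test \<phi>) = - pairing (deriv_dist (monomial_dist 0)) \<phi>"
      by (simp add: deriv_dist.rep_eq)
    also have "\<dots> = 0" by (simp add: deriv_monomial_dist zero_dual.rep_eq)
    finally have "deriv_test (A (deriv_test \<phi>) - \<phi>) = 0"
      by (simp add: linear_diff[OF linear_deriv_test] A(3))
    then show ?thesis using deriv_test_schwartz_eq_0D by fastforce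
  qed
  then have "deriv_dist (- u) = v"
    by (intro dual_eqI) (simp add: deriv_dist.rep_eq uminus_dual.rep_eq u)
  then show ?thesis ..
qed

lemma deriv_dist_power_surj_schwartz:
  fixes v :: "schwartz dual"
  assumes "pairing (monomial_dist 0) \<theta> = 1"
  shows "\<exists>u. (deriv_dist ^^ N) u = v"
proof (induction N arbitrary: v)
  case (Suc N)
  then show ?case using deriv_dist_surj_schwartz[OF assms, of v] by (metis funpow.simps(2) o_apply)
qed simp

text \<open>Testing \<open>deriv_dist u = 0\<close> against \<open>A \<phi>\<close> leaves exactly
  the multiple of \<open>\<theta>\<close> that \<open>A\<close> had to subtract.\<close>

lemma deriv_dist_eq_0_schwartz:
  fixes u :: "schwartz dual"
  assumes \<theta>: "pairing (monomial_dist 0) \<theta> = 1" and u: "deriv_dist u = 0"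
  shows "u = pairing u \<theta> *\<^sub>R monomial_dist 0"
proof (rule dual_eqI)
  fix \<phi>
  obtain A where A: "\<And>\<phi>. deriv_test (A \<phi>) = \<phi> - pairing (monomial_dist 0) \<phi> *\<^sub>R \<theta>"
    using schwartz_antiderivative_operator[OF \<theta>] by blast
  have "pairing (deriv_dist u) (A \<phi>) = 0" by (simp add: u zero_dual.rep_eq)
  then show "pairing u \<phi> = pairing (pairing u \<theta> *\<^sub>R monomial_dist 0) \<phi>"
    by (simp add: deriv_dist.rep_eq A linear_diff[OF linear_pairing] linear_scale[OF linear_pairing] scaleR_dual.rep_eq
        mult.commute)
qed

lemma deriv_dist_power_monomial_dist: "j < N \<Longrightarrow> (deriv_dist ^^ N) (monomial_dist j) = 0"
proof (induction N arbitrary: j)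
  case (Suc N)
  have "(deriv_dist ^^ Suc N) (monomial_dist j) = real j *\<^sub>R (deriv_dist ^^ N) (monomial_dist (j - 1))"
    by (simp add: funpow_Suc_right deriv_monomial_dist linear_scale[OF linear_deriv_dist_power] del: funpow.simps)
  then show ?case using Suc by (cases j) auto
qed simp

text \<open>By induction \<open>deriv_dist u\<close> is a polynomial; subtracting its formal
  primitive from \<open>u\<close> leaves something with derivative 0, which is the new constant
  term.\<close>

lemma deriv_dist_power_eq_0_schwartz:
  assumes \<theta>: "pairing (monomial_dist 0) \<theta> = 1" and "(deriv_dist ^^ N) u = 0"
  shows "\<exists>c. u = (\<Sum>j<N. c j *\<^sub>R monomial_dist j)"
  using assms(2)
proof (induction N arbitrary: u)
  case (Suc N)
  then have "(deriv_dist ^^ N) (deriv_dist u) = 0" by (simp add: funpow_Suc_right del: funpow.simps)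
  then obtain c where c: "deriv_dist u = (\<Sum>j<N. c j *\<^sub>R monomial_dist j)" using Suc.IH by blast
  define v where "v = u - (\<Sum>j<N. (c j / real (Suc j)) *\<^sub>R monomial_dist (Suc j))"
  have "deriv_dist v = 0"
    unfolding v_def linear_diff[OF linear_deriv_dist] linear_sum[OF linear_deriv_dist]
    by (simp add: c linear_scale[OF linear_deriv_dist] deriv_monomial_dist del: of_nat_Suc)
  then have "v = pairing v \<theta> *\<^sub>R monomial_dist 0" by (rule deriv_dist_eq_0_schwartz[OF \<theta>])
  then have "u = pairing v \<theta> *\<^sub>R monomial_dist 0 + (\<Sum>j<N. (c j / real (Suc j)) *\<^sub>R monomial_dist (Suc j))"
    by (simp add: v_def algebra_simps)
  then show ?case
    by (intro exI[of _ "\<lambda>j. case j of 0 \<Rightarrow> pairing v \<theta> | Suc k \<Rightarrow> c k / real (Suc k)"])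
      (simp only: sum.lessThan_Suc_shift nat.case)
qed simp


section \<open>Antiderivatives on the circle\<close>

lemma continuous_on_periodic: "continuous_on S (periodic_apply \<phi>)"
  using higher_deriv_continuous[OF smooth_periodic, of S 0 \<phi>] by simp

lemma periodic_has_derivative:
  "(periodic_apply \<phi> has_field_derivative periodic_apply (deriv_test \<phi>) x) (at x)"
  using smooth_has_derivative[OF smooth_periodic, of 0 \<phi> x]
  by (simp add: deriv_test_periodic_def periodic_deriv.rep_eq)

lemma integrable_periodic: "periodic_apply \<phi> integrable_on {0..1}"
  by (intro integrable_continuous_real continuous_on_periodic)

lemma periodic_seminorm_0: "\<bar>periodic_apply \<phi> x\<bar> \<le> periodic_seminorm 0 \<phi>"
  using periodic_seminorm_upper[of 0 \<phi> x] by simp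

lemma abs_integral_periodic_le: "\<bar>integral {0..1} (periodic_apply \<phi>)\<bar> \<le> periodic_seminorm 0 \<phi>"
  using integral_bound[of 0 1 "periodic_apply \<phi>" "periodic_seminorm 0 \<phi>"]
  by (simp add: continuous_on_periodic periodic_seminorm_0)

text \<open>The constant 1 as a generalized function. It reads off the mean of a test function, and
  it is the element of mean 1 that corrects solutions on the circle.\<close>

lift_definition constant_dist :: "periodic dual" is "\<lambda>\<phi>. integral {0..1} (periodic_apply \<phi>)"
proof -
  let ?M = "\<lambda>\<phi>. integral {0..1} (periodic_apply \<phi>)"
  have lin: "linear ?M"
    by (rule linearI)
      (simp_all add: plus_periodic.rep_eq scaleR_periodic.rep_eq integrable_periodic Henstock_Kurzweil_Integration.integral_add)
  have "\<bar>?M \<phi>\<bar> \<le> 1 * periodic_seminorm 0 \<phi>" for \<phi> using abs_integral_periodic_le[of \<phi>] by simp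
  then have "open V \<Longrightarrow> open (?M -` V)" for V
    unfolding open_periodic_def by (intro seminorm_open_vimage_real[where p = periodic_seminorm and i = 0, OF lin _ zero_le_one])
  then show "linear ?M \<and> continuous_on UNIV ?M"
    using lin by (simp add: continuous_on_open_vimage)
qed

lemma mean_constant_dist: "mean_T constant_dist = 1"
  by (simp add: mean_T_def constant_dist.rep_eq one_periodic.rep_eq)

lemma deriv_constant_dist: "deriv_dist constant_dist = 0"
proof (rule dual_eqI)
  fix \<phi>
  have "(periodic_apply (deriv_test \<phi>) has_integral periodic_apply \<phi> 1 - periodic_apply \<phi> 0) {0..1}"
    by (intro fundamental_theorem_of_calculus)
      (auto intro!: has_field_derivative_at_within periodic_has_derivative
        simp flip: has_real_derivative_iff_has_vector_derivative)
  then show "pairing (deriv_dist constant_dist) \<phi> = pairing 0 \<phi>"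
    using periodic_apply_plus_1[of \<phi> 0]
    by (simp add: deriv_dist.rep_eq constant_dist.rep_eq zero_dual.rep_eq integral_unique)
qed

lemma deriv_test_periodic_eq_0D:
  assumes "deriv_test \<Phi> = (0 :: periodic)"
  shows "\<Phi> = periodic_apply \<Phi> 0 *\<^sub>R 1"
proof (rule periodic_eqI)
  fix x
  have "(periodic_apply \<Phi> has_field_derivative 0) (at t)" for t
    using periodic_has_derivative[of \<Phi> t] by (simp add: assms zero_periodic.rep_eq)
  then show "periodic_apply \<Phi> x = periodic_apply (periodic_apply \<Phi> 0 *\<^sub>R 1) x"
    using DERIV_isconst_all[of "periodic_apply \<Phi>" x 0] by (simp add: scaleR_periodic.rep_eq one_periodic.rep_eq)
qed

lemma mean_deriv_dist: "mean_T (deriv_dist u) = 0"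
proof -
  have "deriv_test (1 :: periodic) = 0"
    by (rule periodic_eqI)
      (simp add: deriv_test_periodic_def periodic_deriv.rep_eq one_periodic.rep_eq zero_periodic.rep_eq)
  then show ?thesis by (simp add: mean_T_def deriv_dist.rep_eq linear_0[OF linear_pairing])
qed

text \<open>For a primitive \<open>F\<close>, the difference \<open>F (x + 1) - F x\<close> is
  constant and equals the integral over one period, which vanishes. The value 0 at the origin
  singles out one primitive.\<close>

lemma periodic_antiderivative:
  assumes mean: "pairing constant_dist \<phi> = 0"
  shows "\<exists>\<Phi>. deriv_test \<Phi> = \<phi> \<and> periodic_apply \<Phi> 0 = 0"
proof -
  let ?f = "periodic_apply \<phi>"
  have "isCont ?f x" for x using continuous_on_periodic[of UNIV \<phi>] by (simp add: continuous_on_eq_continuous_at)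
  then obtain G where G: "\<And>x. (G has_field_derivative ?f x) (at x)"
    using einterval_antiderivative[of "-\<infinity>" \<infinity> ?f] by (auto simp: has_real_derivative_iff_has_vector_derivative)
  define F where "F x = G x - G 0" for x
  have D: "(F has_field_derivative ?f x) (at x)" for x
    unfolding F_def by (rule DERIV_cong[OF DERIV_diff[OF G DERIV_const]]) simp
  have "(?f has_integral F 1 - F 0) {0..1}"
    by (intro fundamental_theorem_of_calculus)
      (auto intro!: has_field_derivative_at_within D simp flip: has_real_derivative_iff_has_vector_derivative)
  then have F1: "F 1 = F 0" using mean by (simp add: constant_dist.rep_eq integral_unique)
  have "((\<lambda>x. F (x + 1) - F x) has_field_derivative 0) (at x)" for x
  proof -
    have "((\<lambda>x. F (x + 1)) has_field_derivative ?f (x + 1)) (at x)"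
      using D[of "x + 1"] by (simp add: DERIV_shift)
    from DERIV_diff[OF this D] show ?thesis by (simp add: periodic_apply_plus_1)
  qed
  then have "F (x + 1) - F x = F (0 + 1) - F 0" for x
    using DERIV_isconst_all[of "\<lambda>x. F (x + 1) - F x" x 0] by blast
  then have per: "F (x + 1) = F x" for x using F1 by simp
  note F = smooth_antiderivative[OF D smooth_periodic]
  have rep: "periodic_apply (Abs_periodic F) = F"
    using F(1) per by (simp add: Abs_periodic_inverse)
  have "deriv_test (Abs_periodic F) = \<phi>"
    by (rule periodic_eqI) (simp add: deriv_test_periodic_def periodic_deriv.rep_eq rep F(3))
  moreover have "periodic_apply (Abs_periodic F) 0 = 0" by (simp add: rep F_def)
  ultimately show ?thesis by blast
qed

text \<open>Starting from 0 at the origin, the function cannot exceed the supremum of its derivative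
  on one period, hence nowhere. The truncated difference \<open>0 - 1 = 0\<close> makes the index
  right for \<open>n = 0\<close>.\<close>

lemma periodic_seminorm_antiderivative:
  assumes "periodic_apply \<Phi> 0 = 0"
  shows "periodic_seminorm n \<Phi> \<le> periodic_seminorm (n - 1) (deriv_test \<Phi>)"
proof (cases n)
  case 0
  have *: "\<bar>periodic_apply \<Phi> x\<bar> \<le> periodic_seminorm 0 (deriv_test \<Phi>)" if "x \<in> {0..1}" for x
  proof -
    have "\<bar>periodic_apply \<Phi> x - periodic_apply \<Phi> 0\<bar> \<le> periodic_seminorm 0 (deriv_test \<Phi>) * \<bar>x - 0\<bar>"
      using field_differentiable_bound[of UNIV "periodic_apply \<Phi>" "periodic_apply (deriv_test \<Phi>)" "periodic_seminorm 0 (deriv_test \<Phi>)" x 0]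
      by (simp add: periodic_has_derivative periodic_seminorm_0)
    also have "\<dots> \<le> periodic_seminorm 0 (deriv_test \<Phi>) * 1"
      using that by (intro mult_left_mono periodic_seminorm_nonneg) auto
    finally show ?thesis using assms by simp
  qed
  have "\<bar>periodic_apply \<Phi> x\<bar> \<le> periodic_seminorm 0 (deriv_test \<Phi>)" for x
  proof -
    have "periodic_apply \<Phi> x \<in> periodic_apply \<Phi> ` {0..1}"
      using rangeI[of "periodic_apply \<Phi>" x] unfolding periodic_range[of "periodic_apply \<Phi>", OF periodic_apply_plus_1] .
    then show ?thesis using * by force
  qed
  then have "periodic_seminorm 0 \<Phi> \<le> periodic_seminorm 0 (deriv_test \<Phi>)"
    by (intro periodic_seminorm_least) (simp only: funpow_0)
  then show ?thesis by (simp only: 0 diff_0_eq_0)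
next
  case (Suc k)
  then show ?thesis using deriv_periodic_bound[of k \<Phi>] by (simp add: deriv_test_periodic_def)
qed

text \<open>The normalization at the origin takes the place of decay at infinity: it makes the
  antiderivative unique and thus the choice linear.\<close>

lemma periodic_antiderivative_operator:
  "\<exists>A. linear A \<and> (\<forall>V. open V \<longrightarrow> open (A -` V)) \<and>
    (\<forall>\<phi>. deriv_test (A \<phi>) = \<phi> - pairing constant_dist \<phi> *\<^sub>R 1) \<and> (\<forall>\<phi>. periodic_apply (A \<phi>) 0 = 0)"
proof -
  let ?M = "pairing constant_dist" and ?p = periodic_seminorm
  define P where "P \<phi> = \<phi> - ?M \<phi> *\<^sub>R 1" for \<phi>
  have "?M (P \<phi>) = 0" for \<phi>
    using mean_constant_dist by (simp add: P_def mean_T_def linear_diff[OF linear_pairing] linear_scale[OF linear_pairing])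
  from periodic_antiderivative[OF this] obtain A where
    A: "\<And>\<phi>. deriv_test (A \<phi>) = P \<phi>" and A0: "\<And>\<phi>. periodic_apply (A \<phi>) 0 = 0"
    by metis
  have eqI: "f = g" if "deriv_test f = deriv_test g" "periodic_apply f 0 = periodic_apply g 0" for f g :: periodic
    using deriv_test_periodic_eq_0D[of "f - g"] that higher_deriv_periodic_ops(3)[of 0 f g 0]
    by (simp add: linear_diff[OF linear_deriv_test])
  have "linear A"
    by (rule linearI; rule eqI)
      (simp_all add: A A0 deriv_test_add deriv_test_scaleR P_def linear_add[OF linear_pairing]
        linear_scale[OF linear_pairing] algebra_simps plus_periodic.rep_eq scaleR_periodic.rep_eq)
  have P_bound: "?p n (P \<phi>) \<le> (1 + ?p n 1) * (\<Sum>k\<in>{n, 0}. ?p k \<phi>)" for n \<phi>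
  proof -
    let ?S = "\<Sum>k\<in>{n, 0}. ?p k \<phi>"
    have le: "?p k \<phi> \<le> ?S" if "k \<in> {n, 0}" for k
      using that by (intro member_le_sum) (auto simp: periodic_seminorm_nonneg)
    have M: "\<bar>?M \<phi>\<bar> \<le> ?S"
      unfolding constant_dist.rep_eq by (rule order.trans[OF abs_integral_periodic_le le]) simp
    have "\<bar>(deriv ^^ n) (periodic_apply (P \<phi>)) x\<bar> \<le> ?S + ?S * ?p n 1" for x
    proof -
      have "\<bar>(deriv ^^ n) (periodic_apply (P \<phi>)) x\<bar>
          \<le> \<bar>(deriv ^^ n) (periodic_apply \<phi>) x\<bar> + \<bar>?M \<phi>\<bar> * \<bar>(deriv ^^ n) (periodic_apply 1) x\<bar>"
        unfolding P_def higher_deriv_periodic_ops abs_mult[symmetric] by (rule abs_triangle_ineq4)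
      also have "\<dots> \<le> ?p n \<phi> + ?S * ?p n 1"
        by (intro add_mono mult_mono M periodic_seminorm_upper order.trans[OF abs_ge_zero M]) simp
      also have "\<dots> \<le> ?S + ?S * ?p n 1" by (intro add_mono le) auto
      finally show ?thesis .
    qed
    then have "?p n (P \<phi>) \<le> ?S + ?S * ?p n 1" by (rule periodic_seminorm_least)
    then show ?thesis by (simp only: distrib_right mult_1_left mult.commute)
  qed
  have "?p n (A \<phi>) \<le> (1 + ?p (n - 1) 1) * (\<Sum>k\<in>{n - 1, 0}. ?p k \<phi>)" for n \<phi>
    using order.trans[OF periodic_seminorm_antiderivative[OF A0, of n \<phi>, unfolded A] P_bound] .
  then have "open (A -` V)" if "open V" for V
    using that unfolding open_periodic_def
    by (elim seminorm_open_vimage_sum[OF \<open>linear A\<close>, rotated 3]) (simp_all add: periodic_seminorm_nonneg)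
  then show ?thesis using \<open>linear A\<close> A A0 unfolding P_def by blast
qed

text \<open>\<open>A (deriv_test \<phi>)\<close> agrees with \<open>\<phi>\<close> only up to a
  constant, and \<open>v\<close> annihilates constants. For the same reason the solution has mean
  zero: \<open>A 1\<close> has derivative 0.\<close>

lemma deriv_dist_surj_periodic:
  assumes "mean_T v = 0"
  shows "\<exists>u. deriv_dist u = v \<and> mean_T u = 0"
proof -
  obtain A where A: "linear A" "\<And>V. open V \<Longrightarrow> open (A -` V)"
    "\<And>\<phi>. deriv_test (A \<phi>) = \<phi> - pairing constant_dist \<phi> *\<^sub>R 1" "\<And>\<phi>. periodic_apply (A \<phi>) 0 = 0"
    using periodic_antiderivative_operator by blast
  obtain u where u: "\<And>\<phi>. pairing u \<phi> = pairing v (A \<phi>)" using pairing_compose[OF A(1,2)] by blast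
  have v: "pairing v \<Phi> = 0" if "deriv_test \<Phi> = 0" for \<Phi>
  proof -
    have "pairing v \<Phi> = pairing v (periodic_apply \<Phi> 0 *\<^sub>R 1)" using deriv_test_periodic_eq_0D[OF that] by simp
    also have "\<dots> = 0" using assms by (simp add: linear_scale[OF linear_pairing] mean_T_def)
    finally show ?thesis .
  qed
  have "pairing v (A (deriv_test \<phi>)) = pairing v \<phi>" for \<phi>
  proof -
    have "pairing constant_dist (deriv_test \<phi>) = - pairing (deriv_dist constant_dist) \<phi>"
      by (simp add: deriv_dist.rep_eq)
    also have "\<dots> = 0" by (simp add: deriv_constant_dist zero_dual.rep_eq)
    finally have "deriv_test (A (deriv_test \<phi>) - \<phi>) = 0"
      by (simp add: linear_diff[OF linear_deriv_test] A(3))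
    from v[OF this] show ?thesis by (simp add: linear_diff[OF linear_pairing])
  qed
  then have "deriv_dist (- u) = v"
    by (intro dual_eqI) (simp add: deriv_dist.rep_eq uminus_dual.rep_eq u)
  moreover have "deriv_test (A 1) = 0"
    using mean_constant_dist by (simp add: A(3) mean_T_def)
  then have "mean_T (- u) = 0" by (simp add: mean_T_def uminus_dual.rep_eq u v)
  ultimately show ?thesis by blast
qed

lemma deriv_dist_power_surj_periodic:
  assumes "mean_T v = 0"
  shows "\<exists>u. (deriv_dist ^^ N) u = v \<and> mean_T u = 0"
  using assms
proof (induction N arbitrary: v)
  case (Suc N)
  then obtain w where "deriv_dist w = v" "mean_T w = 0" using deriv_dist_surj_periodic by blast
  then show ?case using Suc.IH[of w] by auto
qed simp

lemma deriv_dist_eq_0_periodic: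
  assumes "deriv_dist u = 0" "mean_T u = 0"
  shows "u = 0"
proof (rule dual_eqI)
  fix \<phi>
  obtain A where A: "\<And>\<phi>. deriv_test (A \<phi>) = \<phi> - pairing constant_dist \<phi> *\<^sub>R 1"
    using periodic_antiderivative_operator by blast
  have "pairing (deriv_dist u) (A \<phi>) = 0" by (simp add: assms zero_dual.rep_eq)
  then show "pairing u \<phi> = pairing 0 \<phi>"
    using assms(2) by (simp add: mean_T_def deriv_dist.rep_eq A linear_diff[OF linear_pairing] linear_scale[OF linear_pairing] zero_dual.rep_eq)
qed

lemma deriv_dist_power_eq_0_periodic:
  assumes "(deriv_dist ^^ N) u = 0" "mean_T u = 0"
  shows "u = 0"
  using assms
proof (induction N)
  case (Suc N)
  \<comment> \<open>For \<open>N = 0\<close> this is the assumption on \<open>u\<close>; otherwise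
    the element is itself a derivative.\<close>
  have "mean_T ((deriv_dist ^^ N) u) = 0" using Suc.prems(2) by (cases N) (simp_all add: mean_deriv_dist)
  moreover have "deriv_dist ((deriv_dist ^^ N) u) = 0" using Suc.prems(1) by simp
  ultimately have "(deriv_dist ^^ N) u = 0" by (rule deriv_dist_eq_0_periodic[rotated])
  then show ?case using Suc.prems(2) by (rule Suc.IH)
qed simp


section \<open>Native spaces\<close>

lemma tendsto_dist_of_radon_T:
  assumes "\<nu> \<longlonglongrightarrow> \<mu>"
  shows "(\<lambda>k. dist_of_radon_T (\<nu> k)) \<longlonglongrightarrow> dist_of_radon_T \<mu>"
  unfolding tendsto_dual_iff dist_of_radon_T.rep_eq
  by (intro allI blinfun.tendsto assms tendsto_const)

text \<open>Both orders of the factors are needed: with the derivatives outermost,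
  \<open>L h = v\<close> is solved by a primitive followed by inverting \<open>L\<^sub>i\<close>;
  with the derivatives innermost, the kernel of \<open>L\<close> is that of
  \<open>deriv_dist ^^ N\<close>.\<close>

lemma admissibleE:
  fixes L :: "'a::test_space dual \<Rightarrow> 'a dual"
  assumes L: "admissible N L"
    and quot: "\<And>(u :: 'a dual) \<phi>. (\<lambda>k. real (Suc k) * (pairing u (shift_test (inverse (real (Suc k))) \<phi>) - pairing u \<phi>))
      \<longlonglongrightarrow> pairing u (deriv_test \<phi>)"
  obtains L\<^sub>i where "linear L" "linear L\<^sub>i" "bij L\<^sub>i" "continuous_on UNIV (inv L\<^sub>i)"
    "\<And>u. L u = (deriv_dist ^^ N) (L\<^sub>i u)" "\<And>u. L u = L\<^sub>i ((deriv_dist ^^ N) u)"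
proof -
  obtain L\<^sub>i where Li: "lsi_continuous L\<^sub>i" "bij L\<^sub>i" "lsi_continuous (inv L\<^sub>i)" "L = (deriv_dist ^^ N) \<circ> L\<^sub>i"
    using L unfolding admissible_def by blast
  have "(deriv_dist ^^ n) (L\<^sub>i u) = L\<^sub>i ((deriv_dist ^^ n) u)" for n u
    by (induction n) (simp_all add: lsi_continuous_deriv_dist[OF Li(1) quot])
  then show thesis
    using L Li by (intro that[of L\<^sub>i]) (auto simp: admissible_def lsi_continuous_def lsi_def)
qed

lemma banach_on_native_R:
  assumes L: "admissible N L"
    and \<theta>: "\<And>n m. n \<in> {1..N} \<Longrightarrow> m \<in> {1..N} \<Longrightarrow>
      (LINT t|lborel. schwartz_apply (\<theta> n) t * t ^ (m - 1)) = (if n = m then 1 else 0)"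
  shows "banach_on (native_R L) (native_R_norm N \<theta> L)"
proof -
  obtain L\<^sub>i where lin: "linear L" "linear L\<^sub>i" and bij: "bij L\<^sub>i"
    and L1: "\<And>u. L u = (deriv_dist ^^ N) (L\<^sub>i u)" and L2: "\<And>u. L u = L\<^sub>i ((deriv_dist ^^ N) u)"
    using L difference_quotient_schwartz by (rule admissibleE) blast
  \<comment> \<open>For \<open>N = 0\<close> the index set is empty and \<open>s\<close> is 0, so
    both cases of \<open>native_R_norm\<close> become one formula.\<close>
  define s where "s f = L2_set (\<lambda>n. pairing f (\<theta> n)) {1..N}" for f
  have moment: "pairing (monomial_dist j) (\<theta> n) = (if n = Suc j then 1 else 0)" if "n \<in> {1..N}" "j < N" for n j
    using \<theta>[of n "Suc j"] that by (simp add: monomial_dist.rep_eq)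
  \<comment> \<open>The numbering is shifted by one: \<open>\<theta> n\<close> reads off the
    coefficient of degree \<open>n - 1\<close>.\<close>
  have moment_sum: "pairing (\<Sum>j<N. c j *\<^sub>R monomial_dist j) (\<theta> n) = c (n - 1)" if n: "n \<in> {1..N}" for c n
  proof -
    have "pairing (\<Sum>j\<in>J. c j *\<^sub>R monomial_dist j) (\<theta> n) = (\<Sum>j\<in>J. c j * pairing (monomial_dist j) (\<theta> n))" for J
      by (induction J rule: infinite_finite_induct) (simp_all add: zero_dual.rep_eq plus_dual.rep_eq scaleR_dual.rep_eq)
    then have "pairing (\<Sum>j<N. c j *\<^sub>R monomial_dist j) (\<theta> n) = (\<Sum>j<N. c j * (if n = Suc j then 1 else 0))"
      using n by (simp add: moment)
    also have "\<dots> = (\<Sum>j<N. if n - 1 = j then c j else 0)" using n by (intro sum.cong) auto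
    also have "\<dots> = c (n - 1)" using n by (subst sum.delta') auto
    finally show ?thesis .
  qed
  have \<theta>1: "pairing (monomial_dist 0) (\<theta> 1) = 1" if "N \<noteq> 0" using moment[of 1 0] that by simp
  have "banach_on {f \<in> UNIV. L f \<in> range dist_of_radon_R} (\<lambda>f. norm (inv dist_of_radon_R (L f)) + s f)"
  proof (rule banach_on_pullback[OF lin(1) linear_dist_of_radon_R inj_dist_of_radon_R subspace_UNIV])
    fix c f g
    show "0 \<le> s f" by (simp add: s_def L2_set_nonneg)
    show "s (c *\<^sub>R f) = \<bar>c\<bar> * s f"
      using L2_set_right_distrib[of "\<bar>c\<bar>" "\<lambda>n. \<bar>pairing f (\<theta> n)\<bar>" "{1..N}"]
      by (simp add: s_def scaleR_dual.rep_eq L2_set_def power_mult_distrib)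
    show "s (f + g) \<le> s f + s g" unfolding s_def plus_dual.rep_eq by (rule L2_set_triangle_ineq)
  next
    fix f assume "L f = 0" "s f = 0"
    have "L\<^sub>i ((deriv_dist ^^ N) f) = L\<^sub>i 0" using \<open>L f = 0\<close> L2 linear_0[OF lin(2)] by simp
    then have D: "(deriv_dist ^^ N) f = 0" using bij by (simp add: bij_def inj_eq)
    show "f = 0"
    proof (cases "N = 0")
      case False
      obtain c where c: "f = (\<Sum>j<N. c j *\<^sub>R monomial_dist j)"
        using deriv_dist_power_eq_0_schwartz[OF \<theta>1[OF False] D] by blast
      have "c j = 0" if "j < N" for j
      proof -
        have "pairing f (\<theta> (Suc j)) = 0" using \<open>s f = 0\<close> that by (simp add: s_def L2_set_eq_0_iff)
        then show ?thesis using moment_sum[of "Suc j" c] that by (simp add: c)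
      qed
      then show ?thesis by (simp add: c)
    qed (use D in simp)
  next
    fix X :: "nat \<Rightarrow> schwartz dual" and b
    assume Cauchy: "\<forall>\<epsilon>>0. \<exists>k. \<forall>m\<ge>k. \<forall>n\<ge>k. s (X m - X n) < \<epsilon>"
    have "\<exists>a. (\<lambda>k. pairing (X k) (\<theta> n)) \<longlonglongrightarrow> a" if n: "n \<in> {1..N}" for n
    proof -
      have le: "\<bar>pairing (X k) (\<theta> n) - pairing (X l) (\<theta> n)\<bar> \<le> s (X k - X l)" for k l
      proof -
        have "\<bar>pairing (X k - X l) (\<theta> n)\<bar> \<le> L2_set (\<lambda>n. \<bar>pairing (X k - X l) (\<theta> n)\<bar>) {1..N}"
          using member_le_L2_set[OF _ n, of "\<lambda>n. \<bar>pairing (X k - X l) (\<theta> n)\<bar>"] by simp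
        then show ?thesis by (simp add: s_def L2_set_def minus_dual.rep_eq)
      qed
      have "Cauchy (\<lambda>k. pairing (X k) (\<theta> n))"
        unfolding Cauchy_def dist_real_def using Cauchy le by (meson le_less_trans)
      then show ?thesis using Cauchy_convergent convergent_def by blast
    qed
    then obtain a where a: "\<And>n. n \<in> {1..N} \<Longrightarrow> (\<lambda>k. pairing (X k) (\<theta> n)) \<longlonglongrightarrow> a n" by metis
    have "\<exists>g. (deriv_dist ^^ N) g = dist_of_radon_R b"
    proof (cases "N = 0")
      case False
      then show ?thesis using deriv_dist_power_surj_schwartz[OF \<theta>1] by blast
    qed simp
    then obtain g where g: "(deriv_dist ^^ N) g = dist_of_radon_R b" ..
    obtain h where h: "L\<^sub>i h = g" using bij by (metis bij_pointE)
    \<comment> \<open>\<open>h\<close> already solves the equation; the polynomial, invisible to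
      \<open>L\<close>, moves the pairing with each \<open>\<theta> n\<close> to its limit
      \<open>a n\<close>.\<close>
    define f where "f = h + (\<Sum>j<N. (a (Suc j) - pairing h (\<theta> (Suc j))) *\<^sub>R monomial_dist j)"
    have "(deriv_dist ^^ N) (\<Sum>j<N. (a (Suc j) - pairing h (\<theta> (Suc j))) *\<^sub>R monomial_dist j) = 0"
      by (simp add: linear_sum[OF linear_deriv_dist_power] linear_scale[OF linear_deriv_dist_power]
          deriv_dist_power_monomial_dist)
    then have "L f = dist_of_radon_R b"
      unfolding f_def linear_add[OF lin(1)] by (subst (2) L2) (simp add: L1[of h] h g linear_0[OF lin(2)])
    moreover have "(\<lambda>k. s (X k - f)) \<longlonglongrightarrow> 0"
    proof (rule tendsto_sandwich[OF _ _ tendsto_const])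
      have f: "pairing f (\<theta> n) = a n" if "n \<in> {1..N}" for n
        using moment_sum[OF that, of "\<lambda>j. a (Suc j) - pairing h (\<theta> (Suc j))"] that
        by (simp add: f_def plus_dual.rep_eq)
      have "(\<lambda>k. \<Sum>n\<in>{1..N}. \<bar>pairing (X k - f) (\<theta> n)\<bar>) \<longlonglongrightarrow> (\<Sum>n\<in>{1..N}. 0)"
        by (intro tendsto_sum tendsto_rabs_zero) (simp add: minus_dual.rep_eq f a LIM_zero)
      then show "(\<lambda>k. \<Sum>n\<in>{1..N}. \<bar>pairing (X k - f) (\<theta> n)\<bar>) \<longlonglongrightarrow> 0" by simp
    qed (auto simp: s_def L2_set_nonneg L2_set_le_sum_abs)
    ultimately show "\<exists>f\<in>UNIV. L f = dist_of_radon_R b \<and> (\<lambda>k. s (X k - f)) \<longlonglongrightarrow> 0" by blast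
  qed
  moreover have "native_R L = {f \<in> UNIV. L f \<in> range dist_of_radon_R}" by (simp add: native_R_def)
  moreover have "native_R_norm N \<theta> L = (\<lambda>f. norm (inv dist_of_radon_R (L f)) + s f)"
    by (simp add: fun_eq_iff native_R_norm_def radon_norm_R_def s_def)
  ultimately show ?thesis by simp
qed

lemma linear_mean_T: "linear mean_T"
  by (rule linearI) (simp_all add: mean_T_def plus_dual.rep_eq scaleR_dual.rep_eq)

text \<open>The two choices of \<open>U\<close> give the full space and the subspace of mean zero.
  Both are treated together because limits stay in \<open>U\<close> as soon as the means
  converge.\<close>

lemma banach_on_native_T_aux:
  assumes L: "admissible N L" and U: "U = UNIV \<or> U = {f. mean_T f = 0}"
  shows "banach_on {f \<in> U. L f \<in> range dist_of_radon_T} (native_T_norm N L)"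
proof -
  obtain L\<^sub>i where lin: "linear L" "linear L\<^sub>i" and bij: "bij L\<^sub>i" and cont: "continuous_on UNIV (inv L\<^sub>i)"
    and L1: "\<And>u. L u = (deriv_dist ^^ N) (L\<^sub>i u)" and L2: "\<And>u. L u = L\<^sub>i ((deriv_dist ^^ N) u)"
    using L difference_quotient_periodic by (rule admissibleE) blast
  define s where "s f = (if N = 0 then 0 else \<bar>mean_T f\<bar>)" for f
  have U_limit: "f \<in> U" if "\<And>k. X k \<in> U" "(\<lambda>k. mean_T (X k)) \<longlonglongrightarrow> mean_T f" for X :: "nat \<Rightarrow> periodic dual" and f
    using U that LIMSEQ_unique[OF that(2), of 0] by auto
  have mean_tendsto: "(\<lambda>k. mean_T (Y k)) \<longlonglongrightarrow> mean_T u" if "Y \<longlonglongrightarrow> u" for Y u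
    using that unfolding tendsto_dual_iff mean_T_def by blast
  have "subspace {f. mean_T f = 0}" using linear_subspace_kernel[OF linear_mean_T] .
  then have "subspace U" using U by auto
  have "banach_on {f \<in> U. L f \<in> range dist_of_radon_T} (\<lambda>f. norm (inv dist_of_radon_T (L f)) + s f)"
  proof (rule banach_on_pullback[OF lin(1) linear_dist_of_radon_T inj_dist_of_radon_T \<open>subspace U\<close>])
    fix c f g
    show "0 \<le> s f" by (simp add: s_def)
    show "s (c *\<^sub>R f) = \<bar>c\<bar> * s f" by (simp add: s_def linear_scale[OF linear_mean_T] abs_mult)
    show "s (f + g) \<le> s f + s g" by (simp add: s_def linear_add[OF linear_mean_T] abs_triangle_ineq)
  next
    fix f assume "L f = 0" "s f = 0"
    have "L\<^sub>i ((deriv_dist ^^ N) f) = L\<^sub>i 0" using \<open>L f = 0\<close> L2 linear_0[OF lin(2)] by simp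
    then have "(deriv_dist ^^ N) f = 0" using bij by (simp add: bij_def inj_eq)
    then show "f = 0"
      using \<open>s f = 0\<close> deriv_dist_power_eq_0_periodic[of N f] by (cases "N = 0") (simp_all add: s_def)
  next
    fix X :: "nat \<Rightarrow> periodic dual" and b
    assume XU: "\<And>k. X k \<in> U" and XL: "\<And>k. L (X k) \<in> range dist_of_radon_T"
      and b: "(\<lambda>k. inv dist_of_radon_T (L (X k))) \<longlonglongrightarrow> b"
      and Cauchy: "\<forall>\<epsilon>>0. \<exists>k. \<forall>m\<ge>k. \<forall>n\<ge>k. s (X m - X n) < \<epsilon>"
    have LX: "(\<lambda>k. L (X k)) \<longlonglongrightarrow> dist_of_radon_T b"
      using tendsto_dist_of_radon_T[OF b] XL by (simp add: f_inv_into_f)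
    show "\<exists>f\<in>U. L f = dist_of_radon_T b \<and> (\<lambda>k. s (X k - f)) \<longlonglongrightarrow> 0"
    proof (cases "N = 0")
      case True
      define f where "f = inv L\<^sub>i (dist_of_radon_T b)"
      have "L f = dist_of_radon_T b" using True L1 bij by (simp add: f_def bij_def surj_f_inv_f)
      moreover have "X \<longlonglongrightarrow> f"
        using continuous_on_tendsto_compose[OF cont LX] L1 True bij by (simp add: f_def bij_def)
      then have "f \<in> U" by (rule U_limit[of X, OF XU mean_tendsto])
      ultimately show ?thesis using True by (auto simp: s_def)
    next
      case False
      then obtain n where N: "N = Suc n" using not0_implies_Suc by blast
      have "Cauchy (\<lambda>k. mean_T (X k))"
        using Cauchy False by (simp add: Cauchy_def dist_real_def s_def linear_diff[OF linear_mean_T])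
      then obtain a where a: "(\<lambda>k. mean_T (X k)) \<longlonglongrightarrow> a" using Cauchy_convergent convergent_def by blast
      have "mean_T (L (X k)) = 0" for k by (simp add: L1 N mean_deriv_dist)
      then have "mean_T (dist_of_radon_T b) = 0" using LIMSEQ_unique[OF mean_tendsto[OF LX], of 0] by simp
      then obtain g where g: "(deriv_dist ^^ N) g = dist_of_radon_T b"
        using deriv_dist_power_surj_periodic by blast
      obtain h where h: "L\<^sub>i h = g" using bij by (metis bij_pointE)
      \<comment> \<open>\<open>constant_dist\<close> has mean 1 and is killed by \<open>L\<close> as
        \<open>N \<ge> 1\<close>, so this changes the mean from that of \<open>h\<close> to the
        limit \<open>a\<close>.\<close>
      define f where "f = h + (a - mean_T h) *\<^sub>R constant_dist"
      have "(deriv_dist ^^ N) constant_dist = 0"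
        using linear_0[OF linear_deriv_dist_power[of n]] by (simp add: N funpow_Suc_right deriv_constant_dist del: funpow.simps)
      then have "L constant_dist = 0" using L2 linear_0[OF lin(2)] by simp
      then have "L f = dist_of_radon_T b"
        by (simp add: f_def linear_add[OF lin(1)] linear_scale[OF lin(1)] L1[of h] h g)
      moreover have mean: "mean_T f = a"
        by (simp add: f_def linear_add[OF linear_mean_T] linear_scale[OF linear_mean_T] mean_constant_dist)
      have "f \<in> U" by (rule U_limit[of X, OF XU]) (simp add: mean a)
      moreover have "(\<lambda>k. s (X k - f)) \<longlonglongrightarrow> 0"
        using False a by (simp add: s_def linear_diff[OF linear_mean_T] mean tendsto_rabs_zero LIM_zero)
      ultimately show ?thesis by blast
    qed
  qed
  moreover have "native_T_norm N L = (\<lambda>f. norm (inv dist_of_radon_T (L f)) + s f)"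
    by (simp add: fun_eq_iff native_T_norm_def radon_norm_T_def s_def)
  ultimately show ?thesis by simp
qed

lemma banach_on_native_T: "admissible N L \<Longrightarrow> banach_on (native_T L) (native_T_norm N L)"
  using banach_on_native_T_aux[of N L UNIV] by (simp add: native_T_def)

lemma banach_on_native_T0: "admissible N L \<Longrightarrow> banach_on (native_T0 L) (native_T_norm N L)"
  using banach_on_native_T_aux[of N L "{f. mean_T f = 0}"] by (simp add: native_T0_def native_T_def conj_commute)

theorem proposition3:
  fixes N\<^sub>T N\<^sub>S :: nat
    and L\<^sub>T :: "schwartz dual \<Rightarrow> schwartz dual"
    and L\<^sub>S :: "periodic dual \<Rightarrow> periodic dual"
    and \<theta> :: "nat \<Rightarrow> schwartz"
    and p :: ereal
  assumes "admissible N\<^sub>T L\<^sub>T"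
    and "admissible N\<^sub>S L\<^sub>S"
    and "\<And>n m. n \<in> {1..N\<^sub>T} \<Longrightarrow> m \<in> {1..N\<^sub>T} \<Longrightarrow>
           (LINT t|lborel. schwartz_apply (\<theta> n) t * t ^ (m - 1)) = (if n = m then 1 else 0)"
    and "1 \<le> p"
  shows "banach_on (native N\<^sub>T L\<^sub>T L\<^sub>S) (native_norm p N\<^sub>T \<theta> L\<^sub>T N\<^sub>S L\<^sub>S)"
proof -
  define W where "W = (if N\<^sub>T = 0 then native_T L\<^sub>S else native_T0 L\<^sub>S)"
  have native: "native N\<^sub>T L\<^sub>T L\<^sub>S = native_R L\<^sub>T \<times> W" by (simp add: native_def W_def)
  have R: "banach_on (native_R L\<^sub>T) (native_R_norm N\<^sub>T \<theta> L\<^sub>T)"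
    using assms(1,3) by (rule banach_on_native_R)
  have T: "banach_on W (native_T_norm N\<^sub>S L\<^sub>S)"
    using assms(2) by (simp add: W_def banach_on_native_T banach_on_native_T0)
  show ?thesis
  proof (cases "p = \<infinity>")
    case True
    have "native_norm p N\<^sub>T \<theta> L\<^sub>T N\<^sub>S L\<^sub>S = (\<lambda>(x, y). max (native_R_norm N\<^sub>T \<theta> L\<^sub>T x) (native_T_norm N\<^sub>S L\<^sub>S y))"
      by (simp add: native_norm_def True)
    moreover have "banach_on (native_R L\<^sub>T \<times> W) (\<lambda>(x, y). max (native_R_norm N\<^sub>T \<theta> L\<^sub>T x) (native_T_norm N\<^sub>S L\<^sub>S y))"
      using R T by (rule banach_on_prod) (auto simp: max_mult_distrib_left)
    ultimately show ?thesis by (simp add: native)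
  next
    case False
    define r where "r = real_of_ereal p"
    have r: "1 \<le> r" using assms(4) False by (cases p) (auto simp: r_def one_ereal_def)
    have rr: "(a powr r) powr (1 / r) = a" if "0 \<le> a" for a using r that by (simp add: powr_powr)
    have "native_norm p N\<^sub>T \<theta> L\<^sub>T N\<^sub>S L\<^sub>S = (\<lambda>(x, y).
        (native_R_norm N\<^sub>T \<theta> L\<^sub>T x powr r + native_T_norm N\<^sub>S L\<^sub>S y powr r) powr (1 / r))"
      using False by (simp add: native_norm_def r_def)
    moreover have "banach_on (native_R L\<^sub>T \<times> W) (\<lambda>(x, y).
        (native_R_norm N\<^sub>T \<theta> L\<^sub>T x powr r + native_T_norm N\<^sub>S L\<^sub>S y powr r) powr (1 / r))"
      using R T
    proof (rule banach_on_prod[where P = "\<lambda>a b. (a powr r + b powr r) powr (1 / r)"])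
      fix a b c d :: real
      assume nonneg: "0 \<le> a" "0 \<le> b"
      have "(a powr r) powr (1 / r) \<le> (a powr r + b powr r) powr (1 / r)"
        "(b powr r) powr (1 / r) \<le> (a powr r + b powr r) powr (1 / r)"
        using r by (auto intro!: powr_mono2)
      then show "max a b \<le> (a powr r + b powr r) powr (1 / r)" by (simp add: rr nonneg)
      \<comment> \<open>Minkowski's inequality for the splitting of \<open>(a, b)\<close> into
        \<open>(a, 0)\<close> and \<open>(0, b)\<close>.\<close>
      show "(a powr r + b powr r) powr (1 / r) \<le> a + b"
        using powr_norm_triangle[OF r, of a 0 0 b] nonneg rr by simp
      show "((c * a) powr r + (c * b) powr r) powr (1 / r) = c * (a powr r + b powr r) powr (1 / r)" if "0 \<le> c"
        using that nonneg r by (simp add: powr_mult rr flip: distrib_left)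
      show "(a powr r + b powr r) powr (1 / r) \<le> (c powr r + d powr r) powr (1 / r)" if "a \<le> c" "b \<le> d"
        using that nonneg r by (intro powr_mono2 add_mono) auto
      show "((a + c) powr r + (b + d) powr r) powr (1 / r)
          \<le> (a powr r + b powr r) powr (1 / r) + (c powr r + d powr r) powr (1 / r)" if "0 \<le> c" "0 \<le> d"
        using powr_norm_triangle[OF r] nonneg that by blast
    qed
    ultimately show ?thesis by (simp add: native)
  qed
qed

end
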